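(* Let $G$ be an infinite finitely generated group with the special symbol property. Then: (1) the origin constrained domino problem $\mathtt{OCDP}(G\times\mathbb Z)$ is $\mathtt{WP}(G)'$-hard; (2) for any non-trivial finite group $H$, the domino problem $\mathtt{DP}((G\times\mathbb Z)\ast H)$ of the free product $(G\times\mathbb Z)\ast H$ is $\mathtt{WP}(G)'$-hard.
   Context: Let $K$ be a finitely generated group and $S\subset K$ a finite generating set closed under inverses and containing $1_K$. Words in $S^*$ represent elements of $K$; write $u=_K v$ if they represent the same element, and $\mathtt{WP}(K)=\{w\in S^*: w=_K 1_K\}$. For a finite alphabet $A$, $A^K$ has the product topology and the left shift action $(\sigma_g x)_h=x_{g^{-1}h}$. A subshift is a closed shift-invariant subset of some $A^K$. Put $[a]_g=\{x\in A^K: x_g=a\}$. A pattern coding over $A$ is a finite set $c$ of pairs $(w,a)$ with $w\in S^*$, $a\in A$; for a set $\mathcal F$ of pattern codings, $X_{\mathcal F}=\bigcap_{g\in K,\,c\in\mathcal F}\big(A^K\setminus\bigcap_{(w,a)\in c}[a]_{gw}\big)$. A subshift is an SFT if it equals $X_{\mathcal F}$ for some finite $\mathcal F$, and sofic if it is the image of an SFT on $K$ under a continuous shift-commuting map. $G$ has the special symbol property if the subshift $X_{\leq 1}\subset\{0,1\}^G$ of all configurations containing at most one occurrence of the symbol $1$ is sofic. $\mathtt{DP}(K)$ is the language of codings $\langle\mathcal F\rangle$ (including the finite alphabet) of finite sets $\mathcal F$ of pattern codings with $X_{\mathcal F}=\emptyset$. $\mathtt{OCDP}(K)$ is the language of pairs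 $(a,\langle\mathcal F\rangle)$, with $\mathcal F$ a finite set of pattern codings and $a$ a symbol of the alphabet, such that $X_{\mathcal F}\cap[a]_{1_K}=\emptyset$. A language is $\mathtt{WP}(G)'$-hard if it is at least as hard as the halting problem for Turing machines with oracle $\mathtt{WP}(G)$, i.e. the set of (descriptions of) Turing machines with oracle $\mathtt{WP}(G)$ that accept the empty input reduces to it by a computable many-one reduction. *)

theory Defs
  imports "HOL-Analysis.Analysis" "HOL-Algebra.Elementary_Groups" "HOL-Library.Nat_Bijection"
begin

section \<open>Words in the generators of a group\<close>

definition sym_gen_set :: "('g, 'm) monoid_scheme \<Rightarrow> 'g set \<Rightarrow> bool" where
  "sym_gen_set K S \<longleftrightarrow> finite S \<and> S \<subseteq> carrier K \<and> \<one>\<^bsub>K\<^esub> \<in> S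
     \<and> (\<forall>s\<in>S. inv\<^bsub>K\<^esub> s \<in> S) \<and> generate K S = carrier K"

definition word_val :: "('g, 'm) monoid_scheme \<Rightarrow> 'g list \<Rightarrow> 'g" where
  "word_val K w = foldr (\<lambda>s t. s \<otimes>\<^bsub>K\<^esub> t) w \<one>\<^bsub>K\<^esub>"

text \<open>A numbering \<open>\<nu>\<close>, injective on the finite set \<open>S\<close>, names the generators, so that words over
  \<open>S\<close> become strings over a finite set of natural numbers.\<close>

definition WP :: "('g, 'm) monoid_scheme \<Rightarrow> 'g set \<Rightarrow> ('g \<Rightarrow> nat) \<Rightarrow> nat list set" where
  "WP K S \<nu> = {map \<nu> w | w. w \<in> lists S \<and> word_val K w = \<one>\<^bsub>K\<^esub>}"


section \<open>Subshifts\<close>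

text \<open>Configurations are the functions on \<^term>\<open>carrier K\<close> that are \<^term>\<open>undefined\<close>
  elsewhere, the points of the product topology below. Symbols are natural numbers.\<close>

definition full_shift :: "('g, 'm) monoid_scheme \<Rightarrow> nat set \<Rightarrow> ('g \<Rightarrow> nat) set" where
  "full_shift K A = (carrier K \<rightarrow>\<^sub>E A)"

definition shift_topology :: "('g, 'm) monoid_scheme \<Rightarrow> nat set \<Rightarrow> ('g \<Rightarrow> nat) topology" where
  "shift_topology K A = product_topology (\<lambda>_. discrete_topology A) (carrier K)"

definition shift :: "('g, 'm) monoid_scheme \<Rightarrow> 'g \<Rightarrow> ('g \<Rightarrow> nat) \<Rightarrow> 'g \<Rightarrow> nat" where
  "shift K g x = (\<lambda>h\<in>carrier K. x (inv\<^bsub>K\<^esub> g \<otimes>\<^bsub>K\<^esub> h))"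

definition subshift :: "('g, 'm) monoid_scheme \<Rightarrow> nat set \<Rightarrow> ('g \<Rightarrow> nat) set \<Rightarrow> bool" where
  "subshift K A X \<longleftrightarrow> finite A \<and> closedin (shift_topology K A) X
     \<and> (\<forall>g\<in>carrier K. \<forall>x\<in>X. shift K g x \<in> X)"

definition cylinder :: "('g, 'm) monoid_scheme \<Rightarrow> nat set \<Rightarrow> nat \<Rightarrow> 'g \<Rightarrow> ('g \<Rightarrow> nat) set" where
  "cylinder K A a g = {x \<in> full_shift K A. x g = a}"

type_synonym 'g pattern_coding = "('g list \<times> nat) set"

definition pattern_coding :: "'g set \<Rightarrow> nat set \<Rightarrow> 'g pattern_coding \<Rightarrow> bool" where
  "pattern_coding S A c \<longleftrightarrow> finite c \<and> c \<subseteq> lists S \<times> A"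

definition X_forbid ::
    "('g, 'm) monoid_scheme \<Rightarrow> nat set \<Rightarrow> 'g pattern_coding set \<Rightarrow> ('g \<Rightarrow> nat) set" where
  "X_forbid K A F = {x \<in> full_shift K A. \<forall>g\<in>carrier K. \<forall>c\<in>F.
     x \<notin> (\<Inter>(w, a)\<in>c. cylinder K A a (g \<otimes>\<^bsub>K\<^esub> word_val K w))}"

definition SFT ::
    "('g, 'm) monoid_scheme \<Rightarrow> 'g set \<Rightarrow> nat set \<Rightarrow> ('g \<Rightarrow> nat) set \<Rightarrow> bool" where
  "SFT K S A X \<longleftrightarrow> subshift K A X
     \<and> (\<exists>F. finite F \<and> (\<forall>c\<in>F. pattern_coding S A c) \<and> X = X_forbid K A F)"

definition sofic ::
    "('g, 'm) monoid_scheme \<Rightarrow> 'g set \<Rightarrow> nat set \<Rightarrow> ('g \<Rightarrow> nat) set \<Rightarrow> bool" where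
  "sofic K S B Y \<longleftrightarrow> subshift K B Y
     \<and> (\<exists>A X \<phi>. SFT K S A X
          \<and> continuous_map (subtopology (shift_topology K A) X) (shift_topology K B) \<phi>
          \<and> (\<forall>g\<in>carrier K. \<forall>x\<in>X. \<phi> (shift K g x) = shift K g (\<phi> x))
          \<and> \<phi> ` X = Y)"

definition X_le_one :: "('g, 'm) monoid_scheme \<Rightarrow> ('g \<Rightarrow> nat) set" where
  "X_le_one K = {x \<in> full_shift K {0, 1}.
     \<forall>g\<in>carrier K. \<forall>h\<in>carrier K. x g = 1 \<and> x h = 1 \<longrightarrow> g = h}"

definition special_symbol_property :: "('g, 'm) monoid_scheme \<Rightarrow> 'g set \<Rightarrow> bool" where
  "special_symbol_property K S \<longleftrightarrow> sofic K S {0, 1} (X_le_one K)"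


section \<open>Domino problems\<close>

text \<open>Finite sets are presented by lists, in any order and possibly with repetitions, and the
  alphabet \<open>{..<k}\<close> by its size \<open>k\<close>.\<close>

type_synonym 'g coding_list = "('g list \<times> nat) list list"

definition forbidden_set :: "'g coding_list \<Rightarrow> 'g pattern_coding set" where
  "forbidden_set fs = set (map set fs)"

definition valid_codings :: "'g set \<Rightarrow> nat \<Rightarrow> 'g coding_list \<Rightarrow> bool" where
  "valid_codings S k fs \<longleftrightarrow> (\<forall>c\<in>forbidden_set fs. pattern_coding S {..<k} c)"

definition code_word :: "('g \<Rightarrow> nat) \<Rightarrow> 'g list \<Rightarrow> nat" where
  "code_word \<nu> w = list_encode (map \<nu> w)"

definition code_codings :: "('g \<Rightarrow> nat) \<Rightarrow> nat \<Rightarrow> 'g coding_list \<Rightarrow> nat" where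
  "code_codings \<nu> k fs = prod_encode (k,
     list_encode (map (\<lambda>c. list_encode (map (\<lambda>(w, a). prod_encode (code_word \<nu> w, a)) c)) fs))"

definition DP :: "('g, 'm) monoid_scheme \<Rightarrow> 'g set \<Rightarrow> ('g \<Rightarrow> nat) \<Rightarrow> nat set" where
  "DP K S \<nu> = {code_codings \<nu> k fs | k fs.
     valid_codings S k fs \<and> X_forbid K {..<k} (forbidden_set fs) = {}}"

definition OCDP :: "('g, 'm) monoid_scheme \<Rightarrow> 'g set \<Rightarrow> ('g \<Rightarrow> nat) \<Rightarrow> nat set" where
  "OCDP K S \<nu> = {prod_encode (a, code_codings \<nu> k fs) | a k fs.
     a < k \<and> valid_codings S k fs
     \<and> X_forbid K {..<k} (forbidden_set fs) \<inter> cylinder K {..<k} a \<one>\<^bsub>K\<^esub> = {}}"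


section \<open>Computable functions and many-one reductions\<close>

text \<open>\<open>recursive n f\<close>: \<open>f\<close> is a total recursive function of \<open>n\<close> arguments, given as a list of
  length \<open>n\<close>. Minimisation is restricted to regular functions, so that all functions are total.\<close>

inductive recursive :: "nat \<Rightarrow> (nat list \<Rightarrow> nat) \<Rightarrow> bool" where
  zero: "recursive n (\<lambda>_. 0)"
| succ: "recursive 1 (\<lambda>xs. Suc (xs ! 0))"
| proj: "i < n \<Longrightarrow> recursive n (\<lambda>xs. xs ! i)"
| comp: "recursive (length gs) f \<Longrightarrow> (\<forall>g\<in>set gs. recursive n g)
    \<Longrightarrow> recursive n (\<lambda>xs. f (map (\<lambda>g. g xs) gs))"
| prim_rec: "recursive n f \<Longrightarrow> recursive (Suc (Suc n)) g
    \<Longrightarrow> recursive (Suc n) (\<lambda>xs. rec_nat (f (tl xs)) (\<lambda>k r. g (k # r # tl xs)) (hd xs))"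
| minimise: "recursive (Suc n) f \<Longrightarrow> (\<forall>xs. length xs = n \<longrightarrow> (\<exists>y. f (y # xs) = 0))
    \<Longrightarrow> recursive n (\<lambda>xs. LEAST y. f (y # xs) = 0)"

definition computable :: "(nat \<Rightarrow> nat) \<Rightarrow> bool" where
  "computable f \<longleftrightarrow> (\<exists>F. recursive 1 F \<and> (\<forall>x. f x = F [x]))"

definition many_one_reducible :: "nat set \<Rightarrow> nat set \<Rightarrow> bool" where
  "many_one_reducible L L' \<longleftrightarrow> (\<exists>f. computable f \<and> (\<forall>n. n \<in> L \<longleftrightarrow> f n \<in> L'))"


section \<open>Turing machines with an oracle\<close>

text \<open>A deterministic machine with a read-write work tape, infinite to the right, and a write-only
  oracle tape. States and symbols are natural numbers, of which a machine mentions finitely many;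
  symbol \<open>0\<close> is the blank. A table entry \<open>((q, a), (q', b, d, e))\<close> says: in state \<open>q\<close> reading \<open>a\<close>
  on the work tape, go to state \<open>q'\<close>, write \<open>b\<close>, move in direction \<open>d\<close>, and append to the oracle
  tape the letter \<open>s\<close> if \<open>e = Some s\<close> and nothing if \<open>e = None\<close>. Only the first entry for a pair
  \<open>(q, a)\<close> counts; without an entry the machine halts and, unless it is in the accepting state,
  rejects.\<close>

datatype move = MoveL | MoveR

type_synonym otm = "((nat \<times> nat) \<times> (nat \<times> nat \<times> move \<times> nat option)) list"

abbreviation (input) q_start :: nat where "q_start \<equiv> 0"
abbreviation (input) q_accept :: nat where "q_accept \<equiv> 1"
abbreviation (input) q_query :: nat where "q_query \<equiv> 2"
abbreviation (input) q_yes :: nat where "q_yes \<equiv> 3"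
abbreviation (input) q_no :: nat where "q_no \<equiv> 4"

text \<open>State, work tape, head position, content of the oracle tape.\<close>

type_synonym otm_config = "nat \<times> (nat \<Rightarrow> nat) \<times> nat \<times> nat list"

text \<open>A left move on the leftmost cell leaves the head in place (truncated subtraction). A query
  tests the oracle tape for membership in the oracle and erases it.\<close>

inductive otm_step :: "nat list set \<Rightarrow> otm \<Rightarrow> otm_config \<Rightarrow> otm_config \<Rightarrow> bool"
  for Ora :: "nat list set" and M :: otm where
  query: "otm_step Ora M (q_query, t, h, w) (if w \<in> Ora then q_yes else q_no, t, h, [])"
| trans: "q \<noteq> q_query \<Longrightarrow> map_of M (q, t h) = Some (q', b, d, e) \<Longrightarrow>
    otm_step Ora M (q, t, h, w)
      (q', t(h := b), (case d of MoveL \<Rightarrow> h - 1 | MoveR \<Rightarrow> h + 1),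
       (case e of None \<Rightarrow> w | Some s \<Rightarrow> w @ [s]))"

definition accepts_empty :: "nat list set \<Rightarrow> otm \<Rightarrow> bool" where
  "accepts_empty Ora M \<longleftrightarrow>
     (\<exists>t h w. (otm_step Ora M)\<^sup>*\<^sup>* (q_start, \<lambda>_. 0, 0, []) (q_accept, t, h, w))"

definition code_otm :: "otm \<Rightarrow> nat" where
  "code_otm M = list_encode (map (\<lambda>((q, a), (q', b, d, e)).
     list_encode [q, a, q', b, case d of MoveL \<Rightarrow> 0 | MoveR \<Rightarrow> 1,
       case e of None \<Rightarrow> 0 | Some s \<Rightarrow> Suc s]) M)"

definition oracle_halting :: "nat list set \<Rightarrow> nat set" where
  "oracle_halting Ora = {code_otm M | M. accepts_empty Ora M}"

definition jump_hard :: "nat list set \<Rightarrow> nat set \<Rightarrow> bool" where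
  "jump_hard Ora L \<longleftrightarrow> many_one_reducible (oracle_halting Ora) L"

lemma inj_code_otm: "inj code_otm"
proof -
  have "inj (\<lambda>((q, a), (q', b, d, e)).
     list_encode [q, a, q', b, case d of MoveL \<Rightarrow> 0 | MoveR \<Rightarrow> 1,
       case e of None \<Rightarrow> 0 | Some s \<Rightarrow> Suc s])"
    by (rule injI) (auto simp: list_encode_eq split: move.splits option.splits)
  then show ?thesis
    unfolding code_otm_def
    by (intro inj_compose[OF inj_list_encode, unfolded comp_def]) simp
qed


section \<open>Free products\<close>

text \<open>\<open>G * H\<close> is the monoid of words over the disjoint union of \<open>G\<close> and \<open>H\<close>, modulo the
  congruence that identifies each unit with the empty word and evaluates products within a factor.\<close>

definition fp_words ::
    "('a, 'm) monoid_scheme \<Rightarrow> ('b, 'n) monoid_scheme \<Rightarrow> ('a + 'b) list set" where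
  "fp_words G H = lists (carrier G <+> carrier H)"

inductive fp_eq ::
    "('a, 'm) monoid_scheme \<Rightarrow> ('b, 'n) monoid_scheme \<Rightarrow> ('a + 'b) list \<Rightarrow> ('a + 'b) list \<Rightarrow> bool"
  for G :: "('a, 'm) monoid_scheme" and H :: "('b, 'n) monoid_scheme" where
  refl: "u \<in> fp_words G H \<Longrightarrow> fp_eq G H u u"
| sym: "fp_eq G H u v \<Longrightarrow> fp_eq G H v u"
| trans: "fp_eq G H u v \<Longrightarrow> fp_eq G H v w \<Longrightarrow> fp_eq G H u w"
| append: "fp_eq G H u u' \<Longrightarrow> fp_eq G H v v' \<Longrightarrow> fp_eq G H (u @ v) (u' @ v')"
| one_l: "fp_eq G H [Inl \<one>\<^bsub>G\<^esub>] []"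
| one_r: "fp_eq G H [Inr \<one>\<^bsub>H\<^esub>] []"
| mult_l: "x \<in> carrier G \<Longrightarrow> y \<in> carrier G \<Longrightarrow> fp_eq G H [Inl x, Inl y] [Inl (x \<otimes>\<^bsub>G\<^esub> y)]"
| mult_r: "x \<in> carrier H \<Longrightarrow> y \<in> carrier H \<Longrightarrow> fp_eq G H [Inr x, Inr y] [Inr (x \<otimes>\<^bsub>H\<^esub> y)]"

definition fp_rel ::
    "('a, 'm) monoid_scheme \<Rightarrow> ('b, 'n) monoid_scheme \<Rightarrow> (('a + 'b) list \<times> ('a + 'b) list) set" where
  "fp_rel G H = {(u, v). fp_eq G H u v}"

definition free_product ::
    "('a, 'm) monoid_scheme \<Rightarrow> ('b, 'n) monoid_scheme \<Rightarrow> ('a + 'b) list set monoid" where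
  "free_product G H = \<lparr>carrier = fp_words G H // fp_rel G H,
     mult = (\<lambda>X Y. \<Union>u\<in>X. \<Union>v\<in>Y. fp_rel G H `` {u @ v}),
     one = fp_rel G H `` {[]}\<rparr>"

lemma fp_eq_words:
  assumes "group G" "group H" "fp_eq G H u v"
  shows "u \<in> fp_words G H \<and> v \<in> fp_words G H"
proof -
  interpret G: group G by fact
  interpret H: group H by fact
  show ?thesis
    using assms(3) by induction (auto simp: fp_words_def)
qed

lemma equiv_fp_rel:
  assumes "group G" "group H"
  shows "equiv (fp_words G H) (fp_rel G H)"
  using fp_eq_words[OF assms]
  by (intro equivI refl_onI symI transI) (auto simp: fp_rel_def intro: fp_eq.intros)

lemma free_product_mult_class:
  assumes "group G" "group H" "u \<in> fp_words G H" "v \<in> fp_words G H"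
  shows "(fp_rel G H `` {u}) \<otimes>\<^bsub>free_product G H\<^esub> (fp_rel G H `` {v}) = fp_rel G H `` {u @ v}"
proof -
  have eq: "fp_rel G H `` {u' @ v'} = fp_rel G H `` {u @ v}"
    if "(u, u') \<in> fp_rel G H" "(v, v') \<in> fp_rel G H" for u' v'
    by (rule equiv_class_eq[OF equiv_fp_rel[OF assms(1,2)]])
       (use that in \<open>auto simp: fp_rel_def intro: fp_eq.sym fp_eq.append\<close>)
  have "u \<in> fp_rel G H `` {u}" "v \<in> fp_rel G H `` {v}"
    using assms(3,4) by (auto simp: fp_rel_def intro: fp_eq.refl)
  then have "(\<Union>u'\<in>fp_rel G H `` {u}. \<Union>v'\<in>fp_rel G H `` {v}. fp_rel G H `` {u' @ v'})
      = fp_rel G H `` {u @ v}"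
    using eq by blast
  then show ?thesis by (simp add: free_product_def)
qed

lemma fp_eq_cancel:
  assumes "group G" "group H" "u \<in> fp_words G H"
  shows "\<exists>v\<in>fp_words G H. fp_eq G H (v @ u) []"
proof -
  interpret G: group G by fact
  interpret H: group H by fact
  have "u \<in> lists (carrier G <+> carrier H)"
    using assms(3) by (simp add: fp_words_def)
  then show ?thesis
  proof (induction u)
    case Nil
    show ?case by (rule bexI[of _ "[]"]) (auto simp: fp_words_def intro: fp_eq.refl)
  next
    case (Cons a u)
    then obtain v where v: "v \<in> fp_words G H" "fp_eq G H (v @ u) []" by auto
    obtain b where b: "b \<in> carrier G <+> carrier H" "fp_eq G H [b, a] []"
      using Cons.hyps(1)
    proof (elim PlusE)
      fix x assume "a = Inl x" "x \<in> carrier G"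
      then show thesis
        using that[of "Inl (inv\<^bsub>G\<^esub> x)"]
          fp_eq.trans[OF fp_eq.mult_l[of "inv\<^bsub>G\<^esub> x" G x H]] fp_eq.one_l[of G H]
        by (simp add: InlI)
    next
      fix x assume "a = Inr x" "x \<in> carrier H"
      then show thesis
        using that[of "Inr (inv\<^bsub>H\<^esub> x)"]
          fp_eq.trans[OF fp_eq.mult_r[of "inv\<^bsub>H\<^esub> x" H x G]] fp_eq.one_r[of G H]
        by (simp add: InrI)
    qed
    have u: "u \<in> fp_words G H" using Cons.hyps by (simp add: fp_words_def)
    have "fp_eq G H ((v @ [b, a]) @ u) ((v @ []) @ u)"
      using v(1) u b(2) by (blast intro: fp_eq.intros)
    then have "fp_eq G H ((v @ [b]) @ a # u) []"
      using v(2) by (auto intro: fp_eq.trans)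
    moreover have "v @ [b] \<in> fp_words G H" using v b by (simp add: fp_words_def)
    ultimately show ?case by blast
  qed
qed

lemma group_free_product:
  assumes "group G" "group H"
  shows "group (free_product G H)"
proof (rule groupI)
  note cls = free_product_mult_class[OF assms]
  have nil: "[] \<in> fp_words G H" by (simp add: fp_words_def)
  have app: "u @ v \<in> fp_words G H" if "u \<in> fp_words G H" "v \<in> fp_words G H" for u v
    using that by (simp add: fp_words_def)
  have carr: "carrier (free_product G H) = fp_words G H // fp_rel G H"
    and one: "\<one>\<^bsub>free_product G H\<^esub> = fp_rel G H `` {[]}"
    by (simp_all add: free_product_def)
  show "\<one>\<^bsub>free_product G H\<^esub> \<in> carrier (free_product G H)"
    using nil by (simp add: carr one quotientI)
  show "x \<otimes>\<^bsub>free_product G H\<^esub> y \<in> carrier (free_product G H)"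
    if "x \<in> carrier (free_product G H)" "y \<in> carrier (free_product G H)" for x y
    using that unfolding carr by (elim quotientE) (simp add: cls app quotientI)
  show "x \<otimes>\<^bsub>free_product G H\<^esub> y \<otimes>\<^bsub>free_product G H\<^esub> z
      = x \<otimes>\<^bsub>free_product G H\<^esub> (y \<otimes>\<^bsub>free_product G H\<^esub> z)"
    if "x \<in> carrier (free_product G H)" "y \<in> carrier (free_product G H)"
      "z \<in> carrier (free_product G H)" for x y z
    using that unfolding carr by (elim quotientE) (simp add: cls app)
  show "\<one>\<^bsub>free_product G H\<^esub> \<otimes>\<^bsub>free_product G H\<^esub> x = x"
    if "x \<in> carrier (free_product G H)" for x
    using that unfolding carr one by (elim quotientE) (simp add: cls nil)
  show "\<exists>y\<in>carrier (free_product G H). y \<otimes>\<^bsub>free_product G H\<^esub> x = \<one>\<^bsub>free_product G H\<^esub>"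
    if "x \<in> carrier (free_product G H)" for x
  proof -
    obtain u where u: "u \<in> fp_words G H" "x = fp_rel G H `` {u}"
      using \<open>x \<in> carrier (free_product G H)\<close> unfolding carr by (elim quotientE)
    obtain v where v: "v \<in> fp_words G H" "fp_eq G H (v @ u) []"
      using fp_eq_cancel[OF assms u(1)] by blast
    have "fp_rel G H `` {v @ u} = fp_rel G H `` {[]}"
      by (rule equiv_class_eq[OF equiv_fp_rel[OF assms]]) (use v in \<open>simp add: fp_rel_def\<close>)
    then show ?thesis
      using u v by (intro bexI[of _ "fp_rel G H `` {v}"]) (simp_all add: carr one cls quotientI)
  qed
qed

end

theory Submission
  imports Defs
begin

text \<open>
  Let \<open>M\<close> be a machine with oracle \<open>WP G\<close>. The integer factor of \<open>G \<times> \<int>\<close> is read as time, and a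
  tiling with a prescribed symbol at the identity shows the run of \<open>M\<close> on the slices
  \<open>G \<times> {t}\<close>; a local rule forbids the accepting state, so such a tiling exists exactly if \<open>M\<close>
  does not accept. Four ideas make this work.

  \<^item> \<^emph>\<open>One seed.\<close> Local rules alone cannot mark a single element of \<open>G\<close>. The special symbol
    property can: the cells carry a point of the SFT that covers \<open>X\<^sub>\<le>\<^sub>1\<close>, constant in time, and
    a finite window of it tells whether a cell is the seed
    (\<open>continuous_map_finite_window\<close>, \<open>special_symbol_windows\<close>). Hence the only seed of a slice is the
    one enforced at the identity.

  \<^item> \<^emph>\<open>A tape.\<close> As \<open>G\<close> is infinite, its Cayley graph has an infinite path without repetitions from the
    identity (\<open>exists_injective_ray\<close>), even if \<open>G\<close> is a torsion group. The cells store the steps to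
    the next and the previous cell of the path. The seed has no previous cell, and the two kinds of
    steps have to agree, so a path of stored steps from the seed never comes back to it.

  \<^item> \<^emph>\<open>Broadcasting.\<close> Each slice carries one value, constant under the generators of \<open>G\<close>: the
    state of the machine, the symbol that it scans and the action that it takes. All cells of a
    slice thus learn what happens at the head.

  \<^item> \<^emph>\<open>The oracle.\<close> A pebble starts at the seed; when the machine appends a letter \<open>s\<close> to its
    oracle tape, the pebble moves from \<open>g\<close> to \<open>gs\<close>. At a query it lies at the element that the oracle
    tape represents, so that the answer is \<open>yes\<close> exactly if the pebble is at the seed. The word
    problem of \<open>G\<close> is answered by the geometry of \<open>G\<close> and never computed.

  That tilings show runs is \<open>displays_step\<close> and \<open>valid_tiling_imp_not_accepts\<close>; that runs can be
  drawn as tilings is \<open>valid_run_tiling\<close>. The rule is decidable uniformly in the code of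
  \<open>M\<close>, and its violations can be listed by one primitive recursion
  (\<open>rec_fun_code_rule_codings\<close>), which gives a computable reduction.

  In \<open>(G \<times> \<int>) * H\<close> no symbol is prescribed. Instead every coset \<open>gH\<close> is required to contain the
  prescribed symbol, so that some translate of \<open>G \<times> \<int>\<close> shows a tiling with that symbol at its
  identity. Conversely, such a tiling \<open>x\<close> extends to the free product by
  \<open>k \<mapsto> x(P_part k)\<close>, where \<open>P_part k\<close> is the last syllable of \<open>k\<close> if it lies in
  \<open>G \<times> \<int>\<close> and the identity otherwise: multiplying on the right by a non-trivial element of \<open>H\<close>
  turns the last syllable into one of \<open>H\<close>, which puts the prescribed symbol there.
\<close>

section \<open>Recursive functions and decidable relations\<close>

text \<open>Recursive functions up to their values on lists of other lengths than the arity, which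
  makes the notion stable under the usual ways of writing a function down.\<close>

definition rec_fun :: "nat \<Rightarrow> (nat list \<Rightarrow> nat) \<Rightarrow> bool" where
  "rec_fun n f \<longleftrightarrow> (\<exists>F. recursive n F \<and> (\<forall>xs. length xs = n \<longrightarrow> f xs = F xs))"

definition dec_pred :: "nat \<Rightarrow> (nat list \<Rightarrow> bool) \<Rightarrow> bool" where
  "dec_pred n P \<longleftrightarrow> rec_fun n (\<lambda>xs. of_bool (P xs))"

lemma rec_fun_cong:
  assumes "rec_fun n g" "\<And>xs. length xs = n \<Longrightarrow> f xs = g xs"
  shows "rec_fun n f"
  using assms unfolding rec_fun_def by auto

lemma dec_pred_cong:
  assumes "dec_pred n Q" "\<And>xs. length xs = n \<Longrightarrow> P xs = Q xs"
  shows "dec_pred n P"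
  using assms unfolding dec_pred_def by (auto intro: rec_fun_cong)

lemma rec_fun_comp:
  assumes "rec_fun (length gs) f" "\<And>g. g \<in> set gs \<Longrightarrow> rec_fun n g"
  shows "rec_fun n (\<lambda>xs. f (map (\<lambda>g. g xs) gs))"
proof -
  obtain F where F: "recursive (length gs) F" "\<And>xs. length xs = length gs \<Longrightarrow> f xs = F xs"
    using assms(1) unfolding rec_fun_def by auto
  have "\<forall>g\<in>set gs. \<exists>G. recursive n G \<and> (\<forall>xs. length xs = n \<longrightarrow> g xs = G xs)"
    using assms(2) unfolding rec_fun_def by blast
  then obtain c where c: "\<And>g. g \<in> set gs \<Longrightarrow> recursive n (c g)"
      "\<And>g xs. g \<in> set gs \<Longrightarrow> length xs = n \<Longrightarrow> g xs = c g xs"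
    by metis
  have "recursive n (\<lambda>xs. F (map (\<lambda>g. g xs) (map c gs)))"
    by (rule recursive.comp) (use F c in auto)
  moreover have "f (map (\<lambda>g. g xs) gs) = F (map (\<lambda>g. g xs) (map c gs))" if "length xs = n" for xs
  proof -
    have "map (\<lambda>g. g xs) gs = map (\<lambda>g. g xs) (map c gs)"
      using c(2)[OF _ that] by simp
    then show ?thesis using F(2)[of "map (\<lambda>g. g xs) gs"] by (simp only: length_map)
  qed
  ultimately show ?thesis unfolding rec_fun_def by blast
qed

lemma rec_fun_proj: "i < n \<Longrightarrow> rec_fun n (\<lambda>xs. xs ! i)"
  unfolding rec_fun_def by (blast intro: recursive.proj)

lemma rec_fun_app1:
  assumes "rec_fun 1 (\<lambda>xs. h (xs ! 0))" "rec_fun n f"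
  shows "rec_fun n (\<lambda>xs. h (f xs))"
  using rec_fun_comp[of "[f]" "\<lambda>xs. h (xs ! 0)" n] assms by simp

lemma rec_fun_app2:
  assumes "rec_fun 2 (\<lambda>xs. h (xs ! 0) (xs ! 1))" "rec_fun n f" "rec_fun n g"
  shows "rec_fun n (\<lambda>xs. h (f xs) (g xs))"
  using rec_fun_comp[of "[f, g]" "\<lambda>xs. h (xs ! 0) (xs ! 1)" n] assms
  by (auto simp: numeral_2_eq_2)

lemma rec_fun_app3:
  assumes "rec_fun 3 (\<lambda>xs. h (xs ! 0) (xs ! 1) (xs ! 2))" "rec_fun n f" "rec_fun n g" "rec_fun n k"
  shows "rec_fun n (\<lambda>xs. h (f xs) (g xs) (k xs))"
  using rec_fun_comp[of "[f, g, k]" "\<lambda>xs. h (xs ! 0) (xs ! 1) (xs ! 2)" n] assms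
  by (auto simp: numeral_3_eq_3 numeral_2_eq_2)

lemma rec_fun_Suc: "rec_fun n f \<Longrightarrow> rec_fun n (\<lambda>xs. Suc (f xs))"
  by (rule rec_fun_app1[where h = Suc]) (use recursive.succ in \<open>auto simp: rec_fun_def\<close>)

lemma rec_fun_const: "rec_fun n (\<lambda>_. c)"
proof (induction c)
  case 0
  then show ?case unfolding rec_fun_def by (blast intro: recursive.zero)
qed (rule rec_fun_Suc)

text \<open>Recursion at an arbitrary recursive argument, with the whole argument list as parameters: the
  primitive recursion scheme composed with the projections.\<close>

lemma rec_fun_rec_nat:
  assumes "rec_fun n a" "rec_fun n b" "rec_fun (Suc (Suc n)) g"
  shows "rec_fun n (\<lambda>xs. rec_nat (a xs) (\<lambda>k r. g (k # r # xs)) (b xs))"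
proof -
  obtain F G where F: "recursive n F" "\<And>xs. length xs = n \<Longrightarrow> a xs = F xs"
    and G: "recursive (Suc (Suc n)) G" "\<And>xs. length xs = Suc (Suc n) \<Longrightarrow> g xs = G xs"
    using assms(1,3) unfolding rec_fun_def by blast
  let ?R = "\<lambda>xs. rec_nat (F (tl xs)) (\<lambda>k r. G (k # r # tl xs)) (hd xs)"
  let ?gs = "b # map (\<lambda>i xs. xs ! i) [0..<n]"
  have "recursive (Suc n) ?R"
    by (rule recursive.prim_rec[OF F(1) G(1)])
  then have "rec_fun (length ?gs) ?R"
    unfolding rec_fun_def by auto
  then have "rec_fun n (\<lambda>xs. ?R (map (\<lambda>g. g xs) ?gs))"
    by (rule rec_fun_comp) (use assms(2) in \<open>auto intro: rec_fun_proj\<close>)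
  then show ?thesis
  proof (rule rec_fun_cong)
    fix xs :: "nat list" assume "length xs = n"
    then have "map (\<lambda>g. g xs) ?gs = b xs # xs"
      by (auto intro: nth_equalityI)
    then show "rec_nat (a xs) (\<lambda>k r. g (k # r # xs)) (b xs) = ?R (map (\<lambda>g. g xs) ?gs)"
      using F(2) G(2) \<open>length xs = n\<close> by simp
  qed
qed

text \<open>Truncated predecessor and truncated subtraction turn order and equality into arithmetic.\<close>

lemma rec_fun_pred: "rec_fun n f \<Longrightarrow> rec_fun n (\<lambda>xs. f xs - 1)"
proof (rule rec_fun_app1[where h = "\<lambda>x. x - 1"])
  have "rec_fun 1 (\<lambda>xs. rec_nat 0 (\<lambda>k r. (k # r # xs) ! 0) (xs ! 0))"
    by (rule rec_fun_rec_nat) (auto intro: rec_fun_proj rec_fun_const)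
  moreover have "rec_nat 0 (\<lambda>k r. k) x = x - 1" for x :: nat
    by (cases x) auto
  ultimately show "rec_fun 1 (\<lambda>xs. xs ! 0 - 1)" by simp
qed

lemma rec_fun_add: "rec_fun n f \<Longrightarrow> rec_fun n g \<Longrightarrow> rec_fun n (\<lambda>xs. f xs + g xs)"
proof (rule rec_fun_app2[where h = "(+)"])
  have "rec_fun 2 (\<lambda>xs. rec_nat (xs ! 0) (\<lambda>k r. Suc ((k # r # xs) ! 1)) (xs ! 1))"
    by (rule rec_fun_rec_nat) (auto intro!: rec_fun_proj rec_fun_Suc)
  moreover have "rec_nat x (\<lambda>k r. Suc r) y = x + y" for x y :: nat
    by (induction y) auto
  ultimately show "rec_fun 2 (\<lambda>xs. xs ! 0 + xs ! 1)" by simp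
qed

lemma rec_fun_diff: "rec_fun n f \<Longrightarrow> rec_fun n g \<Longrightarrow> rec_fun n (\<lambda>xs. f xs - g xs)"
proof (rule rec_fun_app2[where h = "(-)"])
  have "rec_fun 2 (\<lambda>xs. rec_nat (xs ! 0) (\<lambda>k r. (k # r # xs) ! 1 - 1) (xs ! 1))"
    by (rule rec_fun_rec_nat) (auto intro!: rec_fun_proj rec_fun_pred[unfolded One_nat_def])
  moreover have "rec_nat x (\<lambda>k r. r - 1) y = x - y" for x y :: nat
    by (induction y) auto
  ultimately show "rec_fun 2 (\<lambda>xs. xs ! 0 - xs ! 1)" by simp
qed

lemma rec_fun_mult: "rec_fun n f \<Longrightarrow> rec_fun n g \<Longrightarrow> rec_fun n (\<lambda>xs. f xs * g xs)"
proof (rule rec_fun_app2[where h = "(*)"])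
  have "rec_fun 2 (\<lambda>xs. rec_nat 0 (\<lambda>k r. (k # r # xs) ! 1 + (k # r # xs) ! 2) (xs ! 1))"
    by (rule rec_fun_rec_nat) (auto intro!: rec_fun_proj rec_fun_add rec_fun_const)
  moreover have "rec_nat 0 (\<lambda>k r. r + x) y = x * y" for x y :: nat
    by (induction y) auto
  ultimately show "rec_fun 2 (\<lambda>xs. xs ! 0 * xs ! 1)" by simp
qed

lemma dec_pred_not:
  assumes "dec_pred n P"
  shows "dec_pred n (\<lambda>xs. \<not> P xs)"
  using rec_fun_diff[OF rec_fun_const[of n 1] assms[unfolded dec_pred_def]]
  unfolding dec_pred_def by (rule rec_fun_cong) auto

lemma dec_pred_conj:
  assumes "dec_pred n P" "dec_pred n Q"
  shows "dec_pred n (\<lambda>xs. P xs \<and> Q xs)"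
  using rec_fun_mult[OF assms[unfolded dec_pred_def]]
  unfolding dec_pred_def by (rule rec_fun_cong) auto

lemma dec_pred_disj:
  assumes "dec_pred n P" "dec_pred n Q"
  shows "dec_pred n (\<lambda>xs. P xs \<or> Q xs)"
  using dec_pred_not[OF dec_pred_conj[OF assms[THEN dec_pred_not]]]
  by (rule dec_pred_cong) auto

lemma dec_pred_imp:
  assumes "dec_pred n P" "dec_pred n Q"
  shows "dec_pred n (\<lambda>xs. P xs \<longrightarrow> Q xs)"
  using dec_pred_disj[OF dec_pred_not[OF assms(1)] assms(2)]
  by (rule dec_pred_cong) auto

lemma dec_pred_const: "dec_pred n (\<lambda>_. c)"
  unfolding dec_pred_def by (rule rec_fun_const)

lemma dec_pred_le:
  assumes "rec_fun n f" "rec_fun n g"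
  shows "dec_pred n (\<lambda>xs. f xs \<le> g xs)"
  using rec_fun_diff[OF rec_fun_const[of n 1] rec_fun_diff[OF assms]]
  unfolding dec_pred_def by (rule rec_fun_cong) auto

lemma dec_pred_less:
  assumes "rec_fun n f" "rec_fun n g"
  shows "dec_pred n (\<lambda>xs. f xs < g xs)"
  using dec_pred_le[OF rec_fun_Suc[OF assms(1)] assms(2)]
  by (rule dec_pred_cong) auto

lemma dec_pred_eq:
  assumes "rec_fun n f" "rec_fun n g"
  shows "dec_pred n (\<lambda>xs. f xs = g xs)"
  using dec_pred_conj[OF dec_pred_le[OF assms] dec_pred_le[OF assms(2,1)]]
  by (rule dec_pred_cong) auto

text \<open>The bound is a constant here, so the quantifier is a finite conjunction.\<close>

lemma dec_pred_bounded_all: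
  fixes m :: nat
  assumes "\<And>j. j < m \<Longrightarrow> dec_pred n (P j)"
  shows "dec_pred n (\<lambda>xs. \<forall>j<m. P j xs)"
  using assms
proof (induction m)
  case 0
  then show ?case by (simp add: dec_pred_const)
next
  case (Suc m)
  then have "dec_pred n (\<lambda>xs. (\<forall>j<m. P j xs) \<and> P m xs)"
    by (intro dec_pred_conj) auto
  then show ?case by (rule dec_pred_cong) (auto simp: less_Suc_eq)
qed

lemma dec_pred_bounded_ex:
  fixes m :: nat
  assumes "\<And>j. j < m \<Longrightarrow> dec_pred n (P j)"
  shows "dec_pred n (\<lambda>xs. \<exists>j<m. P j xs)"
proof -
  have "dec_pred n (\<lambda>xs. \<not> (\<forall>j<m. \<not> P j xs))"
    using assms by (intro dec_pred_not dec_pred_bounded_all)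
  then show ?thesis by (rule dec_pred_cong) auto
qed

lemma dec_pred_finite_mem:
  assumes "finite A" "rec_fun n f"
  shows "dec_pred n (\<lambda>xs. f xs \<in> A)"
  using assms(1)
proof (induction A rule: finite_induct)
  case empty
  then show ?case by (simp add: dec_pred_const)
next
  case (insert a A)
  from dec_pred_disj[OF dec_pred_eq[OF assms(2) rec_fun_const[of n a]] insert.IH]
  show ?case by (rule dec_pred_cong) simp
qed

lemma rec_fun_if:
  assumes "dec_pred n P" "rec_fun n f" "rec_fun n g"
  shows "rec_fun n (\<lambda>xs. if P xs then f xs else g xs)"
  using rec_fun_add[OF rec_fun_mult[OF assms(1)[unfolded dec_pred_def] assms(2)]
      rec_fun_mult[OF dec_pred_not[OF assms(1), unfolded dec_pred_def] assms(3)]]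
  by (rule rec_fun_cong) simp

lemma rec_fun_Least:
  assumes "dec_pred (Suc n) P" "\<And>xs. length xs = n \<Longrightarrow> \<exists>y. P (y # xs)"
  shows "rec_fun n (\<lambda>xs. LEAST y. P (y # xs))"
proof -
  obtain F where F: "recursive (Suc n) F"
      "\<And>xs. length xs = Suc n \<Longrightarrow> of_bool (\<not> P xs) = F xs"
    using dec_pred_not[OF assms(1)] unfolding dec_pred_def rec_fun_def by auto
  have eq: "F (y # xs) = 0 \<longleftrightarrow> P (y # xs)" if "length xs = n" for y xs
    using F(2)[of "y # xs"] that by (cases "P (y # xs)") auto
  have "recursive n (\<lambda>xs. LEAST y. F (y # xs) = 0)"
    by (rule recursive.minimise[OF F(1)]) (use assms(2) eq in auto)
  then show ?thesis
    unfolding rec_fun_def using eq by (intro exI conjI) auto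
qed

lemmas rec_intros = rec_fun_proj rec_fun_const rec_fun_add rec_fun_diff rec_fun_mult rec_fun_Suc
  dec_pred_conj dec_pred_disj dec_pred_imp dec_pred_le dec_pred_less dec_pred_eq dec_pred_const
  dec_pred_not rec_fun_if

section \<open>Recursiveness of the pairing and list codings\<close>

lemma rec_fun_triangle: "rec_fun n f \<Longrightarrow> rec_fun n (\<lambda>xs. triangle (f xs))"
proof (rule rec_fun_app1[where h = triangle])
  have "rec_fun 1 (\<lambda>xs. rec_nat 0 (\<lambda>k r. (k # r # xs) ! 1 + Suc ((k # r # xs) ! 0)) (xs ! 0))"
    by (rule rec_fun_rec_nat) (auto intro!: rec_intros)
  moreover have "rec_nat 0 (\<lambda>k r. r + Suc k) x = triangle x" for x
    by (induction x) auto
  ultimately show "rec_fun 1 (\<lambda>xs. triangle (xs ! 0))" by simp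
qed

lemma rec_fun_prod_encode:
  "rec_fun n f \<Longrightarrow> rec_fun n g \<Longrightarrow> rec_fun n (\<lambda>xs. prod_encode (f xs, g xs))"
  unfolding prod_encode_def by (auto intro!: rec_intros rec_fun_triangle)

lemma mono_triangle: "i \<le> j \<Longrightarrow> triangle i \<le> triangle j"
  by (induction j) (auto simp: le_Suc_eq)

text \<open>The code of \<open>(x, y)\<close> lies between the triangular numbers of \<open>x + y\<close> and of \<open>x + y + 1\<close>, so
  one minimisation recovers \<open>x + y\<close> and with it both components.\<close>

lemma prod_decode_eq_diff:
  defines "s \<equiv> \<lambda>z. LEAST s. z < triangle (Suc s)"
  shows "prod_decode z = (z - triangle (s z), s z - (z - triangle (s z)))"
proof -
  obtain x y where xy: "prod_decode z = (x, y)" by fastforce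
  have z: "z = triangle (x + y) + x"
    using prod_decode_inverse[of z] xy by (simp add: prod_encode_def)
  have "s z = x + y"
    unfolding s_def
  proof (rule Least_equality)
    show "z < triangle (Suc (x + y))" using z by simp
    fix t assume "z < triangle (Suc t)"
    then show "x + y \<le> t" using z mono_triangle[of "Suc t" "x + y"] by fastforce
  qed
  then show ?thesis using xy z by simp
qed

lemma rec_fun_prod_decode:
  assumes "rec_fun n f"
  shows "rec_fun n (\<lambda>xs. fst (prod_decode (f xs)))" "rec_fun n (\<lambda>xs. snd (prod_decode (f xs)))"
proof -
  have ex: "\<exists>s. z < triangle (Suc s)" for z
    by (rule exI[of _ z]) (induction z, auto)
  have "rec_fun 1 (\<lambda>xs. LEAST s. (s # xs) ! 1 < triangle (Suc ((s # xs) ! 0)))"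
    by (rule rec_fun_Least) (use ex in \<open>auto intro!: rec_intros rec_fun_triangle\<close>)
  then have s: "rec_fun 1 (\<lambda>xs. LEAST s. xs ! 0 < triangle (Suc s))" by simp
  show "rec_fun n (\<lambda>xs. fst (prod_decode (f xs)))"
    by (rule rec_fun_app1[where h = "\<lambda>z. fst (prod_decode z)", OF _ assms],
        subst prod_decode_eq_diff)
       (use s in \<open>auto simp del: triangle_Suc intro!: rec_intros rec_fun_triangle\<close>)
  show "rec_fun n (\<lambda>xs. snd (prod_decode (f xs)))"
    by (rule rec_fun_app1[where h = "\<lambda>z. snd (prod_decode z)", OF _ assms],
        subst prod_decode_eq_diff)
       (use s in \<open>auto simp del: triangle_Suc intro!: rec_intros rec_fun_triangle\<close>)
qed

text \<open>Access to the entries of a list through its code. Beyond the end of the list the codes of the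
  tails are \<open>0\<close>, so these functions are total.\<close>

definition code_tl :: "nat \<Rightarrow> nat" where
  "code_tl z = snd (prod_decode (z - 1))"

definition code_drop :: "nat \<Rightarrow> nat \<Rightarrow> nat" where
  "code_drop i z = (code_tl ^^ i) z"

definition code_nth :: "nat \<Rightarrow> nat \<Rightarrow> nat" where
  "code_nth i z = fst (prod_decode (code_drop i z - 1))"

lemma prod_decode_0: "prod_decode 0 = (0, 0)"
  using prod_encode_inverse[of "(0, 0)"] by (simp add: prod_encode_def del: prod_encode_inverse)

lemma code_drop_list_encode [simp]: "code_drop i (list_encode xs) = list_encode (drop i xs)"
proof -
  have tl: "code_tl (list_encode ys) = list_encode (tl ys)" for ys
    by (cases ys) (auto simp: code_tl_def prod_decode_0)
  show ?thesis
    unfolding code_drop_def by (induction i) (simp_all add: tl drop_Suc tl_drop)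
qed

lemma code_nth_list_encode [simp]: "i < length xs \<Longrightarrow> code_nth i (list_encode xs) = xs ! i"
  unfolding code_nth_def by (simp add: Cons_nth_drop_Suc[symmetric])

lemma list_encode_eq_0_iff: "list_encode xs = 0 \<longleftrightarrow> xs = []"
  by (cases xs) auto

lemma code_nth_le: "code_nth i z \<le> z"
proof -
  have tl: "code_tl z \<le> z" for z
    using le_prod_encode_2[of "snd (prod_decode (z - 1))" "fst (prod_decode (z - 1))"]
    unfolding code_tl_def by simp
  have "code_drop i z \<le> z"
    unfolding code_drop_def by (induction i) (auto intro: order.trans[OF tl])
  moreover have "fst (prod_decode y) \<le> y" for y
    using le_prod_encode_1[of "fst (prod_decode y)" "snd (prod_decode y)"] by simp
  ultimately show ?thesis unfolding code_nth_def by (meson diff_le_self order.trans)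
qed

lemma rec_fun_code_drop:
  "rec_fun n f \<Longrightarrow> rec_fun n g \<Longrightarrow> rec_fun n (\<lambda>xs. code_drop (f xs) (g xs))"
proof (rule rec_fun_app2[where h = code_drop])
  have "rec_fun 2 (\<lambda>xs. rec_nat (xs ! 1) (\<lambda>k r. snd (prod_decode ((k # r # xs) ! 1 - 1))) (xs ! 0))"
    by (rule rec_fun_rec_nat[where g = "\<lambda>ys. snd (prod_decode (ys ! 1 - 1))"])
      (auto intro!: rec_intros rec_fun_prod_decode)
  moreover have "rec_nat z (\<lambda>k r. snd (prod_decode (r - 1))) i = code_drop i z" for i z
    by (induction i) (auto simp: code_drop_def code_tl_def)
  ultimately show "rec_fun 2 (\<lambda>xs. code_drop (xs ! 0) (xs ! 1))" by simp
qed

lemma rec_fun_code_nth: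
  "rec_fun n f \<Longrightarrow> rec_fun n g \<Longrightarrow> rec_fun n (\<lambda>xs. code_nth (f xs) (g xs))"
  unfolding code_nth_def
  by (intro rec_fun_prod_decode rec_intros rec_fun_code_drop)

text \<open>Codes of lists of a fixed length with bounded entries are bounded; this bounds the search
  for forbidden patterns and the size of the alphabet.\<close>

lemma list_encode_mono:
  "list_all2 (\<le>) xs ys \<Longrightarrow> list_encode xs \<le> list_encode ys"
proof (induction rule: list_all2_induct)
  case (Cons x xs y ys)
  then have "triangle (x + list_encode xs) + x \<le> triangle (y + list_encode ys) + y"
    by (intro add_mono mono_triangle) auto
  then show ?case by (simp add: prod_encode_def)
qed simp

section \<open>Words, windows and rays in finitely generated groups\<close>

lemma word_val_Nil [simp]: "word_val K [] = \<one>\<^bsub>K\<^esub>"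
  and word_val_Cons [simp]: "word_val K (s # w) = s \<otimes>\<^bsub>K\<^esub> word_val K w"
  by (auto simp: word_val_def)

lemma word_val_closed:
  assumes "group K" "w \<in> lists (carrier K)"
  shows "word_val K w \<in> carrier K"
proof -
  interpret group K by fact
  show ?thesis using assms(2) by (induction w) auto
qed

lemma word_val_append:
  assumes "group K" "u \<in> lists (carrier K)" "v \<in> lists (carrier K)"
  shows "word_val K (u @ v) = word_val K u \<otimes>\<^bsub>K\<^esub> word_val K v"
proof -
  interpret group K by fact
  show ?thesis using assms(2)
    by (induction u) (auto simp: m_assoc word_val_closed[OF assms(1)] assms(3))
qed

lemma sym_gen_set_word:
  assumes "group K" "sym_gen_set K T" "k \<in> carrier K"
  shows "\<exists>w\<in>lists T. word_val K w = k"
proof -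
  interpret group K by fact
  have T: "T \<subseteq> carrier K" "\<And>s. s \<in> T \<Longrightarrow> inv\<^bsub>K\<^esub> s \<in> T"
    using assms(2) by (auto simp: sym_gen_set_def)
  have "k \<in> generate K T" using assms(2,3) by (simp add: sym_gen_set_def)
  then show ?thesis
  proof (induction rule: generate.induct)
    case one
    then show ?case by (intro bexI[of _ "[]"]) auto
  next
    case (incl h)
    then show ?case using T by (intro bexI[of _ "[h]"]) auto
  next
    case (inv h)
    then show ?case using T(1) T(2)[OF inv] by (intro bexI[of _ "[inv\<^bsub>K\<^esub> h]"]) auto
  next
    case (eng h1 h2)
    then obtain u v where "u \<in> lists T" "v \<in> lists T" "word_val K u = h1" "word_val K v = h2"
      by auto
    then show ?case using T(1) lists_mono[OF T(1)]
      by (intro bexI[of _ "u @ v"]) (auto simp: word_val_append[OF assms(1)] subset_iff)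
  qed
qed

text \<open>Why local rules can broadcast: what no generator changes is constant on the whole group.\<close>

lemma invariant_under_generators_const:
  assumes "group K" "sym_gen_set K T"
    and "\<And>g s. g \<in> carrier K \<Longrightarrow> s \<in> T \<Longrightarrow> f (g \<otimes>\<^bsub>K\<^esub> s) = f g"
    and "k \<in> carrier K"
  shows "f k = f \<one>\<^bsub>K\<^esub>"
proof -
  interpret group K by fact
  have T: "T \<subseteq> carrier K" using assms(2) by (simp add: sym_gen_set_def)
  obtain w where w: "w \<in> lists T" "word_val K w = k"
    using sym_gen_set_word[OF assms(1,2,4)] by auto
  have "f (word_val K w) = f \<one>\<^bsub>K\<^esub>" using w(1)
  proof (induction w rule: rev_induct)
    case (snoc s w)
    then have s: "s \<in> T" "s \<in> carrier K" "w \<in> lists (carrier K)" using T by auto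
    then show ?case
      using snoc assms(3)[of "word_val K w" s]
      by (simp add: word_val_append[OF assms(1)] word_val_closed[OF assms(1)])
  qed simp
  then show ?thesis using w(2) by simp
qed

text \<open>The Curtis--Hedlund--Lyndon theorem: by compactness, a continuous map on a subshift reads only
  a finite window of its argument to determine one symbol of the image.\<close>

lemma continuous_map_finite_window:
  assumes "finite A" "closedin (shift_topology K A) X"
    and cont: "continuous_map (subtopology (shift_topology K A) X) (shift_topology K B) \<phi>"
    and g0: "g0 \<in> carrier K"
  shows "\<exists>D. finite D \<and> D \<subseteq> carrier K \<and>
    (\<forall>x\<in>X. \<forall>y\<in>X. (\<forall>d\<in>D. x d = y d) \<longrightarrow> \<phi> x g0 = \<phi> y g0)"
proof -
  let ?P = "shift_topology K A"
  have top: "topspace ?P = (carrier K \<rightarrow>\<^sub>E A)"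
    by (simp add: shift_topology_def)
  have X: "X \<subseteq> topspace ?P" using assms(2) by (rule closedin_subset)
  have "compact_space ?P"
    using \<open>finite A\<close> unfolding shift_topology_def
    by (simp add: compact_space_product_topology compact_space_discrete_topology)
  then have comp: "compactin ?P X"
    using assms(2) by (rule closedin_compact_space)
  have cont0: "continuous_map (subtopology ?P X) (discrete_topology B) (\<lambda>x. \<phi> x g0)"
    using cont g0 unfolding shift_topology_def by (simp add: continuous_map_componentwise)
  \<comment> \<open>Near each point, finitely many symbols already determine the value.\<close>
  have "\<exists>D. finite D \<and> D \<subseteq> carrier K \<and> (\<forall>z\<in>X. (\<forall>d\<in>D. z d = x d) \<longrightarrow> \<phi> z g0 = \<phi> x g0)"
    if x: "x \<in> X" for x
  proof -
    have "\<phi> x g0 \<in> B"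
      using continuous_map_funspace[OF cont0] x X by auto
    then have "openin (subtopology ?P X) {z \<in> topspace (subtopology ?P X). \<phi> z g0 \<in> {\<phi> x g0}}"
      by (intro openin_continuous_map_preimage[OF cont0]) auto
    then obtain V where V: "openin ?P V"
        "{z \<in> topspace (subtopology ?P X). \<phi> z g0 \<in> {\<phi> x g0}} = V \<inter> X"
      unfolding openin_subtopology by auto
    have "x \<in> V" using V(2) x X by auto
    then obtain U where U: "finite {i \<in> carrier K. U i \<noteq> topspace (discrete_topology A)}"
        "x \<in> Pi\<^sub>E (carrier K) U" "Pi\<^sub>E (carrier K) U \<subseteq> V"
      using V(1) unfolding shift_topology_def openin_product_topology_alt by metis
    let ?D = "{i \<in> carrier K. U i \<noteq> A}"
    have "\<phi> z g0 = \<phi> x g0" if z: "z \<in> X" "\<forall>d\<in>?D. z d = x d" for z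
    proof -
      have "z \<in> Pi\<^sub>E (carrier K) U"
      proof (rule PiE_I)
        fix i assume i: "i \<in> carrier K"
        show "z i \<in> U i"
          using z i U(2) X top by (cases "U i = A") (auto simp: PiE_iff subset_iff)
      next
        fix i assume "i \<notin> carrier K"
        then show "z i = undefined" using z(1) X top PiE_arb[of z "carrier K" "\<lambda>_. A" i] by blast
      qed
      then show ?thesis using V(2) U(3) z(1) by auto
    qed
    then show ?thesis using U(1) by (intro exI[of _ ?D]) auto
  qed
  then obtain D where D: "\<And>x. x \<in> X \<Longrightarrow> finite (D x) \<and> D x \<subseteq> carrier K"
      "\<And>x z. x \<in> X \<Longrightarrow> z \<in> X \<Longrightarrow> \<forall>d\<in>D x. z d = x d \<Longrightarrow> \<phi> z g0 = \<phi> x g0"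
    by metis
  \<comment> \<open>Finitely many of these neighbourhoods cover \<open>X\<close>; the union of their windows is the window.\<close>
  let ?C = "\<lambda>x. Pi\<^sub>E (carrier K) (\<lambda>i. if i \<in> D x then {x i} else A)"
  have "openin ?P (?C x)" if "x \<in> X" for x
    unfolding shift_topology_def
    using D(1)[OF that] PiE_mem[of x "carrier K" "\<lambda>_. A"] subsetD[OF X that] top
    by (intro product_topology_basis) (auto intro: finite_subset[of _ "D x"])
  moreover have "X \<subseteq> \<Union>(?C ` X)"
  proof
    fix x assume x: "x \<in> X"
    then have "x \<in> carrier K \<rightarrow>\<^sub>E A" using X top by blast
    then have "x \<in> ?C x" by (auto simp: PiE_iff)
    then show "x \<in> \<Union>(?C ` X)" using x by blast
  qed
  ultimately have "\<exists>F. finite F \<and> F \<subseteq> ?C ` X \<and> X \<subseteq> \<Union>F"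
    using comp unfolding compactin_def by auto
  then obtain X0 where X0: "finite X0" "X0 \<subseteq> X" "X \<subseteq> \<Union>(?C ` X0)"
    by (auto dest: finite_subset_image)
  let ?D = "\<Union>(D ` X0)"
  have "\<phi> x g0 = \<phi> y g0" if xy: "x \<in> X" "y \<in> X" "\<forall>d\<in>?D. x d = y d" for x y
  proof -
    obtain x0 where x0: "x0 \<in> X0" "x \<in> ?C x0" using X0(3) xy(1) by blast
    have "x d = x0 d" if "d \<in> D x0" for d
      using x0 D(1)[of x0] X0(2) that by (auto simp: PiE_iff split: if_splits)
    then show ?thesis
      using D(2)[of x0 x] D(2)[of x0 y] x0(1) X0(2) xy by auto
  qed
  moreover have "finite ?D" "?D \<subseteq> carrier K" using X0(1,2) D(1) by blast+
  ultimately show ?thesis by (intro exI[of _ ?D]) blast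
qed

text \<open>Koenig's lemma applied to the tree of geodesic words: an infinite finitely generated group
  contains a one-sided infinite injective path from the identity in its Cayley graph.\<close>

lemma exists_injective_ray:
  assumes "group K" "sym_gen_set K S" "infinite (carrier K)"
  shows "\<exists>r::nat \<Rightarrow> _. r 0 = \<one>\<^bsub>K\<^esub> \<and> inj r \<and> range r \<subseteq> carrier K
    \<and> (\<forall>i. \<exists>s\<in>S. r (Suc i) = r i \<otimes>\<^bsub>K\<^esub> s)"
proof -
  interpret group K by fact
  have S: "S \<subseteq> carrier K" "finite S" using assms(2) by (auto simp: sym_gen_set_def)
  then have lS: "w \<in> lists S \<Longrightarrow> w \<in> lists (carrier K)" for w by auto
  note val_append = word_val_append[OF assms(1) lS lS]
  define geo where "geo w \<longleftrightarrow> w \<in> lists S \<and>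
    (\<forall>v\<in>lists S. word_val K v = word_val K w \<longrightarrow> length w \<le> length v)" for w
  \<comment> \<open>The words above which the tree is infinite: each has a successor of the same kind.\<close>
  define good where "good w \<longleftrightarrow> infinite {u. geo (w @ u)}" for w
  have geo_prefix: "geo w" if "geo (w @ u)" for w u
    unfolding geo_def
  proof (intro conjI ballI impI)
    show w: "w \<in> lists S" using that by (auto simp: geo_def)
    have u: "u \<in> lists S" using that by (auto simp: geo_def)
    fix v assume v: "v \<in> lists S" "word_val K v = word_val K w"
    have "word_val K (v @ u) = word_val K (w @ u)"
      using v w u by (simp add: val_append)
    then have "length (w @ u) \<le> length (v @ u)"
      using that v u unfolding geo_def by (metis append_in_lists_conv)
    then show "length w \<le> length v" by simp
  qed
  have good_geo: "geo w" if "good w" for w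
  proof -
    have "{u. geo (w @ u)} \<noteq> {}" using that unfolding good_def by (metis finite.emptyI)
    then show ?thesis using geo_prefix by auto
  qed
  have "good []"
  proof -
    have "\<exists>w. geo w \<and> word_val K w = k" if k: "k \<in> carrier K" for k
    proof -
      obtain w where w: "w \<in> lists S \<and> word_val K w = k"
        using sym_gen_set_word[OF assms(1,2) k] by auto
      from ex_has_least_nat[of "\<lambda>w. w \<in> lists S \<and> word_val K w = k", OF w, of length]
      show ?thesis unfolding geo_def by blast
    qed
    then have "carrier K \<subseteq> word_val K ` {u. geo ([] @ u)}" by auto
    then show ?thesis unfolding good_def using assms(3) finite_surj by blast
  qed
  have step: "\<exists>v. good v \<and> (\<exists>s\<in>S. v = w @ [s])" if "good w" for w
  proof (rule ccontr)
    assume no: "\<nexists>v. good v \<and> (\<exists>s\<in>S. v = w @ [s])"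
    have "{u. geo (w @ u)} \<subseteq> insert [] (\<Union>s\<in>S. Cons s ` {u. geo ((w @ [s]) @ u)})"
    proof
      fix u assume u: "u \<in> {u. geo (w @ u)}"
      show "u \<in> insert [] (\<Union>s\<in>S. Cons s ` {u. geo ((w @ [s]) @ u)})"
        using u by (cases u) (auto simp: geo_def)
    qed
    moreover have "finite (insert [] (\<Union>s\<in>S. Cons s ` {u. geo ((w @ [s]) @ u)}))"
    proof (intro finite.insertI finite_UN_I finite_imageI S(2))
      fix s assume "s \<in> S"
      then show "finite {u. geo ((w @ [s]) @ u)}" using no unfolding good_def by blast
    qed
    ultimately show False using that finite_subset unfolding good_def by blast
  qed
  obtain W where W: "W 0 = []" "\<And>n. good (W n)" "\<And>n. \<exists>s\<in>S. W (Suc n) = W n @ [s]"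
  proof -
    have "\<exists>W. \<forall>n. (good (W n) \<and> (n = 0 \<longrightarrow> W n = [])) \<and> (\<exists>s\<in>S. W (Suc n) = W n @ [s])"
      by (rule dependent_nat_choice) (use \<open>good []\<close> step in auto)
    then show thesis using that by auto
  qed
  have len: "length (W n) = n" for n
  proof (induction n)
    case (Suc n)
    then show ?case using W(3)[of n] by auto
  qed (simp add: W)
  have geoW: "geo (W n)" for n using good_geo W(2) by simp
  have WS: "W n \<in> lists S" for n using geoW[of n] by (simp add: geo_def)
  show ?thesis
  proof (intro exI[of _ "\<lambda>n. word_val K (W n)"] conjI allI)
    show "word_val K (W 0) = \<one>\<^bsub>K\<^esub>" by (simp add: W)
    \<comment> \<open>Two geodesic words for the same element have the same length.\<close>
    show "inj (\<lambda>n. word_val K (W n))"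
    proof (rule injI)
      fix i j assume "word_val K (W i) = word_val K (W j)"
      then show "i = j"
        using geoW[of i] geoW[of j] len[of i] len[of j] WS unfolding geo_def by (metis le_antisym)
    qed
    show "range (\<lambda>n. word_val K (W n)) \<subseteq> carrier K"
      using WS lS word_val_closed[OF assms(1)] by blast
    fix i
    show "\<exists>s\<in>S. word_val K (W (Suc i)) = word_val K (W i) \<otimes>\<^bsub>K\<^esub> s"
    proof -
      obtain s where "s \<in> S" "W (Suc i) = W i @ [s]" using W(3) by blast
      then show ?thesis using S WS by (intro bexI[of _ s]) (auto simp: val_append)
    qed
  qed
qed

section \<open>Oracle machines and their codes\<close>

lemma rec_fun_list_encode_map:
  assumes "\<And>j. rec_fun n (f j)"
  shows "rec_fun n (\<lambda>xs. list_encode (map (\<lambda>j. f j xs) js))"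
  using assms by (induction js) (auto intro!: rec_intros rec_fun_prod_encode)

text \<open>The step relation made total: a configuration without successor repeats forever.\<close>

fun oracle_next :: "nat list set \<Rightarrow> otm \<Rightarrow> otm_config \<Rightarrow> otm_config" where
  "oracle_next Ora M (q, t, h, w) =
     (if q = q_query then (if w \<in> Ora then q_yes else q_no, t, h, [])
      else case map_of M (q, t h) of None \<Rightarrow> (q, t, h, w)
        | Some (q', b, d, e) \<Rightarrow> (q', t(h := b), (case d of MoveL \<Rightarrow> h - 1 | MoveR \<Rightarrow> h + 1),
            (case e of None \<Rightarrow> w | Some s \<Rightarrow> w @ [s])))"

definition oracle_run :: "nat list set \<Rightarrow> otm \<Rightarrow> nat \<Rightarrow> otm_config" where
  "oracle_run Ora M i = (oracle_next Ora M ^^ i) (q_start, \<lambda>_. 0, 0, [])"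

lemma accepts_empty_iff_run: "accepts_empty Ora M \<longleftrightarrow> (\<exists>i. fst (oracle_run Ora M i) = q_accept)"
proof -
  let ?c0 = "(q_start, \<lambda>_. 0, 0, []) :: otm_config"
  have step: "c' = oracle_next Ora M c" if "otm_step Ora M c c'" for c c'
    using that by cases (auto split: move.splits option.splits)
  have "\<exists>i. c = oracle_run Ora M i" if "(otm_step Ora M)\<^sup>*\<^sup>* ?c0 c" for c
    using that
  proof (induction rule: rtranclp_induct)
    case base
    have "?c0 = oracle_run Ora M 0" by (simp add: oracle_run_def)
    then show ?case by blast
  next
    case (step c c')
    then obtain i where "c = oracle_run Ora M i" by auto
    then have "c' = oracle_run Ora M (Suc i)"
      using \<open>\<And>c' c. otm_step Ora M c c' \<Longrightarrow> c' = oracle_next Ora M c\<close>[OF step(2)]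
      by (simp add: oracle_run_def)
    then show ?case by blast
  qed
  moreover have "(otm_step Ora M)\<^sup>*\<^sup>* ?c0 (oracle_run Ora M i)" for i
  proof (induction i)
    case (Suc i)
    obtain q t h w where c: "oracle_run Ora M i = (q, t, h, w)" by (cases "oracle_run Ora M i") auto
    have "(otm_step Ora M)\<^sup>*\<^sup>* (q, t, h, w) (oracle_next Ora M (q, t, h, w))"
    proof (cases "q = q_query")
      case True
      then show ?thesis using otm_step.query[of Ora M t h w] by auto
    next
      case False
      then show ?thesis
        using otm_step.trans[OF False, of M t h _ _ _ _ Ora w]
        by (cases "map_of M (q, t h)") (auto intro: r_into_rtranclp)
    qed
    then show ?case using Suc c by (auto simp: oracle_run_def)
  qed (simp add: oracle_run_def)
  ultimately show ?thesis
    unfolding accepts_empty_def by (metis fst_conv prod.collapse)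
qed

definition move_code :: "move \<Rightarrow> nat" where
  "move_code d = (case d of MoveL \<Rightarrow> 0 | MoveR \<Rightarrow> 1)"

definition letter_code :: "nat option \<Rightarrow> nat" where
  "letter_code e = (case e of None \<Rightarrow> 0 | Some s \<Rightarrow> Suc s)"

definition entry_code :: "(nat \<times> nat) \<times> (nat \<times> nat \<times> move \<times> nat option) \<Rightarrow> nat" where
  "entry_code = (\<lambda>((q, a), (q', b, d, e)). list_encode [q, a, q', b, move_code d, letter_code e])"

lemma code_otm_eq: "code_otm M = list_encode (map entry_code M)"
  unfolding code_otm_def entry_code_def move_code_def letter_code_def ..

lemma code_nth_entry_code [simp]:
  "code_nth 0 (entry_code ((q, a), (q', b, d, e))) = q"
  "code_nth (Suc 0) (entry_code ((q, a), (q', b, d, e))) = a"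
  "code_nth 2 (entry_code ((q, a), (q', b, d, e))) = q'"
  "code_nth 3 (entry_code ((q, a), (q', b, d, e))) = b"
  "code_nth 4 (entry_code ((q, a), (q', b, d, e))) = move_code d"
  "code_nth 5 (entry_code ((q, a), (q', b, d, e))) = letter_code e"
  unfolding entry_code_def by (simp_all del: list_encode.simps)

text \<open>A search that always ends, since it stops at the end of the coded list at the latest.\<close>

definition first_pos :: "(nat \<Rightarrow> bool) \<Rightarrow> nat \<Rightarrow> nat" where
  "first_pos P z = (LEAST i. code_drop i z = 0 \<or> P (code_nth i z))"

lemma ex_code_drop_0: "\<exists>i. code_drop i z = 0"
  by (rule exI[of _ "length (list_decode z)"])
    (metis code_drop_list_encode drop_all list_decode_inverse list_encode.simps(1) order_refl)

lemma first_pos_list_encode: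
  "(if code_drop (first_pos P (list_encode zs)) (list_encode zs) = 0
    then find P zs = None
    else find P zs = Some (code_nth (first_pos P (list_encode zs)) (list_encode zs)))"
proof -
  let ?z = "list_encode zs" and ?i = "first_pos P (list_encode zs)"
  have i: "code_drop ?i ?z = 0 \<or> P (code_nth ?i ?z)"
    unfolding first_pos_def by (rule LeastI_ex) (use ex_code_drop_0[of ?z] in blast)
  have less: "\<not> P (zs ! k)" if "k < ?i" "k < length zs" for k
    using not_less_Least[OF that(1)[unfolded first_pos_def]] that(2) by simp
  show ?thesis
  proof (cases "code_drop ?i ?z = 0")
    case True
    then have "length zs \<le> ?i" by (simp add: list_encode_eq_0_iff)
    then have "\<forall>x\<in>set zs. \<not> P x" using less by (auto simp: in_set_conv_nth)
    then show ?thesis using True by (simp add: find_None_iff)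
  next
    case False
    then have "?i < length zs" by (simp add: list_encode_eq_0_iff)
    then show ?thesis
      using False i less by (auto simp: find_Some_iff intro!: exI[of _ ?i])
  qed
qed

lemma map_of_eq_find: "map_of M k = map_option snd (find (\<lambda>p. fst p = k) M)"
  by (induction M) auto

text \<open>The behaviour of a machine in state \<open>q\<close> reading \<open>a\<close>, read off from the code \<open>n\<close> of the
  machine. Direction \<open>2\<close> leaves the head in place; letter \<open>0\<close> means that nothing is written on
  the oracle tape. Which answer a query receives is left open.\<close>

definition entry_pos :: "nat \<Rightarrow> nat \<Rightarrow> nat \<Rightarrow> nat" where
  "entry_pos n q a = first_pos (\<lambda>z. code_nth 0 z = q \<and> code_nth 1 z = a) n"

definition action_ok :: "nat \<Rightarrow> nat \<Rightarrow> nat \<Rightarrow> nat \<Rightarrow> nat \<Rightarrow> nat \<Rightarrow> nat \<Rightarrow> bool" where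
  "action_ok n q a q' b d e \<longleftrightarrow>
     (q = q_query \<longrightarrow> (q' = q_yes \<or> q' = q_no) \<and> b = a \<and> d = 2 \<and> e = 0) \<and>
     (q \<noteq> q_query \<and> code_drop (entry_pos n q a) n = 0 \<longrightarrow> q' = q \<and> b = a \<and> d = 2 \<and> e = 0) \<and>
     (q \<noteq> q_query \<and> code_drop (entry_pos n q a) n \<noteq> 0 \<longrightarrow>
        q' = code_nth 2 (code_nth (entry_pos n q a) n) \<and>
        b = code_nth 3 (code_nth (entry_pos n q a) n) \<and>
        d = code_nth 4 (code_nth (entry_pos n q a) n) \<and>
        e = code_nth 5 (code_nth (entry_pos n q a) n))"

lemma action_ok_code_otm:
  assumes "q \<noteq> q_query"
  shows "action_ok (code_otm M) q a q' b d e \<longleftrightarrow>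
    (q', b, d, e) = (case map_of M (q, a) of None \<Rightarrow> (q, a, 2, 0)
       | Some (p, b', d', e') \<Rightarrow> (p, b', move_code d', letter_code e'))"
proof -
  let ?P = "\<lambda>z. code_nth 0 z = q \<and> code_nth 1 z = a"
  have P: "?P (entry_code p) \<longleftrightarrow> fst p = (q, a)" for p
    by (cases p) auto
  have "find ?P (map entry_code M) = map_option entry_code (find (\<lambda>p. fst p = (q, a)) M)"
    by (induction M) (use P in \<open>auto simp del: One_nat_def\<close>)
  then have fp: "if code_drop (entry_pos (code_otm M) q a) (code_otm M) = 0
      then find (\<lambda>p. fst p = (q, a)) M = None
      else map_option entry_code (find (\<lambda>p. fst p = (q, a)) M)
        = Some (code_nth (entry_pos (code_otm M) q a) (code_otm M))"
    using first_pos_list_encode[of ?P "map entry_code M"]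
    unfolding code_otm_eq entry_pos_def by (simp del: code_drop_list_encode split: if_splits)
  show ?thesis
  proof (cases "find (\<lambda>p. fst p = (q, a)) M")
    case None
    then show ?thesis
      using fp assms unfolding action_ok_def map_of_eq_find by (auto split: if_splits)
  next
    case (Some r)
    obtain q0 a0 p b' d' e' where r: "r = ((q0, a0), (p, b', d', e'))" by (cases r) auto
    then have "code_nth (entry_pos (code_otm M) q a) (code_otm M) = entry_code ((q0, a0), (p, b', d', e'))"
      "code_drop (entry_pos (code_otm M) q a) (code_otm M) \<noteq> 0"
      using fp Some by (auto split: if_splits)
    then show ?thesis
      using assms Some r unfolding action_ok_def map_of_eq_find by auto
  qed
qed

text \<open>Every number is the code of a list, so the codes of machines are the numbers whose entries are
  codes of lists of length six with a proper direction.\<close>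

definition bad_entry :: "nat \<Rightarrow> bool" where
  "bad_entry z \<longleftrightarrow> code_drop 6 z \<noteq> 0 \<or> code_drop 5 z = 0 \<or> code_nth 4 z > 1"

definition is_otm_code :: "nat \<Rightarrow> bool" where
  "is_otm_code n \<longleftrightarrow> code_drop (first_pos bad_entry n) n = 0"

lemma not_bad_entry_iff: "\<not> bad_entry z \<longleftrightarrow> z \<in> range entry_code"
proof
  assume z: "\<not> bad_entry z"
  define ys where "ys = list_decode z"
  have zy: "z = list_encode ys" by (simp add: ys_def)
  have "length ys = 6"
    using z unfolding bad_entry_def zy by (simp add: list_encode_eq_0_iff)
  then obtain q a q' b d e where ys: "ys = [q, a, q', b, d, e]"
    by (auto simp: numeral_eq_Suc length_Suc_conv)
  have "code_nth 4 z = d"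
    unfolding zy ys by (simp del: list_encode.simps)
  then have "d \<le> 1"
    using z unfolding bad_entry_def by simp
  then have "d = move_code (if d = 0 then MoveL else MoveR)"
    by (auto simp: move_code_def)
  moreover have "e = letter_code (if e = 0 then None else Some (e - 1))"
    by (auto simp: letter_code_def)
  ultimately have "z = entry_code ((q, a), (q', b, (if d = 0 then MoveL else MoveR),
      (if e = 0 then None else Some (e - 1))))"
    unfolding entry_code_def zy ys by simp
  then show "z \<in> range entry_code" by blast
next
  assume "z \<in> range entry_code"
  then obtain q a q' b d e where z: "z = entry_code ((q, a), (q', b, d, e))" by auto
  have "code_drop 6 z = 0" "code_drop 5 z \<noteq> 0"
    unfolding z entry_code_def by (simp_all del: list_encode.simps add: list_encode_eq_0_iff)
  moreover have "code_nth 4 z \<le> 1"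
    unfolding z by (auto simp: move_code_def split: move.split)
  ultimately show "\<not> bad_entry z" by (auto simp: bad_entry_def)
qed

lemma is_otm_code_iff: "is_otm_code n \<longleftrightarrow> n \<in> range code_otm"
proof -
  define zs where "zs = list_decode n"
  have n: "n = list_encode zs" by (simp add: zs_def)
  have "is_otm_code n \<longleftrightarrow> find bad_entry zs = None"
    using first_pos_list_encode[of bad_entry zs] unfolding is_otm_code_def n
    by (cases "code_drop (first_pos bad_entry (list_encode zs)) (list_encode zs) = 0") simp_all
  also have "\<dots> \<longleftrightarrow> set zs \<subseteq> range entry_code"
    using not_bad_entry_iff by (auto simp: find_None_iff)
  also have "\<dots> \<longleftrightarrow> (\<exists>M. zs = map entry_code M)"
    unfolding ex_map_conv by blast
  also have "\<dots> \<longleftrightarrow> n \<in> range code_otm"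
    unfolding n code_otm_eq by (auto simp: list_encode_eq)
  finally show ?thesis .
qed

text \<open>The predicate and the coded list may depend on the arguments; the search variable is the head
  of the longer argument list.\<close>

lemma rec_fun_first_pos:
  assumes "dec_pred (Suc n) (\<lambda>ys. P (tl ys) (code_nth (hd ys) (f (tl ys))))" "rec_fun n f"
    and "rec_fun (Suc n) (\<lambda>ys. f (tl ys))"
  shows "rec_fun n (\<lambda>xs. first_pos (P xs) (f xs))"
proof -
  have "rec_fun (Suc n) (\<lambda>ys. hd ys)"
    by (rule rec_fun_cong[OF rec_fun_proj[of 0]]) (auto intro!: hd_conv_nth)
  then have "dec_pred (Suc n) (\<lambda>ys. code_drop (hd ys) (f (tl ys)) = 0 \<or>
      P (tl ys) (code_nth (hd ys) (f (tl ys))))"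
    by (intro rec_intros rec_fun_code_drop assms)
  then have "rec_fun n (\<lambda>xs. LEAST y. code_drop (hd (y # xs)) (f (tl (y # xs))) = 0 \<or>
      P (tl (y # xs)) (code_nth (hd (y # xs)) (f (tl (y # xs)))))"
    by (rule rec_fun_Least) (use ex_code_drop_0 in auto)
  then show ?thesis by (simp add: first_pos_def)
qed

lemma tl_nth: "length ys = Suc n \<Longrightarrow> i < n \<Longrightarrow> tl ys ! i = ys ! Suc i"
  by (simp add: nth_tl)

lemma rec_fun_entry_pos:
  "rec_fun n f \<Longrightarrow> rec_fun n g \<Longrightarrow> rec_fun n h \<Longrightarrow>
    rec_fun n (\<lambda>xs. entry_pos (f xs) (g xs) (h xs))"
proof (rule rec_fun_app3[where h = entry_pos])
  have tl: "rec_fun (Suc 3) (\<lambda>ys. tl ys ! i)" if "i < 3" for i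
    by (rule rec_fun_cong[OF rec_fun_proj[of "Suc i"]]) (use that in \<open>auto simp: tl_nth\<close>)
  have hd: "rec_fun (Suc 3) (\<lambda>ys. hd ys)"
    by (rule rec_fun_cong[OF rec_fun_proj[of 0]]) (auto intro!: hd_conv_nth)
  show "rec_fun 3 (\<lambda>xs. entry_pos (xs ! 0) (xs ! 1) (xs ! 2))"
    unfolding entry_pos_def
    by (rule rec_fun_first_pos[where f = "\<lambda>xs. xs ! 0"
          and P = "\<lambda>xs z. code_nth 0 z = xs ! 1 \<and> code_nth 1 z = xs ! 2"])
       (intro rec_intros rec_fun_code_nth tl hd; simp)+
qed

lemma dec_pred_action_ok:
  assumes "rec_fun n f" "rec_fun n q" "rec_fun n a" "rec_fun n q'" "rec_fun n b" "rec_fun n d"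
    "rec_fun n e"
  shows "dec_pred n (\<lambda>xs. action_ok (f xs) (q xs) (a xs) (q' xs) (b xs) (d xs) (e xs))"
  unfolding action_ok_def
  by (intro rec_intros rec_fun_code_nth rec_fun_code_drop rec_fun_entry_pos assms)

lemma dec_pred_is_otm_code:
  assumes "rec_fun n f"
  shows "dec_pred n (\<lambda>xs. is_otm_code (f xs))"
proof -
  have hd: "rec_fun (Suc 1) (\<lambda>ys. hd ys)"
    by (rule rec_fun_cong[OF rec_fun_proj[of 0]]) (auto intro!: hd_conv_nth)
  have tl: "rec_fun (Suc 1) (\<lambda>ys. tl ys ! 0)"
    by (rule rec_fun_cong[OF rec_fun_proj[of 1]]) (auto simp: tl_nth)
  have "rec_fun 1 (\<lambda>xs. first_pos bad_entry (xs ! 0))"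
    unfolding bad_entry_def
    by (rule rec_fun_first_pos[where f = "\<lambda>xs. xs ! 0" and
          P = "\<lambda>_ z. code_drop 6 z \<noteq> 0 \<or> code_drop 5 z = 0 \<or> code_nth 4 z > 1"])
       (intro rec_intros rec_fun_code_nth rec_fun_code_drop tl hd; simp)+
  then have "rec_fun n (\<lambda>xs. first_pos bad_entry (f xs))"
    using assms by (rule rec_fun_app1)
  then show ?thesis
    unfolding is_otm_code_def
    by (intro rec_intros rec_fun_code_drop assms)
qed

section \<open>Computing the forbidden patterns of a decidable local rule\<close>

text \<open>A rule that is decided by the symbols at \<open>N\<close> fixed places relative to a cell. All candidate
  patterns are enumerated as codes of lists of length \<open>N\<close>; those that break the rule are forbidden.\<close>

definition rule_shift ::
    "('g, 'm) monoid_scheme \<Rightarrow> nat \<Rightarrow> 'g list \<Rightarrow> ((nat \<Rightarrow> nat) \<Rightarrow> bool) \<Rightarrow> ('g \<Rightarrow> nat) set" where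
  "rule_shift K k ps R = {x \<in> full_shift K {..<k}.
     \<forall>g\<in>carrier K. R (\<lambda>j. x (g \<otimes>\<^bsub>K\<^esub> (ps ! j)))}"

definition broken_code :: "nat \<Rightarrow> nat \<Rightarrow> ((nat \<Rightarrow> nat) \<Rightarrow> bool) \<Rightarrow> nat \<Rightarrow> bool" where
  "broken_code N k R v \<longleftrightarrow> (\<forall>j<N. code_nth j v < k) \<and> \<not> R (\<lambda>j. code_nth j v)"

definition rule_codings :: "'g list list \<Rightarrow> nat \<Rightarrow> ((nat \<Rightarrow> nat) \<Rightarrow> bool) \<Rightarrow> 'g coding_list" where
  "rule_codings ws k R = map (\<lambda>v. map (\<lambda>j. (ws ! j, code_nth j v)) [0..<length ws])
     (filter (broken_code (length ws) k R)
       (rev [0..<Suc (list_encode (replicate (length ws) k))]))"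

lemma valid_rule_codings:
  assumes "set ws \<subseteq> lists T"
  shows "valid_codings T k (rule_codings ws k R)"
  using subsetD[OF assms nth_mem]
  unfolding valid_codings_def forbidden_set_def pattern_coding_def rule_codings_def
  by (auto simp: broken_code_def in_lists_conv_set simp del: upt_Suc)

text \<open>The symbols that a point shows at the places \<open>ps\<close> are themselves one of the candidates, so the
  point avoids the forbidden patterns at a cell exactly if the rule holds there.\<close>

lemma X_forbid_rule_codings:
  assumes "group K" "set ws \<subseteq> lists (carrier K)" "map (word_val K) ws = ps"
    and local: "\<And>c c'. (\<forall>j<length ws. c j = c' j) \<Longrightarrow> R c \<longleftrightarrow> R c'"
  shows "X_forbid K {..<k} (forbidden_set (rule_codings ws k R)) = rule_shift K k ps R"
proof -
  let ?N = "length ws"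
  let ?B = "list_encode (replicate ?N k)"
  have ps: "ps ! j = word_val K (ws ! j)" if "j < ?N" for j
    using assms(3) that by auto
  have F: "forbidden_set (rule_codings ws k R) =
      (\<lambda>v. (\<lambda>j. (ws ! j, code_nth j v)) ` {..<?N}) ` {v. v < Suc ?B \<and> broken_code ?N k R v}"
    unfolding forbidden_set_def rule_codings_def
    by (simp add: image_image atLeast0LessThan lessThan_def del: upt_Suc)
  have key: "(\<forall>c\<in>forbidden_set (rule_codings ws k R).
          x \<notin> (\<Inter>(w, a)\<in>c. cylinder K {..<k} a (g \<otimes>\<^bsub>K\<^esub> word_val K w)))
      \<longleftrightarrow> R (\<lambda>j. x (g \<otimes>\<^bsub>K\<^esub> (ps ! j)))"
    if x: "x \<in> full_shift K {..<k}" and g: "g \<in> carrier K" and range: "\<forall>j<?N. x (g \<otimes>\<^bsub>K\<^esub> (ps ! j)) < k" for x g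
  proof -
    let ?c = "\<lambda>j. x (g \<otimes>\<^bsub>K\<^esub> (ps ! j))"
    let ?L = "\<forall>c\<in>forbidden_set (rule_codings ws k R).
          x \<notin> (\<Inter>(w, a)\<in>c. cylinder K {..<k} a (g \<otimes>\<^bsub>K\<^esub> word_val K w))"
    have L: "?L \<longleftrightarrow> (\<forall>v. v < Suc ?B \<and> broken_code ?N k R v \<longrightarrow> (\<exists>j<?N. ?c j \<noteq> code_nth j v))"
    proof -
      have mem: "x \<in> (\<Inter>(w, a)\<in>(\<lambda>j. (ws ! j, code_nth j v)) ` {..<?N}. cylinder K {..<k} a (g \<otimes>\<^bsub>K\<^esub> word_val K w))
          \<longleftrightarrow> (\<forall>j<?N. ?c j = code_nth j v)" for v
        using x ps by (auto simp: cylinder_def)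
      show ?thesis unfolding F ball_simps(9) mem by blast
    qed
    show ?thesis
    proof
      assume R: "R ?c"
      show ?L
        unfolding L
      proof (intro allI impI, rule ccontr)
        fix v assume v: "v < Suc ?B \<and> broken_code ?N k R v"
          and "\<not> (\<exists>j<?N. ?c j \<noteq> code_nth j v)"
        then have "R ?c \<longleftrightarrow> R (\<lambda>j. code_nth j v)" by (intro local) auto
        then show False using R v by (simp add: broken_code_def)
      qed
    next
      assume ?L
      show "R ?c"
      proof (rule ccontr)
        assume nR: "\<not> R ?c"
        let ?v = "list_encode (map ?c [0..<?N])"
        have nth: "code_nth j ?v = ?c j" if "j < ?N" for j using that by simp
        then have "R ?c \<longleftrightarrow> R (\<lambda>j. code_nth j ?v)" by (intro local) auto
        then have "broken_code ?N k R ?v" using nR range nth by (simp add: broken_code_def)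
        moreover have "?v \<le> ?B"
          using range by (intro list_encode_mono) (auto simp: list_all2_conv_all_nth less_imp_le)
        ultimately show False using \<open>?L\<close> nth unfolding L by (metis less_Suc_eq_le)
      qed
    qed
  qed
  have bound: "x (g \<otimes>\<^bsub>K\<^esub> (ps ! j)) < k"
    if "x \<in> full_shift K {..<k}" "g \<in> carrier K" "j < ?N" for x g j
  proof -
    have "ps ! j \<in> carrier K"
      using assms(1,2) ps that(3) by (metis nth_mem subsetD word_val_closed)
    then have "g \<otimes>\<^bsub>K\<^esub> (ps ! j) \<in> carrier K"
      using assms(1) that(2) by (meson group.is_monoid monoid.m_closed)
    then show ?thesis using that(1) by (auto simp: full_shift_def)
  qed
  show ?thesis
    unfolding X_forbid_def rule_shift_def
  proof (intro Collect_cong conj_cong ball_cong)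
    fix x g assume x: "x \<in> full_shift K {..<k}" and g: "g \<in> carrier K"
    show "(\<forall>c\<in>forbidden_set (rule_codings ws k R).
          x \<notin> (\<Inter>(w, a)\<in>c. cylinder K {..<k} a (g \<otimes>\<^bsub>K\<^esub> word_val K w)))
      \<longleftrightarrow> R (\<lambda>j. x (g \<otimes>\<^bsub>K\<^esub> (ps ! j)))"
      by (rule key[OF x g]) (simp add: bound[OF x g])
  qed simp_all
qed

text \<open>Filtering the candidates and coding the resulting list are done by one and the same recursion
  over the candidates.\<close>

lemma code_rule_codings:
  "list_encode (map (\<lambda>c. list_encode (map (\<lambda>(w, a). prod_encode (code_word \<tau> w, a)) c))
      (rule_codings ws k R)) =
    rec_nat 0 (\<lambda>v r. if broken_code (length ws) k R v then
        Suc (prod_encode (list_encode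
          (map (\<lambda>j. prod_encode (code_word \<tau> (ws ! j), code_nth j v)) [0..<length ws]), r))
        else r)
      (Suc (list_encode (replicate (length ws) k)))"
proof -
  have "list_encode (map (\<lambda>c. list_encode (map (\<lambda>(w, a). prod_encode (code_word \<tau> w, a)) c))
      (map (\<lambda>v. map (\<lambda>j. (ws ! j, code_nth j v)) [0..<length ws])
     (filter (broken_code (length ws) k R) (rev [0..<b])))) =
    rec_nat 0 (\<lambda>v r. if broken_code (length ws) k R v then
        Suc (prod_encode (list_encode
          (map (\<lambda>j. prod_encode (code_word \<tau> (ws ! j), code_nth j v)) [0..<length ws]), r))
        else r) b" for b
    by (induction b) (auto simp: comp_def)
  then show ?thesis unfolding rule_codings_def .
qed

lemma rec_fun_code_rule_codings:
  assumes k: "rec_fun 1 (\<lambda>xs. k (xs ! 0))"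
    and R: "dec_pred 2 (\<lambda>xs. R (xs ! 0) (\<lambda>j. code_nth j (xs ! 1)))"
  shows "rec_fun 1 (\<lambda>xs. code_codings \<tau> (k (xs ! 0)) (rule_codings ws (k (xs ! 0)) (R (xs ! 0))))"
proof -
  let ?N = "length ws"
  let ?pat = "\<lambda>v. list_encode
    (map (\<lambda>j. prod_encode (code_word \<tau> (ws ! j), code_nth j v)) [0..<?N])"
  have k3: "rec_fun 3 (\<lambda>xs. k (xs ! 2))"
    using k by (rule rec_fun_app1) (auto intro: rec_fun_proj)
  have R3: "dec_pred 3 (\<lambda>xs. R (xs ! 2) (\<lambda>j. code_nth j (xs ! 0)))"
    using rec_fun_app2[of "\<lambda>n v. of_bool (R n (\<lambda>j. code_nth j v))" 3 "\<lambda>xs. xs ! 2" "\<lambda>xs. xs ! 0"] R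
    unfolding dec_pred_def by (simp add: rec_fun_proj)
  have broken: "dec_pred 3 (\<lambda>xs. broken_code ?N (k (xs ! 2)) (R (xs ! 2)) (xs ! 0))"
    unfolding broken_code_def
    by (intro dec_pred_bounded_all rec_intros rec_fun_code_nth k3 R3) auto
  let ?g = "\<lambda>xs. if broken_code ?N (k (xs ! 2)) (R (xs ! 2)) (xs ! 0) then
        Suc (prod_encode (?pat (xs ! 0), xs ! 1)) else xs ! 1"
  have "rec_fun 3 ?g"
    using broken
    by (intro rec_intros rec_fun_prod_encode rec_fun_list_encode_map rec_fun_code_nth) auto
  then have "rec_fun (Suc (Suc 1)) ?g"
    by (simp add: numeral_3_eq_3)
  moreover have "rec_fun 1 (\<lambda>xs. Suc (list_encode (map (\<lambda>_. k (xs ! 0)) [0..<?N])))"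
    by (intro rec_intros rec_fun_list_encode_map k)
  ultimately have "rec_fun 1 (\<lambda>xs. rec_nat 0 (\<lambda>v r. ?g (v # r # xs))
      (Suc (list_encode (map (\<lambda>_. k (xs ! 0)) [0..<?N]))))"
    by (intro rec_fun_rec_nat[where g = ?g] rec_fun_const)
  then have "rec_fun 1 (\<lambda>xs. list_encode
      (map (\<lambda>c. list_encode (map (\<lambda>(w, a). prod_encode (code_word \<tau> w, a)) c))
      (rule_codings ws (k (xs ! 0)) (R (xs ! 0)))))"
    by (simp add: code_rule_codings map_replicate_const cong: if_cong)
  from rec_fun_prod_encode[OF k this] show ?thesis unfolding code_codings_def .
qed

section \<open>The tiling rule\<close>

text \<open>A symbol consists of a symbol of the cover, the seed mark, the steps to the next and the
  previous cell of the tape, the head mark, the pebble mark, the tape symbol and the value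
  broadcast on the slice. A step is \<open>0\<close> if there is none, and \<open>Suc j\<close> for the \<open>j\<close>-th of a list of
  group elements. The broadcast value consists of the phase of the slice (\<open>0\<close> before the run,
  \<open>1\<close> at the slice that prepares it, \<open>2\<close> during the run), the state, the scanned symbol, and the
  action: new state, written symbol, direction and letter for the oracle tape.\<close>

definition cell :: "nat \<Rightarrow> nat \<Rightarrow> nat \<Rightarrow> nat \<Rightarrow> nat \<Rightarrow> nat \<Rightarrow> nat \<Rightarrow> nat \<Rightarrow> nat" where
  "cell c s x p h o' t l = list_encode [c, s, x, p, h, o', t, l]"

definition level :: "nat \<Rightarrow> nat \<Rightarrow> nat \<Rightarrow> nat \<Rightarrow> nat \<Rightarrow> nat \<Rightarrow> nat \<Rightarrow> nat" where
  "level s q a q' b d e = list_encode [s, q, a, q', b, d, e]"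

definition cover :: "nat \<Rightarrow> nat" where "cover v = code_nth 0 v"
definition seed :: "nat \<Rightarrow> nat" where "seed v = code_nth 1 v"
definition succ_dir :: "nat \<Rightarrow> nat" where "succ_dir v = code_nth 2 v"
definition pred_dir :: "nat \<Rightarrow> nat" where "pred_dir v = code_nth 3 v"
definition head :: "nat \<Rightarrow> nat" where "head v = code_nth 4 v"
definition pebble :: "nat \<Rightarrow> nat" where "pebble v = code_nth 5 v"
definition tape_symbol :: "nat \<Rightarrow> nat" where "tape_symbol v = code_nth 6 v"
definition level_of :: "nat \<Rightarrow> nat" where "level_of v = code_nth 7 v"
definition phase :: "nat \<Rightarrow> nat" where "phase l = code_nth 0 l"
definition state :: "nat \<Rightarrow> nat" where "state l = code_nth 1 l"
definition scanned :: "nat \<Rightarrow> nat" where "scanned l = code_nth 2 l"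
definition state' :: "nat \<Rightarrow> nat" where "state' l = code_nth 3 l"
definition written :: "nat \<Rightarrow> nat" where "written l = code_nth 4 l"
definition direction :: "nat \<Rightarrow> nat" where "direction l = code_nth 5 l"
definition letter :: "nat \<Rightarrow> nat" where "letter l = code_nth 6 l"

lemmas field_defs = cover_def seed_def succ_dir_def pred_dir_def head_def pebble_def tape_symbol_def
  level_of_def phase_def state_def scanned_def state'_def written_def direction_def letter_def

lemma cell_fields [simp]:
  "cover (cell c s x p h o' t l) = c" "seed (cell c s x p h o' t l) = s"
  "succ_dir (cell c s x p h o' t l) = x" "pred_dir (cell c s x p h o' t l) = p"
  "head (cell c s x p h o' t l) = h" "pebble (cell c s x p h o' t l) = o'"
  "tape_symbol (cell c s x p h o' t l) = t" "level_of (cell c s x p h o' t l) = l"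
  unfolding cell_def field_defs by (simp_all del: list_encode.simps)

lemma level_fields [simp]:
  "phase (level s q a q' b d e) = s" "state (level s q a q' b d e) = q"
  "scanned (level s q a q' b d e) = a" "state' (level s q a q' b d e) = q'"
  "written (level s q a q' b d e) = b" "direction (level s q a q' b d e) = d"
  "letter (level s q a q' b d e) = e"
  unfolding level_def field_defs by (simp_all del: list_encode.simps)

text \<open>A rule at a cell looks at the values \<open>c j\<close> of its neighbours for \<open>j < m\<close> and at the values
  \<open>c (m + j)\<close> of the same neighbours one time step later; \<open>c 0\<close> and \<open>c m\<close> belong to the cell itself.\<close>

abbreviation (input) cover_window :: "nat \<Rightarrow> (nat \<Rightarrow> nat) \<Rightarrow> nat" where
  "cover_window m c \<equiv> list_encode (map (\<lambda>j. cover (c j)) [0..<m])"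

text \<open>\<open>V\<close> holds the windows that occur in the cover and \<open>W\<close> those that the factor map sends to
  \<open>1\<close>. Cover and path do not change in time, so the seed is a vertical line. That every
  cell entered by a step knows this step makes the steps injective, and that the seed is entered by
  none keeps the path away from it.\<close>

definition static_rule :: "nat \<Rightarrow> nat set \<Rightarrow> nat set \<Rightarrow> (nat \<Rightarrow> nat) \<Rightarrow> bool" where
  "static_rule m V W c \<longleftrightarrow>
     cover_window m c \<in> V \<and> seed (c 0) = (if cover_window m c \<in> W then 1 else 0) \<and>
     cover (c m) = cover (c 0) \<and> succ_dir (c m) = succ_dir (c 0) \<and> pred_dir (c m) = pred_dir (c 0) \<and>
     (\<forall>j<m. level_of (c j) = level_of (c 0)) \<and>
     (seed (c 0) = 1 \<longrightarrow> pred_dir (c 0) = 0 \<and> succ_dir (c 0) \<noteq> 0) \<and>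
     (pred_dir (c 0) \<noteq> 0 \<longrightarrow> succ_dir (c 0) \<noteq> 0) \<and>
     succ_dir (c 0) \<le> m \<and>
     (\<forall>j<m. succ_dir (c 0) = Suc j \<longrightarrow> pred_dir (c j) = Suc j)"

text \<open>The first slice takes an idle action. Its symbol at the seed is therefore the same for all
  machines, as one symbol has to be prescribed at the identity.\<close>

definition setup_rule :: "(nat \<Rightarrow> nat) \<Rightarrow> bool" where
  "setup_rule c \<longleftrightarrow> level_of (c 0) = level 1 0 0 0 0 2 0 \<and>
     tape_symbol (c 0) = 0 \<and> head (c 0) = seed (c 0) \<and> pebble (c 0) = seed (c 0)"

definition machine_rule :: "nat \<Rightarrow> (nat \<Rightarrow> nat) \<Rightarrow> bool" where
  "machine_rule n c \<longleftrightarrow> state (level_of (c 0)) \<noteq> q_accept \<and>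
     action_ok n (state (level_of (c 0))) (scanned (level_of (c 0))) (state' (level_of (c 0)))
       (written (level_of (c 0))) (direction (level_of (c 0))) (letter (level_of (c 0)))"

text \<open>The head marks are determined along the path only: a move to the right is passed on by the
  cell that the head leaves, and a move to the left is seen by the cell that it enters. A cell
  without previous cell is the left end of the tape, where a move to the left stays.\<close>

definition tape_rule :: "nat \<Rightarrow> (nat \<Rightarrow> nat) \<Rightarrow> bool" where
  "tape_rule m c \<longleftrightarrow>
     phase (level_of (c m)) = 2 \<and> state (level_of (c m)) = state' (level_of (c 0)) \<and>
     (head (c 0) = 1 \<longrightarrow> tape_symbol (c 0) = scanned (level_of (c 0))) \<and>
     tape_symbol (c m) = (if head (c 0) = 1 then written (level_of (c 0)) else tape_symbol (c 0)) \<and>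
     (direction (level_of (c 0)) = 2 \<longrightarrow> head (c m) = head (c 0)) \<and>
     (direction (level_of (c 0)) = 1 \<longrightarrow> (pred_dir (c 0) = 0 \<longrightarrow> head (c m) = 0) \<and>
        (\<forall>j<m. succ_dir (c 0) = Suc j \<longrightarrow> head (c (m + j)) = head (c 0))) \<and>
     (direction (level_of (c 0)) = 0 \<longrightarrow> (\<forall>j<m. succ_dir (c 0) = Suc j \<longrightarrow>
        head (c m) = (if head (c j) = 1 \<or> (pred_dir (c 0) = 0 \<and> head (c 0) = 1) then 1 else 0)))"

text \<open>A letter that names no generator takes the pebble off the board: from then on, until the
  next query, the oracle tape does not hold a word over the generators. A query returns the pebble
  to the seed.\<close>

definition pebble_rule :: "nat \<Rightarrow> (nat \<Rightarrow> nat) \<Rightarrow> (nat \<Rightarrow> nat) \<Rightarrow> bool" where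
  "pebble_rule m ltr c \<longleftrightarrow>
     (state (level_of (c 0)) = q_query \<longrightarrow> pebble (c m) = seed (c 0) \<and>
        (seed (c 0) = 1 \<longrightarrow> state' (level_of (c 0)) = (if pebble (c 0) = 1 then q_yes else q_no))) \<and>
     (state (level_of (c 0)) \<noteq> q_query \<and> letter (level_of (c 0)) = 0 \<longrightarrow> pebble (c m) = pebble (c 0)) \<and>
     (state (level_of (c 0)) \<noteq> q_query \<and> letter (level_of (c 0)) \<noteq> 0 \<longrightarrow>
        (\<forall>j<m. ltr j = letter (level_of (c 0)) \<longrightarrow> pebble (c (m + j)) = pebble (c 0)) \<and>
        ((\<forall>j<m. ltr j \<noteq> letter (level_of (c 0))) \<longrightarrow> pebble (c m) = 0))"

definition tile_rule ::
    "nat \<Rightarrow> nat set \<Rightarrow> nat set \<Rightarrow> (nat \<Rightarrow> nat) \<Rightarrow> nat \<Rightarrow> (nat \<Rightarrow> nat) \<Rightarrow> bool" where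
  "tile_rule m V W ltr n c \<longleftrightarrow> static_rule m V W c \<and>
     (phase (level_of (c 0)) = 1 \<longrightarrow> setup_rule c) \<and>
     (phase (level_of (c 0)) = 2 \<longrightarrow> machine_rule n c) \<and>
     (phase (level_of (c 0)) = 1 \<or> phase (level_of (c 0)) = 2 \<longrightarrow> tape_rule m c \<and> pebble_rule m ltr c)"

lemma dec_pred_tile_rule:
  assumes "finite V" "finite W" "rec_fun k f" "\<And>j. rec_fun k (c j)"
  shows "dec_pred k (\<lambda>xs. tile_rule m V W ltr (f xs) (\<lambda>j. c j xs))"
  unfolding tile_rule_def static_rule_def setup_rule_def machine_rule_def tape_rule_def
    pebble_rule_def field_defs
  by (intro rec_intros dec_pred_bounded_all dec_pred_finite_mem rec_fun_list_encode_map
      dec_pred_action_ok rec_fun_code_nth assms)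

lemma tile_rule_cong:
  assumes "m > 0" "\<And>j. j < 2 * m \<Longrightarrow> c j = c' j"
  shows "tile_rule m V W ltr n c \<longleftrightarrow> tile_rule m V W ltr n c'"
proof -
  have "c j = c' j" "c (m + j) = c' (m + j)" if "j < m" for j using assms(2) that by auto
  moreover from this[of 0] assms(1) have "c 0 = c' 0" "c m = c' m" by auto
  moreover from calculation have "cover_window m c = cover_window m c'"
    by (intro arg_cong[of _ _ list_encode] map_cong) auto
  ultimately show ?thesis
    unfolding tile_rule_def static_rule_def setup_rule_def machine_rule_def tape_rule_def
      pebble_rule_def by simp
qed

section \<open>Runs as tilings\<close>

text \<open>A step of the machine is split into the choice of an action, which is broadcast, and its
  execution, which is local.\<close>

fun apply_action :: "otm_config \<Rightarrow> nat \<times> nat \<times> nat \<times> nat \<Rightarrow> otm_config" where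
  "apply_action (q, t, h, w) (q', b, d, e) =
     (q', t(h := b), (if d = 0 then h - 1 else if d = 1 then h + 1 else h),
      (if q = q_query then [] else if e = 0 then w else w @ [e - 1]))"

fun action_of :: "nat list set \<Rightarrow> otm \<Rightarrow> otm_config \<Rightarrow> nat \<times> nat \<times> nat \<times> nat" where
  "action_of Ora M (q, t, h, w) =
     (if q = q_query then (if w \<in> Ora then q_yes else q_no, t h, 2, 0)
      else case map_of M (q, t h) of None \<Rightarrow> (q, t h, 2, 0)
        | Some (p, b, d, e) \<Rightarrow> (p, b, move_code d, letter_code e))"

lemma apply_action_of: "apply_action c (action_of Ora M c) = oracle_next Ora M c"
  by (cases c) (auto simp: move_code_def letter_code_def split: option.split move.split)

lemma action_of_iff:
  "action_of Ora M (q, t, h, w) = (q', b, d, e) \<longleftrightarrow>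
    action_ok (code_otm M) q (t h) q' b d e \<and> (q = q_query \<longrightarrow> q' = (if w \<in> Ora then q_yes else q_no))"
proof (cases "q = q_query")
  case True
  then show ?thesis by (auto simp: action_ok_def)
next
  case False
  then show ?thesis using action_ok_code_otm[OF False, of M "t h" q' b d e]
    by (auto split: option.splits)
qed

lemma action_of_direction: "action_of Ora M c = (q', b, d, e) \<Longrightarrow> d \<le> 2"
  by (cases c) (auto simp: move_code_def split: if_splits option.splits move.splits)

locale tiling = group G for G :: "('a, 'm) monoid_scheme" (structure) +
  fixes S :: "'a set" and \<nu> :: "'a \<Rightarrow> nat" and gs :: "'a list"
  assumes gen: "sym_gen_set G S" and inj: "inj_on \<nu> S"
    and gs: "set gs \<subseteq> carrier G" "S \<subseteq> set gs" "gs \<noteq> []" "gs ! 0 = \<one>"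
begin

text \<open>Letters are shifted by one, as in the broadcast action; \<open>0\<close> stands for no letter.\<close>

definition letter_at :: "nat \<Rightarrow> nat" where
  "letter_at j = (if gs ! j \<in> S then Suc (\<nu> (gs ! j)) else 0)"

definition neighbourhood :: "('a \<Rightarrow> int \<Rightarrow> nat) \<Rightarrow> 'a \<Rightarrow> int \<Rightarrow> nat \<Rightarrow> nat" where
  "neighbourhood X g t j =
     (if j < length gs then X (g \<otimes> gs ! j) t else X (g \<otimes> gs ! (j - length gs)) (t + 1))"

definition valid_tiling :: "nat set \<Rightarrow> nat set \<Rightarrow> nat \<Rightarrow> ('a \<Rightarrow> int \<Rightarrow> nat) \<Rightarrow> bool" where
  "valid_tiling V W n X \<longleftrightarrow> (\<forall>g\<in>carrier G. \<forall>t.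
     tile_rule (length gs) V W letter_at n (neighbourhood X g t))"

text \<open>The position of the pebble. At most one place is pointed at, since \<open>\<nu>\<close> is injective, and none
  if the word contains something that is not a letter.\<close>

definition pointed :: "nat list \<Rightarrow> 'a \<Rightarrow> bool" where
  "pointed w g \<longleftrightarrow> (\<exists>u\<in>lists S. w = map \<nu> u \<and> g = word_val G u)"

lemma S_carrier: "S \<subseteq> carrier G" using gs by blast

lemma gs_nth [simp]: "j < length gs \<Longrightarrow> gs ! j \<in> carrier G"
  using gs(1) nth_mem by blast

lemma gs_0: "gs ! 0 = \<one>" "length gs > 0" using gs by auto

lemma S_index: "s \<in> S \<Longrightarrow> \<exists>j<length gs. gs ! j = s"
  using gs(2) by (metis in_set_conv_nth subsetD)

lemma neighbourhood_simps [simp]: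
  "j < length gs \<Longrightarrow> neighbourhood X g t j = X (g \<otimes> gs ! j) t"
  "neighbourhood X g t (length gs + j) = X (g \<otimes> gs ! j) (t + 1)"
  "g \<in> carrier G \<Longrightarrow> neighbourhood X g t 0 = X g t"
  "g \<in> carrier G \<Longrightarrow> neighbourhood X g t (length gs) = X g (t + 1)"
  using gs_0 by (auto simp: neighbourhood_def)

lemma pointed_Nil: "pointed [] g \<longleftrightarrow> g = \<one>"
  by (auto simp: pointed_def)

lemma pointed_snoc:
  assumes "s \<in> S" "g \<in> carrier G"
  shows "pointed (w @ [\<nu> s]) (g \<otimes> s) \<longleftrightarrow> pointed w g"
proof -
  have s: "s \<in> carrier G" using assms(1) S_carrier by blast
  have val: "word_val G (u @ [s]) = word_val G u \<otimes> s" "word_val G u \<in> carrier G"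
    if "u \<in> lists S" for u
  proof -
    have "u \<in> lists (carrier G)" using that S_carrier by (blast intro: lists_mono[THEN subsetD])
    then show "word_val G (u @ [s]) = word_val G u \<otimes> s" "word_val G u \<in> carrier G"
      using s by (auto simp: word_val_append[OF is_group] word_val_closed[OF is_group])
  qed
  show ?thesis
  proof
    assume "pointed w g"
    then obtain u where "u \<in> lists S" "w = map \<nu> u" "g = word_val G u"
      unfolding pointed_def by blast
    then show "pointed (w @ [\<nu> s]) (g \<otimes> s)"
      unfolding pointed_def using assms(1) val by (intro bexI[of _ "u @ [s]"]) auto
  next
    assume "pointed (w @ [\<nu> s]) (g \<otimes> s)"
    then obtain u where u: "u \<in> lists S" "w @ [\<nu> s] = map \<nu> u" "g \<otimes> s = word_val G u"
      unfolding pointed_def by blast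
    obtain u' s' where u': "u = u' @ [s']" "w = map \<nu> u'" "\<nu> s' = \<nu> s"
      using u(2) by (cases u rule: rev_cases) auto
    then have "s' = s" using inj u(1) assms(1) by (auto dest: inj_onD)
    then have "g = word_val G u'"
      using u u' val[of u'] s assms(2) by simp
    then show "pointed w g" unfolding pointed_def using u u' by auto
  qed
qed

lemma not_pointed_snoc: "l \<notin> \<nu> ` S \<Longrightarrow> \<not> pointed (w @ [l]) g"
  unfolding pointed_def by (auto simp: append_eq_map_conv)

lemma WP_iff_pointed: "w \<in> WP G S \<nu> \<longleftrightarrow> pointed w \<one>"
  unfolding WP_def pointed_def by auto

end

context tiling
begin

text \<open>The slice at time \<open>t\<close> shows a configuration along the path \<open>r\<close>. Cells off the path may hold
  anything but a pebble in a wrong place.\<close>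

fun displays :: "('a \<Rightarrow> int \<Rightarrow> nat) \<Rightarrow> (nat \<Rightarrow> 'a) \<Rightarrow> int \<Rightarrow> otm_config \<Rightarrow> bool" where
  "displays X r t (q, tape, h, w) \<longleftrightarrow> state (level_of (X \<one> t)) = q \<and>
     (\<forall>i. tape_symbol (X (r i) t) = tape i \<and> head (X (r i) t) = of_bool (i = h)) \<and>
     (\<forall>g\<in>carrier G. pebble (X g t) = of_bool (pointed w g))"

lemma valid_tilingD:
  assumes "valid_tiling V W n X" "g \<in> carrier G"
  shows "static_rule (length gs) V W (neighbourhood X g t)"
    "phase (level_of (X g t)) = 1 \<Longrightarrow> setup_rule (neighbourhood X g t)"
    "phase (level_of (X g t)) = 2 \<Longrightarrow> machine_rule n (neighbourhood X g t)"
    "phase (level_of (X g t)) = 1 \<or> phase (level_of (X g t)) = 2 \<Longrightarrow>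
      tape_rule (length gs) (neighbourhood X g t) \<and>
      pebble_rule (length gs) letter_at (neighbourhood X g t)"
  using assms unfolding valid_tiling_def tile_rule_def by auto

lemma level_const:
  assumes "valid_tiling V W n X" "g \<in> carrier G"
  shows "level_of (X g t) = level_of (X \<one> t)"
proof (rule invariant_under_generators_const[OF is_group gen _ assms(2)])
  fix g s assume g: "g \<in> carrier G" and "s \<in> S"
  then obtain j where "j < length gs" "gs ! j = s" using S_index by blast
  then show "level_of (X (g \<otimes> s) t) = level_of (X g t)"
    using valid_tilingD(1)[OF assms(1) g, of t] g unfolding static_rule_def by auto
qed

text \<open>The rules determine the next slice on the path and the next position of the pebble. Since the
  pebble lies where the oracle tape points, the answer to a query is enforced at the seed.\<close>

lemma displays_step:
  assumes valid: "valid_tiling V W n X"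
    and seed: "\<And>g. g \<in> carrier G \<Longrightarrow> seed (X g t) = of_bool (g = \<one>)"
    and r: "\<And>i. r i \<in> carrier G" "\<And>i. k i < length gs" "\<And>i. succ_dir (X (r i) t) = Suc (k i)"
      "\<And>i. r (Suc i) = r i \<otimes> gs ! k i" "\<And>i. pred_dir (X (r i) t) = 0 \<longleftrightarrow> i = 0"
    and L: "level_of (X \<one> t) = l" "phase l = 1 \<or> phase l = 2" "direction l \<le> 2"
    and disp: "displays X r t (q, tape, h, w)"
  shows "displays X r (t + 1)
      (apply_action (q, tape, h, w) (state' l, written l, direction l, letter l))"
    and "scanned l = tape h"
    and "q = q_query \<Longrightarrow> state' l = (if w \<in> WP G S \<nu> then q_yes else q_no)"
    and "phase (level_of (X \<one> (t + 1))) = 2"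
proof -
  have lev: "level_of (X g t) = l" if "g \<in> carrier G" for g
    using level_const[OF valid that] L(1) by simp
  have T: "tape_rule (length gs) (neighbourhood X g t)"
    and P: "pebble_rule (length gs) letter_at (neighbourhood X g t)" if "g \<in> carrier G" for g
    using valid_tilingD(4)[OF valid that, of t] lev[OF that] L(2) by auto
  have q: "state l = q" and tape: "\<And>i. tape_symbol (X (r i) t) = tape i"
    and head: "\<And>i. head (X (r i) t) = of_bool (i = h)"
    and peb: "\<And>g. g \<in> carrier G \<Longrightarrow> pebble (X g t) = of_bool (pointed w g)"
    using disp L(1) by auto
  show "phase (level_of (X \<one> (t + 1))) = 2"
    using T[OF one_closed] unfolding tape_rule_def by simp
  show scan: "scanned l = tape h"
    using T[OF r(1)[of h]] tape head lev[OF r(1)] r(1) unfolding tape_rule_def by simp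
  show "state' l = (if w \<in> WP G S \<nu> then q_yes else q_no)" if "q = q_query"
    using P[OF one_closed] lev[OF one_closed] q that seed[OF one_closed] peb[OF one_closed]
    unfolding pebble_rule_def WP_iff_pointed by auto
  have state: "state (level_of (X \<one> (t + 1))) = state' l"
    using T[OF one_closed] lev[OF one_closed] unfolding tape_rule_def by simp
  have tape_symbol: "tape_symbol (X (r i) (t + 1)) = (tape(h := written l)) i" for i
    using T[OF r(1)[of i]] tape head lev[OF r(1)] r(1) unfolding tape_rule_def by auto
  have succ: "X (r i \<otimes> gs ! k i) t' = X (r (Suc i)) t'" for i t' by (simp add: r)
  have head': "head (X (r i) (t + 1)) =
      of_bool (i = (if direction l = 0 then h - 1 else if direction l = 1 then h + 1 else h))" for i
  proof -
    consider "direction l = 2" | "direction l = 1" | "direction l = 0" using L(3) by linarith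
    then show ?thesis
    proof cases
      case 1
      then show ?thesis
        using T[OF r(1)[of i]] head lev[OF r(1)] r(1) unfolding tape_rule_def by auto
    next
      case 2
      show ?thesis
      proof (cases i)
        case 0
        then show ?thesis
          using 2 T[OF r(1)[of i]] lev[OF r(1)] r(1) r(5)[of i] unfolding tape_rule_def by auto
      next
        case (Suc i')
        then show ?thesis
          using 2 T[OF r(1)[of i']] lev[OF r(1)] r(1) r(2)[of i'] r(3)[of i'] head[of i'] r(4)[of i']
          unfolding tape_rule_def by auto
      qed
    next
      case 3
      then have "head (X (r i) (t + 1)) =
          (if head (X (r (Suc i)) t) = 1 \<or> (pred_dir (X (r i) t) = 0 \<and> head (X (r i) t) = 1)
           then 1 else 0)"
        using T[OF r(1)[of i]] lev[OF r(1)] r(1) r(2)[of i] r(3)[of i] r(4)[of i]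
        unfolding tape_rule_def by auto
      then show ?thesis using 3 head r(5)[of i] by auto
    qed
  qed
  have pebble: "pebble (X g (t + 1)) =
      of_bool (pointed (if q = q_query then [] else if letter l = 0 then w else w @ [letter l - 1]) g)"
    if g: "g \<in> carrier G" for g
  proof (cases "q = q_query \<or> letter l = 0")
    case True
    then show ?thesis
      using P[OF g] lev[OF g] q g seed[OF g] peb[OF g] pointed_Nil
      unfolding pebble_rule_def by auto
  next
    case False
    show ?thesis
    proof (cases "letter l - 1 \<in> \<nu> ` S")
      case True
      then obtain s where s: "s \<in> S" "letter l = Suc (\<nu> s)" using False by auto
      then obtain j where j: "j < length gs" "gs ! j = s" using S_index by blast
      have sc: "s \<in> carrier G" using s S_carrier by blast
      let ?g = "g \<otimes> inv s"
      have g': "?g \<in> carrier G" "?g \<otimes> s = g" using g sc by (auto simp: m_assoc)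
      have "pebble (X (?g \<otimes> s) (t + 1)) = pebble (X ?g t)"
        using P[OF g'(1)] lev[OF g'(1)] q g'(1) False j s unfolding pebble_rule_def letter_at_def
        by auto
      then show ?thesis
        using False peb[OF g'(1)] pointed_snoc[OF s(1) g'(1), of w] g'(2) s(2) by simp
    next
      case notin: False
      have "letter_at j \<noteq> letter l" for j
      proof
        assume "letter_at j = letter l"
        then have "gs ! j \<in> S" "letter l - 1 = \<nu> (gs ! j)"
          using False by (auto simp: letter_at_def split: if_splits)
        then show False using notin by blast
      qed
      then have "pebble (X g (t + 1)) = 0"
        using P[OF g] lev[OF g] q g False unfolding pebble_rule_def by auto
      then show ?thesis using False not_pointed_snoc[OF notin] by simp
    qed
  qed
  show "displays X r (t + 1)
      (apply_action (q, tape, h, w) (state' l, written l, direction l, letter l))"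
    using state tape_symbol head' pebble by simp
qed

lemma static_rule_time:
  assumes "valid_tiling V W n X" "g \<in> carrier G"
  shows "succ_dir (X g t) = succ_dir (X g 0)" "pred_dir (X g t) = pred_dir (X g 0)"
    "cover (X g t) = cover (X g 0)"
proof -
  have step: "cover (X g (t + 1)) = cover (X g t)" "succ_dir (X g (t + 1)) = succ_dir (X g t)"
    "pred_dir (X g (t + 1)) = pred_dir (X g t)" for t
    using valid_tilingD(1)[OF assms, of t] assms(2) unfolding static_rule_def by auto
  have const: "f t = f 0" if "\<And>t. f (t + 1) = f t" for f :: "int \<Rightarrow> nat" and t
    by (induction t rule: int_induct[where k = 0]) (use that that[of "_ - 1"] in auto)
  show "succ_dir (X g t) = succ_dir (X g 0)" "pred_dir (X g t) = pred_dir (X g 0)"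
    "cover (X g t) = cover (X g 0)"
    using const[of "\<lambda>t. succ_dir (X g t)" t] const[of "\<lambda>t. pred_dir (X g t)" t]
      const[of "\<lambda>t. cover (X g t)" t] step by auto
qed

text \<open>Following the steps from the seed gives an infinite path along which all slices from time
  \<open>0\<close> on show the run of the machine, which therefore never enters the accepting state. The path
  avoids the seed, so only its first cell carries the head at the beginning.\<close>

lemma valid_tiling_imp_not_accepts:
  assumes valid: "valid_tiling V W (code_otm M) X"
    and seed: "\<And>g t. g \<in> carrier G \<Longrightarrow> seed (X g t) = of_bool (g = \<one>)"
    and phase: "phase (level_of (X \<one> 0)) = 1"
  shows "\<not> accepts_empty (WP G S \<nu>) M"
proof -
  let ?run = "oracle_run (WP G S \<nu>) M"
  define k where "k g = succ_dir (X g 0) - 1" for g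
  define r where "r i = ((\<lambda>g. g \<otimes> gs ! k g) ^^ i) \<one>" for i
  have static: "pred_dir (X g 0) \<noteq> 0 \<Longrightarrow> succ_dir (X g 0) \<noteq> 0"
      "succ_dir (X g 0) \<le> length gs"
      "j < length gs \<Longrightarrow> succ_dir (X g 0) = Suc j \<Longrightarrow> pred_dir (X (g \<otimes> gs ! j) 0) = Suc j"
    if "g \<in> carrier G" for g j
    using valid_tilingD(1)[OF valid that, of 0] that unfolding static_rule_def by simp_all
  have static_one: "pred_dir (X \<one> 0) = 0" "succ_dir (X \<one> 0) \<noteq> 0"
    using valid_tilingD(1)[OF valid one_closed, of 0] seed[OF one_closed, of 0]
    unfolding static_rule_def by simp_all
  have r0: "r 0 = \<one>" and rSuc: "r (Suc i) = r i \<otimes> gs ! k (r i)" for i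
    by (simp_all add: r_def)
  have path: "r i \<in> carrier G \<and> succ_dir (X (r i) 0) = Suc (k (r i)) \<and> k (r i) < length gs
      \<and> (pred_dir (X (r i) 0) = 0 \<longleftrightarrow> i = 0)" for i
  proof (induction i)
    case 0
    then show ?case
      using static_one static(2)[OF one_closed] unfolding k_def r0 by simp
  next
    case (Suc i)
    then have c: "r (Suc i) \<in> carrier G" by (simp add: rSuc)
    have "pred_dir (X (r (Suc i)) 0) = Suc (k (r i))"
      using static(3)[of "r i" "k (r i)"] Suc unfolding rSuc by simp
    then show ?case
      using c static(1,2)[OF c] unfolding k_def by simp
  qed
  have ri: "r i = \<one> \<longleftrightarrow> i = 0" for i
    using path[of i] static_one(1) r0 by metis
  note succ = static_rule_time[OF valid]
  have path_t: "r i \<in> carrier G" "k (r i) < length gs" "succ_dir (X (r i) t) = Suc (k (r i))"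
    "pred_dir (X (r i) t) = 0 \<longleftrightarrow> i = 0" for i t
    using path[of i] succ[of "r i" t] by auto
  note step = displays_step[OF valid seed path_t(1) path_t(2) path_t(3) rSuc path_t(4)]
  have init: "level_of (X \<one> 0) = level 1 0 0 0 0 2 0" "tape_symbol (X g 0) = 0"
      "head (X g 0) = of_bool (g = \<one>)" "pebble (X g 0) = of_bool (g = \<one>)"
    if "g \<in> carrier G" for g
    using valid_tilingD(2)[OF valid that, of 0] level_const[OF valid that, of 0] phase seed[OF that] that
    unfolding setup_rule_def by auto
  have disp0: "displays X r 0 (0, \<lambda>_. 0, 0, [])"
    using init(2-4) init(1)[OF one_closed] path ri by (auto simp: pointed_Nil)
  have run: "displays X r (int i + 1) (?run i) \<and> phase (level_of (X \<one> (int i + 1))) = 2" for i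
  proof (induction i)
    case 0
    have "(\<lambda>_. 0)(0 := 0) = (\<lambda>_::nat. 0::nat)" by auto
    then show ?case
      using step(1,4)[OF _ init(1)[OF one_closed] _ _ disp0] by (simp add: oracle_run_def)
  next
    case (Suc i)
    obtain q t h w where c: "?run i = (q, t, h, w)" by (cases "?run i") auto
    let ?t = "int i + 1"
    let ?l = "level_of (X \<one> ?t)"
    have disp: "displays X r ?t (q, t, h, w)" using Suc c by simp
    then have q: "state ?l = q" by simp
    have ok: "action_ok (code_otm M) q (scanned ?l) (state' ?l) (written ?l) (direction ?l) (letter ?l)"
      using valid_tilingD(3)[OF valid one_closed, of ?t] Suc q unfolding machine_rule_def by simp
    have "direction ?l \<le> 2"
    proof (cases "q = q_query")
      case True
      then show ?thesis using ok by (simp add: action_ok_def)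
    next
      case False
      then show ?thesis
        using ok[unfolded action_ok_code_otm[OF False]]
        by (auto simp: move_code_def split: option.splits move.splits)
    qed
    note st = step[OF _ HOL.refl _ this disp]
    have "action_of (WP G S \<nu>) M (q, t, h, w) = (state' ?l, written ?l, direction ?l, letter ?l)"
      using ok st(2,3) Suc unfolding action_of_iff by simp
    then have "?run (Suc i) = apply_action (q, t, h, w) (state' ?l, written ?l, direction ?l, letter ?l)"
      using c apply_action_of[of "(q, t, h, w)" "WP G S \<nu>" M]
      by (simp add: oracle_run_def del: oracle_next.simps apply_action.simps action_of.simps)
    moreover have "int (Suc i) + 1 = ?t + 1" by simp
    ultimately show ?case
      using st(1,4) Suc by (simp del: apply_action.simps displays.simps)
  qed
  have "fst (?run i) \<noteq> q_accept" for i
  proof -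
    obtain q t h w where c: "?run i = (q, t, h, w)" by (cases "?run i") auto
    then show ?thesis
      using run[of i] valid_tilingD(3)[OF valid one_closed, of "int i + 1"]
      unfolding machine_rule_def by simp
  qed
  then show ?thesis unfolding accepts_empty_iff_run by blast
qed

end

lemma of_bool_eq_Suc_0 [simp]: "of_bool P = Suc 0 \<longleftrightarrow> P"
  by (cases P) auto

abbreviation (input) conf_state :: "otm_config \<Rightarrow> nat" where "conf_state c \<equiv> fst c"
abbreviation (input) conf_tape :: "otm_config \<Rightarrow> nat \<Rightarrow> nat" where "conf_tape c \<equiv> fst (snd c)"
abbreviation (input) conf_head :: "otm_config \<Rightarrow> nat" where "conf_head c \<equiv> fst (snd (snd c))"
abbreviation (input) conf_word :: "otm_config \<Rightarrow> nat list" where "conf_word c \<equiv> snd (snd (snd c))"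

text \<open>The preparing slice and the first slice of the run both show the initial configuration.\<close>

definition delayed_run :: "nat list set \<Rightarrow> otm \<Rightarrow> nat \<Rightarrow> otm_config" where
  "delayed_run Ora M i = oracle_run Ora M (i - 1)"

definition delayed_action :: "nat list set \<Rightarrow> otm \<Rightarrow> nat \<Rightarrow> nat \<times> nat \<times> nat \<times> nat" where
  "delayed_action Ora M i = (if i = 0 then (0, 0, 2, 0) else action_of Ora M (oracle_run Ora M (i - 1)))"

lemma delayed_run_0: "delayed_run Ora M 0 = (0, \<lambda>_. 0, 0, [])"
  by (simp add: delayed_run_def oracle_run_def)

lemma delayed_run_Suc:
  "delayed_run Ora M (Suc i) = apply_action (delayed_run Ora M i) (delayed_action Ora M i)"
proof (cases i)
  case 0
  have "(\<lambda>_. 0)(0 := 0) = (\<lambda>_::nat. 0::nat)" by auto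
  then show ?thesis using 0 by (simp add: delayed_run_def delayed_action_def oracle_run_def)
next
  case (Suc j)
  have "oracle_run Ora M (Suc j) = oracle_next Ora M (oracle_run Ora M j)"
    by (simp add: oracle_run_def del: oracle_next.simps)
  then show ?thesis
    using Suc by (simp add: delayed_run_def delayed_action_def apply_action_of
        del: oracle_next.simps apply_action.simps action_of.simps)
qed

definition level_at :: "nat list set \<Rightarrow> otm \<Rightarrow> int \<Rightarrow> nat" where
  "level_at Ora M t = (if t < 0 then level 0 0 0 0 0 0 0
     else case delayed_run Ora M (nat t) of (q, tape, h, w) \<Rightarrow>
       case delayed_action Ora M (nat t) of (q', b, d, e) \<Rightarrow>
         level (if t = 0 then 1 else 2) q (tape h) q' b d e)"

context tiling
begin

text \<open>The picture of a run along the ray \<open>r\<close>, whose \<open>i\<close>-th step is the \<open>k i\<close>-th entry of \<open>gs\<close>.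
  Slices before time \<open>0\<close> are blank, and so are all cells off the ray.\<close>

definition run_tiling ::
    "otm \<Rightarrow> ('a \<Rightarrow> nat) \<Rightarrow> (nat \<Rightarrow> 'a) \<Rightarrow> (nat \<Rightarrow> nat) \<Rightarrow> 'a \<Rightarrow> int \<Rightarrow> nat" where
  "run_tiling M \<xi> r k g t = (case delayed_run (WP G S \<nu>) M (nat t) of (q, tape, h, w) \<Rightarrow>
     cell (\<xi> g) (of_bool (g = \<one>))
       (if g \<in> range r then Suc (k (inv_into UNIV r g)) else 0)
       (if g \<in> range r \<and> g \<noteq> r 0 then Suc (k (inv_into UNIV r g - 1)) else 0)
       (of_bool (0 \<le> t \<and> g = r h))
       (of_bool (0 \<le> t \<and> pointed w g))
       (if 0 \<le> t \<and> g \<in> range r then tape (inv_into UNIV r g) else 0)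
       (level_at (WP G S \<nu>) M t))"

text \<open>Each rule is checked at an arbitrary cell. As the ray has no repetitions, a mark on it sits at one
  place only, and a step stored at a cell is the step of the ray there.\<close>

lemma valid_run_tiling:
  assumes r: "r 0 = \<one>" "\<And>i. r i \<in> carrier G" "inj r" "\<And>i. r (Suc i) = r i \<otimes> gs ! k i"
      "\<And>i. k i < length gs"
    and cover: "\<And>g. g \<in> carrier G \<Longrightarrow> list_encode (map (\<lambda>j. \<xi> (g \<otimes> gs ! j)) [0..<length gs]) \<in> V"
      "\<And>g. g \<in> carrier G \<Longrightarrow>
        list_encode (map (\<lambda>j. \<xi> (g \<otimes> gs ! j)) [0..<length gs]) \<in> W \<longleftrightarrow> g = \<one>"
    and acc: "\<not> accepts_empty (WP G S \<nu>) M"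
  shows "valid_tiling V W (code_otm M) (run_tiling M \<xi> r k)"
  unfolding valid_tiling_def
proof (intro ballI allI)
  fix g t assume g: "g \<in> carrier G"
  let ?X = "run_tiling M \<xi> r k" and ?O = "WP G S \<nu>"
  let ?c = "neighbourhood ?X g t"
  obtain q tape h w where C: "delayed_run ?O M (nat t) = (q, tape, h, w)"
    by (cases "delayed_run ?O M (nat t)") auto
  obtain q' b d e where A: "delayed_action ?O M (nat t) = (q', b, d, e)"
    by (cases "delayed_action ?O M (nat t)") auto
  obtain q1 tape1 h1 w1 where C1: "delayed_run ?O M (nat (t + 1)) = (q1, tape1, h1, w1)"
    by (cases "delayed_run ?O M (nat (t + 1))") auto
  have inv_r: "inv_into UNIV r (r i) = i" for i using r(3) by simp
  have r_eq: "r i = r j \<longleftrightarrow> i = j" for i j using r(3) by (auto dest: injD)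
  have fields: "cover (?X x t') = \<xi> x" "seed (?X x t') = of_bool (x = \<one>)"
    "succ_dir (?X x t') = (if x \<in> range r then Suc (k (inv_into UNIV r x)) else 0)"
    "pred_dir (?X x t') = (if x \<in> range r \<and> x \<noteq> r 0 then Suc (k (inv_into UNIV r x - 1)) else 0)"
    "level_of (?X x t') = level_at ?O M t'" for x t'
    by (cases "delayed_run ?O M (nat t')", simp add: run_tiling_def)+
  have window: "cover_window (length gs) ?c = list_encode (map (\<lambda>j. \<xi> (g \<otimes> gs ! j)) [0..<length gs])"
    unfolding list_encode_eq by (rule map_cong) (simp_all add: fields)
  have fields_t: "head (?X x t) = of_bool (0 \<le> t \<and> x = r h)"
    "pebble (?X x t) = of_bool (0 \<le> t \<and> pointed w x)"
    "tape_symbol (?X x t) = (if 0 \<le> t \<and> x \<in> range r then tape (inv_into UNIV r x) else 0)" for x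
    by (simp_all add: run_tiling_def C)
  have fields_t1: "head (?X x (t + 1)) = of_bool (0 \<le> t + 1 \<and> x = r h1)"
    "pebble (?X x (t + 1)) = of_bool (0 \<le> t + 1 \<and> pointed w1 x)"
    "tape_symbol (?X x (t + 1)) = (if 0 \<le> t + 1 \<and> x \<in> range r then tape1 (inv_into UNIV r x) else 0)"
    for x by (simp_all add: run_tiling_def C1)
  have static: "static_rule (length gs) V W ?c"
  proof -
    have "pred_dir (?X (g \<otimes> gs ! j) t) = Suc j" if j: "succ_dir (?X g t) = Suc j" for j
    proof -
      obtain i where "g = r i" "j = k i"
        using j by (auto simp: fields inv_r split: if_splits)
      then show ?thesis by (simp add: fields r(4)[symmetric] inv_r r_eq)
    qed
    moreover have "succ_dir (?X g t) \<le> length gs"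
      using r(5) by (simp add: fields Suc_le_eq)
    moreover have "\<one> \<in> range r" using r(1) rangeI[of r 0] by simp
    ultimately show ?thesis
      unfolding static_rule_def window
      using g cover[OF g] r(1) by (simp add: fields)
  qed
  have init: "setup_rule ?c" if "t = 0"
  proof -
    have "(q, tape, h, w) = (0, \<lambda>_. 0, 0, [])" "(q', b, d, e) = (0, 0, 2, 0)"
      using C A that delayed_run_0[of ?O M] by (simp_all add: delayed_action_def)
    then have *: "q = 0" "tape = (\<lambda>_. 0)" "h = 0" "w = []" "q' = 0" "b = 0" "d = 2" "e = 0"
      by simp_all
    show ?thesis
      using g C A unfolding setup_rule_def
      by (simp add: fields fields_t[unfolded that] level_at_def that * r(1) pointed_Nil)
  qed
  have lev: "level_of (?X g t) = level (if t = 0 then 1 else 2) q (tape h) q' b d e" if "t \<ge> 0" for g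
    using C A that by (simp add: fields level_at_def)
  have phase: "phase (level_of (?X g t)) = (if t < 0 then 0 else if t = 0 then 1 else 2)" for g
    by (auto simp: fields level_at_def split: prod.split)
  have ok: "action_ok (code_otm M) q (tape h) q' b d e" "q \<noteq> q_accept"
      "q = q_query \<Longrightarrow> q' = (if w \<in> ?O then q_yes else q_no)" if "t > 0"
  proof -
    have "action_of ?O M (q, tape, h, w) = (q', b, d, e)"
      using C A that by (simp add: delayed_run_def delayed_action_def del: action_of.simps)
    then show "action_ok (code_otm M) q (tape h) q' b d e"
      "q = q_query \<Longrightarrow> q' = (if w \<in> ?O then q_yes else q_no)"
      unfolding action_of_iff by simp_all
    show "q \<noteq> q_accept"
      using acc C unfolding accepts_empty_iff_run delayed_run_def by (metis fst_conv)
  qed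
  have machine: "machine_rule (code_otm M) ?c" if "t > 0"
    using g ok[OF that] lev that unfolding machine_rule_def by simp
  have dyn: "tape_rule (length gs) ?c \<and> pebble_rule (length gs) letter_at ?c" if t: "t \<ge> 0"
  proof
    have "nat (t + 1) = Suc (nat t)" using t by simp
    then have next_conf: "(q1, tape1, h1, w1) = apply_action (q, tape, h, w) (q', b, d, e)"
      using C1 C A delayed_run_Suc[of ?O M "nat t"] by simp
    have n: "q1 = q'" "tape1 = tape(h := b)"
      "h1 = (if d = 0 then h - 1 else if d = 1 then h + 1 else h)"
      "w1 = (if q = q_query then [] else if e = 0 then w else w @ [e - 1])"
      using next_conf by simp_all
    have lev1: "phase (level_of (?X x (t + 1))) = 2" "state (level_of (?X x (t + 1))) = q'" for x
      using t n(1) by (auto simp: fields level_at_def C1 split: prod.split)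
    note l = lev[OF t]
    have t1: "0 \<le> t + 1" using t by simp
    have jk: "succ_dir (?X g t) = Suc j \<longleftrightarrow> (\<exists>i. g = r i \<and> j = k i)" for j
      by (auto simp: fields inv_r)
    show "tape_rule (length gs) ?c"
      unfolding tape_rule_def
    proof (intro conjI impI allI)
      show "phase (level_of (?c (length gs))) = 2"
        "state (level_of (?c (length gs))) = state' (level_of (?c 0))"
        using g lev1 l by simp_all
      show "tape_symbol (?c 0) = scanned (level_of (?c 0))" if "head (?c 0) = 1"
        using that g t l by (auto simp: fields_t inv_r split: if_splits)
      show "tape_symbol (?c (length gs)) =
          (if head (?c 0) = 1 then written (level_of (?c 0)) else tape_symbol (?c 0))"
        using g t l by (auto simp: fields_t fields_t1 inv_r r_eq n(2))
      show "head (?c (length gs)) = head (?c 0)" if "direction (level_of (?c 0)) = 2"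
        using that g t l by (simp add: fields_t fields_t1 n(3))
      show "head (?c (length gs)) = 0"
        if "direction (level_of (?c 0)) = 1" "pred_dir (?c 0) = 0"
        using that g t l by (auto simp: fields fields_t1 n(3) r_eq split: if_splits)
      show "head (?c (length gs + j)) = head (?c 0)"
        if prems: "direction (level_of (?c 0)) = 1" "j < length gs" "succ_dir (?c 0) = Suc j" for j
      proof -
        obtain i where "g = r i" "j = k i" using prems(3) g jk by auto
        then show ?thesis
          using prems(1) g t l by (simp add: r(4)[symmetric] fields_t fields_t1 n(3) r_eq)
      qed
      show "head (?c (length gs)) =
          (if head (?c j) = 1 \<or> pred_dir (?c 0) = 0 \<and> head (?c 0) = 1 then 1 else 0)"
        if prems: "direction (level_of (?c 0)) = 0" "j < length gs" "succ_dir (?c 0) = Suc j" for j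
      proof -
        obtain i where "g = r i" "j = k i" using prems(3) g jk by auto
        then show ?thesis
          using prems(1,2) g t l
          by (auto simp: r(4)[symmetric] fields fields_t fields_t1 n(3) r_eq inv_r)
      qed
    qed
    have q_pos: "t > 0" if "q = q_query"
      using that t C delayed_run_0[of ?O M] by (cases "t = 0") auto
    show "pebble_rule (length gs) letter_at ?c"
      unfolding pebble_rule_def
    proof (intro conjI impI allI)
      show "pebble (?c (length gs)) = seed (?c 0)" if "state (level_of (?c 0)) = q_query"
        using that g t l by (simp add: fields fields_t1 n(4) pointed_Nil)
      show "state' (level_of (?c 0)) = (if pebble (?c 0) = 1 then q_yes else q_no)"
        if "state (level_of (?c 0)) = q_query" "seed (?c 0) = 1"
      proof -
        have "q = q_query" "g = \<one>" using that g l by (auto simp: fields split: if_splits)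
        then show ?thesis
          using ok(3)[OF q_pos] g t l by (simp add: fields_t WP_iff_pointed)
      qed
      show "pebble (?c (length gs)) = pebble (?c 0)"
        if "state (level_of (?c 0)) \<noteq> q_query \<and> letter (level_of (?c 0)) = 0"
        using that g t l by (simp add: fields_t fields_t1 n(4))
      show "pebble (?c (length gs + j)) = pebble (?c 0)"
        if "state (level_of (?c 0)) \<noteq> q_query \<and> letter (level_of (?c 0)) \<noteq> 0"
          "j < length gs" "letter_at j = letter (level_of (?c 0))" for j
      proof -
        have e: "q \<noteq> q_query" "e \<noteq> 0" "letter_at j = e" using that g l by auto
        then have "gs ! j \<in> S" "e = Suc (\<nu> (gs ! j))" by (auto simp: letter_at_def split: if_splits)
        then show ?thesis
          using e g t pointed_snoc[of "gs ! j" g w] by (simp add: fields_t fields_t1 n(4))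
      qed
      show "pebble (?c (length gs)) = 0"
        if "state (level_of (?c 0)) \<noteq> q_query \<and> letter (level_of (?c 0)) \<noteq> 0"
          "\<forall>j<length gs. letter_at j \<noteq> letter (level_of (?c 0))"
      proof -
        have e: "q \<noteq> q_query" "e \<noteq> 0" "\<And>j. j < length gs \<Longrightarrow> letter_at j \<noteq> e" using that g l by auto
        have "e - 1 \<notin> \<nu> ` S"
        proof
          assume "e - 1 \<in> \<nu> ` S"
          then obtain s j where "s \<in> S" "e - 1 = \<nu> s" "j < length gs" "gs ! j = s"
            using S_index by blast
          then show False using e(2) e(3)[of j] by (simp add: letter_at_def)
        qed
        then show ?thesis
          using e(1,2) g not_pointed_snoc[of "e - 1" w g] by (simp add: fields_t1 n(4))
      qed
    qed
  qed
  show "tile_rule (length gs) V W letter_at (code_otm M) ?c"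
    unfolding tile_rule_def using static init machine dyn g phase[of g]
    by (auto split: if_splits)
qed

end

text \<open>A bound for symbols all of whose fields are at most \<open>N\<close>.\<close>

definition alphabet_size :: "nat \<Rightarrow> nat" where
  "alphabet_size N = Suc (cell N N N N N N N (level N N N N N N N))"

lemma level_mono:
  assumes "s \<le> N" "q \<le> N" "a \<le> N" "q' \<le> N" "b \<le> N" "d \<le> N" "e \<le> N"
  shows "level s q a q' b d e \<le> level N N N N N N N"
  using assms unfolding level_def by (intro list_encode_mono) simp

lemma cell_mono:
  assumes "c \<le> N" "s \<le> N" "x \<le> N" "p \<le> N" "h \<le> N" "o' \<le> N" "t \<le> N" "l \<le> level N N N N N N N"
  shows "cell c s x p h o' t l < alphabet_size N"
proof -
  have "cell c s x p h o' t l \<le> cell N N N N N N N (level N N N N N N N)"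
    using assms unfolding cell_def by (intro list_encode_mono) simp
  then show ?thesis by (simp add: alphabet_size_def)
qed

lemma rec_fun_alphabet_size: "rec_fun n f \<Longrightarrow> rec_fun n (\<lambda>xs. alphabet_size (f xs))"
  unfolding alphabet_size_def cell_def level_def
  by (simp only: list_encode.simps) (intro rec_intros rec_fun_prod_encode)

text \<open>All that a machine can write occurs as an entry of an entry of its code, and entries are at most
  the code; the states \<open>q_yes\<close> and \<open>q_no\<close> account for the summand \<open>4\<close>. So the alphabet is finite and
  computable from the code.\<close>

lemma action_of_bound:
  assumes "action_of Ora M c = (q', b, d, e)" "conf_state c \<le> code_otm M + 4"
    "\<And>j. conf_tape c j \<le> code_otm M"
  shows "q' \<le> code_otm M + 4 \<and> b \<le> code_otm M \<and> d \<le> 2 \<and> e \<le> code_otm M"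
proof -
  obtain q t h w where c: "c = (q, t, h, w)" by (cases c) auto
  have ok: "action_ok (code_otm M) q (t h) q' b d e"
    using assms(1) unfolding c action_of_iff by simp
  have "code_nth i (code_nth j n) \<le> n" for i j n
    using code_nth_le order.trans by blast
  then have "q' \<le> code_otm M + 4 \<and> b \<le> code_otm M \<and> e \<le> code_otm M"
    using ok assms(2) assms(3)[of h] unfolding action_ok_def c
    by (cases "q = q_query"; cases "code_drop (entry_pos (code_otm M) q (t h)) (code_otm M) = 0")
      (auto intro: trans_le_add1)
  then show ?thesis using action_of_direction[OF assms(1)] by simp
qed

lemma oracle_run_bound:
  "conf_state (oracle_run Ora M i) \<le> code_otm M + 4 \<and> conf_tape (oracle_run Ora M i) j \<le> code_otm M"
proof (induction i arbitrary: j)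
  case 0
  then show ?case by (simp add: oracle_run_def)
next
  case (Suc i)
  obtain q t h w where c: "oracle_run Ora M i = (q, t, h, w)" by (cases "oracle_run Ora M i") auto
  obtain q' b d e where a: "action_of Ora M (q, t, h, w) = (q', b, d, e)"
    by (cases "action_of Ora M (q, t, h, w)") auto
  have "oracle_run Ora M (Suc i) = apply_action (q, t, h, w) (q', b, d, e)"
    using c a apply_action_of[of "(q, t, h, w)" Ora M]
    by (simp add: oracle_run_def del: oracle_next.simps apply_action.simps action_of.simps)
  then show ?case
    using action_of_bound[OF a] Suc[of j] Suc c by simp
qed

lemma (in tiling) run_tiling_bound:
  assumes "\<xi> g \<le> B" "4 \<le> B" "length gs \<le> B" "\<And>i. k i < length gs"
  shows "run_tiling M \<xi> r k g t < alphabet_size (code_otm M + B)"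
proof -
  let ?O = "WP G S \<nu>" and ?N = "code_otm M + B"
  obtain q tape h w where C: "delayed_run ?O M (nat t) = (q, tape, h, w)"
    by (cases "delayed_run ?O M (nat t)") auto
  obtain q' b d e where A: "delayed_action ?O M (nat t) = (q', b, d, e)"
    by (cases "delayed_action ?O M (nat t)") auto
  have C_bound: "q \<le> code_otm M + 4" "\<And>j. tape j \<le> code_otm M"
    using oracle_run_bound[of ?O M "nat t - 1"] C unfolding delayed_run_def by auto
  have "q' \<le> code_otm M + 4 \<and> b \<le> code_otm M \<and> d \<le> 2 \<and> e \<le> code_otm M"
  proof (cases "nat t = 0")
    case True
    then show ?thesis using A by (auto simp: delayed_action_def)
  next
    case False
    then have "action_of ?O M (q, tape, h, w) = (q', b, d, e)"
      using A C by (simp add: delayed_action_def delayed_run_def del: action_of.simps)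
    then show ?thesis by (rule action_of_bound) (use C_bound in auto)
  qed
  then have "level_at ?O M t \<le> level ?N ?N ?N ?N ?N ?N ?N"
    unfolding level_at_def C A using C_bound(1) C_bound(2)[of h] assms(2)
    by (auto intro!: level_mono)
  moreover have "Suc (k i) \<le> ?N" for i using assms(3) assms(4)[of i] by simp
  moreover have "tape i \<le> ?N" for i using C_bound(2) trans_le_add1 by blast
  ultimately show ?thesis
    unfolding run_tiling_def C using assms(1,2) by (auto intro!: cell_mono)
qed

section \<open>The last syllable of an element of a free product\<close>

fun syllable_ok ::
    "('p, 'm) monoid_scheme \<Rightarrow> ('h, 'n) monoid_scheme \<Rightarrow> 'p + 'h \<Rightarrow> bool" where
  "syllable_ok P H (Inl p) \<longleftrightarrow> p \<in> carrier P \<and> p \<noteq> \<one>\<^bsub>P\<^esub>"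
| "syllable_ok P H (Inr h) \<longleftrightarrow> h \<in> carrier H \<and> h \<noteq> \<one>\<^bsub>H\<^esub>"

text \<open>Reduced words are kept in reverse order, with the last syllable in front.\<close>

fun reduced ::
    "('p, 'm) monoid_scheme \<Rightarrow> ('h, 'n) monoid_scheme \<Rightarrow> ('p + 'h) list \<Rightarrow> bool" where
  "reduced P H [] \<longleftrightarrow> True"
| "reduced P H (x # st) \<longleftrightarrow> syllable_ok P H x \<and> reduced P H st \<and> (st \<noteq> [] \<longrightarrow> isl x \<noteq> isl (hd st))"

text \<open>Multiplication of a reduced word on the right by an element of one factor.\<close>

fun push_l :: "('p, 'm) monoid_scheme \<Rightarrow> 'p \<Rightarrow> ('p + 'h) list \<Rightarrow> ('p + 'h) list" where
  "push_l P p (Inl p' # st) = (if p' \<otimes>\<^bsub>P\<^esub> p = \<one>\<^bsub>P\<^esub> then st else Inl (p' \<otimes>\<^bsub>P\<^esub> p) # st)"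
| "push_l P p st = (if p = \<one>\<^bsub>P\<^esub> then st else Inl p # st)"

fun push_r :: "('h, 'n) monoid_scheme \<Rightarrow> 'h \<Rightarrow> ('p + 'h) list \<Rightarrow> ('p + 'h) list" where
  "push_r H h (Inr h' # st) = (if h' \<otimes>\<^bsub>H\<^esub> h = \<one>\<^bsub>H\<^esub> then st else Inr (h' \<otimes>\<^bsub>H\<^esub> h) # st)"
| "push_r H h st = (if h = \<one>\<^bsub>H\<^esub> then st else Inr h # st)"

fun push ::
    "('p, 'm) monoid_scheme \<Rightarrow> ('h, 'n) monoid_scheme \<Rightarrow> 'p + 'h \<Rightarrow> ('p + 'h) list \<Rightarrow> ('p + 'h) list" where
  "push P H (Inl p) st = push_l P p st"
| "push P H (Inr h) st = push_r H h st"

locale two_groups = P: group P + H: group H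
  for P :: "('p, 'm) monoid_scheme" and H :: "('h, 'n) monoid_scheme"
begin

lemma stack_cases:
  obtains "st = []" | p st' where "st = Inl p # st'" | h st' where "st = Inr h # st'"
  by (cases st) (auto, metis sum.exhaust)

lemma reduced_Inl_tl: "reduced P H (Inl p # st) \<Longrightarrow> st = [] \<or> (\<exists>h st'. st = Inr h # st')"
  by (cases st rule: stack_cases) auto

lemma reduced_Inr_tl: "reduced P H (Inr h # st) \<Longrightarrow> st = [] \<or> (\<exists>p st'. st = Inl p # st')"
  by (cases st rule: stack_cases) auto

lemma reduced_push:
  assumes "reduced P H st" "x \<in> carrier P <+> carrier H"
  shows "reduced P H (push P H x st)"
  using assms by (cases st rule: stack_cases; cases x) auto

lemma push_one:
  assumes "reduced P H st"
  shows "push_l P \<one>\<^bsub>P\<^esub> st = st" "push_r H \<one>\<^bsub>H\<^esub> st = st"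
  using assms by (cases st rule: stack_cases; auto)+

lemma push_l_push_l:
  assumes "reduced P H st" "x \<in> carrier P" "y \<in> carrier P"
  shows "push_l P y (push_l P x st) = push_l P (x \<otimes>\<^bsub>P\<^esub> y) st"
proof (cases st rule: stack_cases)
  case 1
  then show ?thesis using assms by auto
next
  case (2 p st')
  have p: "p \<in> carrier P" "p \<noteq> \<one>\<^bsub>P\<^esub>" using assms(1) 2 by auto
  have tl: "st' = [] \<or> (\<exists>h st''. st' = Inr h # st'')"
    using reduced_Inl_tl assms(1) 2 by blast
  have "p \<otimes>\<^bsub>P\<^esub> x \<otimes>\<^bsub>P\<^esub> y = p \<otimes>\<^bsub>P\<^esub> (x \<otimes>\<^bsub>P\<^esub> y)" using p assms by (simp add: P.m_assoc)
  then show ?thesis using 2 tl assms p by auto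
next
  case (3 h st')
  then show ?thesis using assms by auto
qed

lemma push_r_push_r:
  assumes "reduced P H st" "x \<in> carrier H" "y \<in> carrier H"
  shows "push_r H y (push_r H x st) = push_r H (x \<otimes>\<^bsub>H\<^esub> y) st"
proof (cases st rule: stack_cases)
  case 1
  then show ?thesis using assms by auto
next
  case (3 p st')
  have p: "p \<in> carrier H" "p \<noteq> \<one>\<^bsub>H\<^esub>" using assms(1) 3 by auto
  have tl: "st' = [] \<or> (\<exists>h st''. st' = Inl h # st'')"
    using reduced_Inr_tl assms(1) 3 by blast
  have "p \<otimes>\<^bsub>H\<^esub> x \<otimes>\<^bsub>H\<^esub> y = p \<otimes>\<^bsub>H\<^esub> (x \<otimes>\<^bsub>H\<^esub> y)" using p assms by (simp add: H.m_assoc)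
  then show ?thesis using 3 tl assms p by auto
next
  case (2 h st')
  then show ?thesis using assms by auto
qed

abbreviation push_word :: "('p + 'h) list \<Rightarrow> ('p + 'h) list \<Rightarrow> ('p + 'h) list" where
  "push_word u st \<equiv> fold (push P H) u st"

lemma reduced_push_word:
  "u \<in> fp_words P H \<Longrightarrow> reduced P H st \<Longrightarrow> reduced P H (push_word u st)"
  by (induction u arbitrary: st) (auto simp: fp_words_def reduced_push)

text \<open>Van der Waerden's argument: words act on reduced words by appending syllables, and equal
  elements of the free product act equally.\<close>

lemma push_word_cong:
  "fp_eq P H u v \<Longrightarrow> reduced P H st \<Longrightarrow> push_word u st = push_word v st"
proof (induction arbitrary: st rule: fp_eq.induct)
  case (append u u' v v')
  have "u' \<in> fp_words P H"
    using fp_eq_words[OF P.is_group H.is_group append.hyps(1)] by blast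
  then show ?case using append reduced_push_word by simp
qed (auto simp: push_one push_l_push_l push_r_push_r)

text \<open>The last syllable is replaced by the identity if it lies in the other factor. The resulting
  map from the free product to \<open>P\<close> commutes with multiplication by \<open>P\<close> on the right.\<close>

definition last_syllable :: "('p + 'h) list \<Rightarrow> 'p" where
  "last_syllable st = (case st of Inl p # _ \<Rightarrow> p | _ \<Rightarrow> \<one>\<^bsub>P\<^esub>)"

definition P_part :: "('p + 'h) list set \<Rightarrow> 'p" where
  "P_part k = last_syllable (push_word (SOME u. u \<in> k) [])"

definition of_P :: "'p \<Rightarrow> ('p + 'h) list set" where
  "of_P p = fp_rel P H `` {[Inl p]}"

definition of_H :: "'h \<Rightarrow> ('p + 'h) list set" where
  "of_H h = fp_rel P H `` {[Inr h]}"

lemma P_part_class: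
  assumes "u \<in> fp_words P H"
  shows "P_part (fp_rel P H `` {u}) = last_syllable (push_word u [])"
proof -
  have "u \<in> fp_rel P H `` {u}" using assms by (auto simp: fp_rel_def intro: fp_eq.refl)
  then have "(SOME v. v \<in> fp_rel P H `` {u}) \<in> fp_rel P H `` {u}" by (rule someI)
  then have "fp_eq P H u (SOME v. v \<in> fp_rel P H `` {u})" by (simp add: fp_rel_def)
  from push_word_cong[OF this, of "[]"] show ?thesis by (simp add: P_part_def)
qed

lemma free_product_class:
  assumes "k \<in> carrier (free_product P H)"
  obtains u where "u \<in> fp_words P H" "k = fp_rel P H `` {u}"
  using assms by (auto simp: free_product_def elim: quotientE)

lemma singleton_words:
  "p \<in> carrier P \<Longrightarrow> [Inl p] \<in> fp_words P H" "h \<in> carrier H \<Longrightarrow> [Inr h] \<in> fp_words P H"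
  by (auto simp: fp_words_def)

lemma of_P_closed: "p \<in> carrier P \<Longrightarrow> of_P p \<in> carrier (free_product P H)"
  using singleton_words by (auto simp: of_P_def free_product_def intro: quotientI)

lemma of_H_closed: "h \<in> carrier H \<Longrightarrow> of_H h \<in> carrier (free_product P H)"
  using singleton_words by (auto simp: of_H_def free_product_def intro: quotientI)

lemma class_eq: "fp_eq P H u v \<Longrightarrow> fp_rel P H `` {u} = fp_rel P H `` {v}"
  by (rule equiv_class_eq[OF equiv_fp_rel[OF P.is_group H.is_group]]) (simp add: fp_rel_def)

lemma of_P_mult:
  "p \<in> carrier P \<Longrightarrow> q \<in> carrier P \<Longrightarrow> of_P (p \<otimes>\<^bsub>P\<^esub> q) = of_P p \<otimes>\<^bsub>free_product P H\<^esub> of_P q"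
  unfolding of_P_def
  by (subst free_product_mult_class[OF P.is_group H.is_group])
     (auto simp: singleton_words intro!: class_eq fp_eq.sym[OF fp_eq.mult_l])

lemma of_P_one: "of_P \<one>\<^bsub>P\<^esub> = \<one>\<^bsub>free_product P H\<^esub>"
  using class_eq[OF fp_eq.one_l] by (simp add: of_P_def free_product_def)

lemma of_H_one: "of_H \<one>\<^bsub>H\<^esub> = \<one>\<^bsub>free_product P H\<^esub>"
  using class_eq[OF fp_eq.one_r] by (simp add: of_H_def free_product_def)

lemma P_part_closed_mult:
  assumes "k \<in> carrier (free_product P H)"
  shows "P_part k \<in> carrier P"
    and "p \<in> carrier P \<Longrightarrow> P_part (k \<otimes>\<^bsub>free_product P H\<^esub> of_P p) = P_part k \<otimes>\<^bsub>P\<^esub> p"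
    and "P_part k \<noteq> \<one>\<^bsub>P\<^esub> \<Longrightarrow> h \<in> carrier H \<Longrightarrow> h \<noteq> \<one>\<^bsub>H\<^esub> \<Longrightarrow>
      P_part (k \<otimes>\<^bsub>free_product P H\<^esub> of_H h) = \<one>\<^bsub>P\<^esub>"
proof -
  obtain u where u: "u \<in> fp_words P H" "k = fp_rel P H `` {u}"
    using assms by (rule free_product_class)
  define st where "st = push_word u []"
  have st: "reduced P H st" using reduced_push_word[OF u(1)] by (simp add: st_def)
  have k: "P_part k = last_syllable st" using P_part_class[OF u(1)] u(2) by (simp add: st_def)
  have snoc: "P_part (k \<otimes>\<^bsub>free_product P H\<^esub> (fp_rel P H `` {[x]})) = last_syllable (push P H x st)"
    if "[x] \<in> fp_words P H" for x
  proof -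
    have "u @ [x] \<in> fp_words P H" using u(1) that by (auto simp: fp_words_def)
    then show ?thesis
      using free_product_mult_class[OF P.is_group H.is_group u(1) that] P_part_class[of "u @ [x]"] u(2)
      by (simp add: st_def)
  qed
  show "P_part k \<in> carrier P"
    using st k by (cases st rule: stack_cases) (auto simp: last_syllable_def)
  show "P_part (k \<otimes>\<^bsub>free_product P H\<^esub> of_P p) = P_part k \<otimes>\<^bsub>P\<^esub> p" if p: "p \<in> carrier P"
  proof -
    have "last_syllable (push_l P p st) = last_syllable st \<otimes>\<^bsub>P\<^esub> p"
      using st p
    proof (cases st rule: stack_cases)
      case (2 p' st')
      then have "st' = [] \<or> (\<exists>h st''. st' = Inr h # st'')"
        using reduced_Inl_tl st by blast
      then show ?thesis using 2 by (auto simp: last_syllable_def)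
    qed (auto simp: last_syllable_def)
    then show ?thesis using snoc[OF singleton_words(1)[OF p]] k by (simp add: of_P_def)
  qed
  show "P_part (k \<otimes>\<^bsub>free_product P H\<^esub> of_H h) = \<one>\<^bsub>P\<^esub>"
    if "P_part k \<noteq> \<one>\<^bsub>P\<^esub>" and h: "h \<in> carrier H" "h \<noteq> \<one>\<^bsub>H\<^esub>"
  proof -
    have "last_syllable st \<noteq> \<one>\<^bsub>P\<^esub>" using that(1) k by simp
    then have "last_syllable (push_r H h st) = \<one>\<^bsub>P\<^esub>"
      using h by (cases st rule: stack_cases) (auto simp: last_syllable_def)
    then show ?thesis using snoc[OF singleton_words(2)[OF h(1)]] by (simp add: of_H_def)
  qed
qed

end

section \<open>Windows that mark at most one place\<close>

abbreviation window_code :: "('a, 'm) monoid_scheme \<Rightarrow> 'a list \<Rightarrow> ('a \<Rightarrow> nat) \<Rightarrow> 'a \<Rightarrow> nat" where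
  "window_code G gs \<xi> g \<equiv> list_encode (map (\<lambda>j. \<xi> (g \<otimes>\<^bsub>G\<^esub> gs ! j)) [0..<length gs])"

lemma map_nth_upt: "map (\<lambda>j. f (xs ! j)) [0..<length xs] = map f xs"
  by (rule nth_equalityI) auto

text \<open>The special symbol property in terms of windows: if all windows of a labelling of \<open>G\<close>
  lie in \<open>V\<close>, then at most one of them lies in \<open>W\<close>, and some labelling \<open>\<xi>\<close> has its only such
  window at the identity. The list \<open>gs\<close> collects the window of the factor map, the places in the
  forbidden patterns of the SFT, and the generators.\<close>

lemma special_symbol_windows:
  fixes G (structure)
  assumes "group G" "sym_gen_set G S" "special_symbol_property G S"
  obtains gs V W \<xi> B where
    "set gs \<subseteq> carrier G" "S \<subseteq> set gs" "gs \<noteq> []" "gs ! 0 = \<one>" "finite V" "finite W"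
    "\<And>g. g \<in> carrier G \<Longrightarrow> \<xi> g \<le> (B::nat)"
    "\<And>g. g \<in> carrier G \<Longrightarrow> window_code G gs \<xi> g \<in> V"
    "\<And>g. g \<in> carrier G \<Longrightarrow> window_code G gs \<xi> g \<in> W \<longleftrightarrow> g = \<one>"
    "\<And>\<zeta> g h. (\<And>g. g \<in> carrier G \<Longrightarrow> window_code G gs \<zeta> g \<in> V) \<Longrightarrow> g \<in> carrier G \<Longrightarrow> h \<in> carrier G \<Longrightarrow>
      window_code G gs \<zeta> g \<in> W \<Longrightarrow> window_code G gs \<zeta> h \<in> W \<Longrightarrow> g = h"
proof -
  interpret group G by fact
  have S: "finite S" "S \<subseteq> carrier G" using assms(2) by (auto simp: sym_gen_set_def)
  obtain A X \<phi> where sft: "SFT G S A X"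
    and cont: "continuous_map (subtopology (shift_topology G A) X) (shift_topology G {0, 1}) \<phi>"
    and equi: "\<And>g x. g \<in> carrier G \<Longrightarrow> x \<in> X \<Longrightarrow> \<phi> (shift G g x) = shift G g (\<phi> x)"
    and img: "\<phi> ` X = X_le_one G"
    using assms(3) unfolding special_symbol_property_def sofic_def by blast
  have A: "finite A" and closed: "closedin (shift_topology G A) X"
    and inv_X: "\<And>g x. g \<in> carrier G \<Longrightarrow> x \<in> X \<Longrightarrow> shift G g x \<in> X"
    using sft unfolding SFT_def subshift_def by auto
  obtain F where F: "finite F" "\<And>c. c \<in> F \<Longrightarrow> pattern_coding S A c" "X = X_forbid G A F"
    using sft unfolding SFT_def by blast
  obtain D where D: "finite D" "D \<subseteq> carrier G"
      "\<And>x y. x \<in> X \<Longrightarrow> y \<in> X \<Longrightarrow> \<forall>d\<in>D. x d = y d \<Longrightarrow> \<phi> x \<one> = \<phi> y \<one>"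
    using continuous_map_finite_window[OF A closed cont one_closed] by blast
  let ?E = "\<Union>c\<in>F. word_val G ` fst ` c"
  have E: "finite ?E" "?E \<subseteq> carrier G"
  proof -
    show "finite ?E" using F(1,2) by (auto simp: pattern_coding_def)
    show "?E \<subseteq> carrier G"
    proof
      fix e assume "e \<in> ?E"
      then obtain c w a where "c \<in> F" "(w, a) \<in> c" "e = word_val G w" by auto
      moreover from this have "w \<in> lists S" using F(2) by (auto simp: pattern_coding_def)
      ultimately show "e \<in> carrier G"
        using S(2) word_val_closed[OF assms(1)] by (meson lists_mono subsetD)
    qed
  qed
  obtain gs' where gs': "set gs' = S \<union> D \<union> ?E" using finite_list[of "S \<union> D \<union> ?E"] S(1) D(1) E(1) by auto
  define gs where "gs = \<one> # gs'"
  have gs: "set gs = insert \<one> (S \<union> D \<union> ?E)" "gs \<noteq> []" "gs ! 0 = \<one>" by (auto simp: gs_def gs')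
  have gs_c: "set gs \<subseteq> carrier G" using gs(1) S(2) D(2) E(2) by auto
  define V where "V = {list_encode (map y gs) | y. y \<in> full_shift G A \<and>
    (\<forall>c\<in>F. \<exists>(w, a)\<in>c. y (word_val G w) \<noteq> a)}"
  define W where "W = {list_encode (map y gs) | y. y \<in> X \<and> \<phi> y \<one> = 1}"
  have full: "X \<subseteq> full_shift G A" unfolding F(3) X_forbid_def by auto
  have fin: "finite (list_encode ` {ys. set ys \<subseteq> A \<and> length ys = length gs})"
    using A by (intro finite_imageI finite_lists_length_eq)
  have mapA: "set (map y gs) \<subseteq> A" if "y \<in> full_shift G A" for y
    using that gs_c by (auto simp: full_shift_def PiE_iff)
  have finV: "finite V"
    by (rule finite_subset[OF _ fin]) (use mapA in \<open>force simp: V_def\<close>)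
  have finW: "finite W"
    by (rule finite_subset[OF _ fin]) (use mapA full in \<open>force simp: W_def\<close>)
  have win: "window_code G gs \<zeta> g = list_encode (map (\<lambda>h. \<zeta> (g \<otimes> h)) gs)" for \<zeta> g
    by (simp add: map_nth_upt[of "\<lambda>h. \<zeta> (g \<otimes> h)"])
  have agree: "\<zeta> (g \<otimes> h) = y h" if "window_code G gs \<zeta> g = list_encode (map y gs)" "h \<in> set gs" for \<zeta> g y h
    using that unfolding win list_encode_eq by (auto simp: map_eq_conv)
  \<comment> \<open>The windows in \<open>V\<close> recognise the points of \<open>X\<close>, and those in \<open>W\<close> the place of the symbol \<open>1\<close>.\<close>
  have recog: "window_code G gs \<zeta> g \<in> V" "window_code G gs \<zeta> g \<in> W \<longleftrightarrow> \<phi> \<zeta> g = 1"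
    if z: "\<zeta> \<in> X" and g: "g \<in> carrier G" for \<zeta> g
  proof -
    let ?y = "shift G (inv g) \<zeta>"
    have y: "?y \<in> X" using inv_X z g by simp
    have yh: "?y h = \<zeta> (g \<otimes> h)" if "h \<in> carrier G" for h
      using that g by (simp add: shift_def)
    then have wy: "window_code G gs \<zeta> g = list_encode (map ?y gs)"
      unfolding win list_encode_eq using gs_c by auto
    have "\<exists>(w, a)\<in>c. ?y (word_val G w) \<noteq> a" if c: "c \<in> F" for c
    proof -
      have "?y \<notin> (\<Inter>(w, a)\<in>c. cylinder G A a (\<one> \<otimes> word_val G w))"
        using y c one_closed unfolding F(3) X_forbid_def by blast
      then obtain w a where wa: "(w, a) \<in> c" "?y \<notin> cylinder G A a (\<one> \<otimes> word_val G w)" by auto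
      then have "word_val G w \<in> carrier G" using E(2) c by force
      then show ?thesis using wa y full by (auto simp: cylinder_def)
    qed
    then show "window_code G gs \<zeta> g \<in> V" unfolding V_def wy using y full by blast
    have \<phi>y: "\<phi> ?y \<one> = \<phi> \<zeta> g" using equi[of "inv g" \<zeta>] z g by (simp add: shift_def)
    show "window_code G gs \<zeta> g \<in> W \<longleftrightarrow> \<phi> \<zeta> g = 1"
    proof
      assume "window_code G gs \<zeta> g \<in> W"
      then obtain x where x: "x \<in> X" "\<phi> x \<one> = 1" "window_code G gs \<zeta> g = list_encode (map x gs)"
        unfolding W_def by blast
      have "\<forall>d\<in>D. ?y d = x d" using agree[OF x(3)] yh D(2) gs(1) by auto
      then show "\<phi> \<zeta> g = 1" using D(3)[OF y x(1)] x(2) \<phi>y by simp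
    next
      assume "\<phi> \<zeta> g = 1"
      then show "window_code G gs \<zeta> g \<in> W" unfolding W_def wy using y \<phi>y by auto
    qed
  qed
  have valid: "restrict \<zeta> (carrier G) \<in> X" if v: "\<And>g. g \<in> carrier G \<Longrightarrow> window_code G gs \<zeta> g \<in> V" for \<zeta>
  proof -
    let ?z = "restrict \<zeta> (carrier G)"
    have obt: "\<exists>y. y \<in> full_shift G A \<and> (\<forall>c\<in>F. \<exists>(w, a)\<in>c. y (word_val G w) \<noteq> a) \<and>
      (\<forall>h\<in>set gs. \<zeta> (g \<otimes> h) = y h)" if "g \<in> carrier G" for g
      using v[OF that] agree unfolding V_def by blast
    have "\<zeta> g \<in> A" if g: "g \<in> carrier G" for g
    proof -
      obtain y where "y \<in> full_shift G A" "\<zeta> (g \<otimes> \<one>) = y \<one>" using obt[OF g] gs(1) by auto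
      then show ?thesis using g by (auto simp: full_shift_def PiE_iff)
    qed
    then have zf: "?z \<in> full_shift G A" by (auto simp: full_shift_def)
    have "?z \<notin> (\<Inter>(w, a)\<in>c. cylinder G A a (g \<otimes> word_val G w))"
      if g: "g \<in> carrier G" and c: "c \<in> F" for g c
    proof -
      obtain y w a where y: "(w, a) \<in> c" "y (word_val G w) \<noteq> a" "\<forall>h\<in>set gs. \<zeta> (g \<otimes> h) = y h"
        using obt[OF g] c by blast
      have "word_val G w \<in> set gs" using y(1) c gs(1) by force
      then have "?z (g \<otimes> word_val G w) \<noteq> a" using y(2,3) g gs_c by auto
      then have "?z \<notin> cylinder G A a (g \<otimes> word_val G w)" unfolding cylinder_def by blast
      then show ?thesis using y(1) by blast
    qed
    then show ?thesis unfolding F(3) X_forbid_def using zf by blast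
  qed
  define \<delta> where "\<delta> = (\<lambda>g\<in>carrier G. if g = \<one> then 1 else (0::nat))"
  have "\<delta> \<in> X_le_one G" by (auto simp: \<delta>_def X_le_one_def full_shift_def split: if_splits)
  then obtain \<xi> where \<xi>: "\<xi> \<in> X" "\<phi> \<xi> = \<delta>" using img by (metis imageE)
  obtain B where B: "\<And>a. a \<in> A \<Longrightarrow> a \<le> B" using A by (metis finite_nat_set_iff_bounded_le)
  show thesis
  proof (rule that[OF gs_c _ gs(2,3) finV finW])
    show "S \<subseteq> set gs" using gs(1) by auto
    show "\<xi> g \<le> B" if "g \<in> carrier G" for g
      using \<xi>(1) full that B by (auto simp: full_shift_def PiE_iff subset_iff)
    show "window_code G gs \<xi> g \<in> V" if "g \<in> carrier G" for g
      using recog(1)[OF \<xi>(1) that] .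
    show "window_code G gs \<xi> g \<in> W \<longleftrightarrow> g = \<one>" if "g \<in> carrier G" for g
      using recog(2)[OF \<xi>(1) that] that by (simp add: \<xi>(2) \<delta>_def)
    fix \<zeta> g h
    assume v: "\<And>g. g \<in> carrier G \<Longrightarrow> window_code G gs \<zeta> g \<in> V" and gh: "g \<in> carrier G" "h \<in> carrier G"
      and m: "window_code G gs \<zeta> g \<in> W" "window_code G gs \<zeta> h \<in> W"
    let ?z = "restrict \<zeta> (carrier G)"
    have z: "?z \<in> X" using valid[OF v] .
    have "window_code G gs \<zeta> k = window_code G gs ?z k" if "k \<in> carrier G" for k
      unfolding win list_encode_eq using that gs_c by auto
    then have "\<phi> ?z g = 1" "\<phi> ?z h = 1" using m gh recog(2)[OF z] by auto
    moreover have "\<phi> ?z \<in> X_le_one G" using z img by blast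
    ultimately show "g = h" using gh unfolding X_le_one_def by blast
  qed
qed

section \<open>Reducing oracle halting to tilings of the product with the integers\<close>

text \<open>A uniformly computable family of local rules: \<open>k n\<close> is the size of the alphabet of the rule \<open>R n\<close>,
  which reads the symbols at \<open>N\<close> places.\<close>

definition computable_rule :: "nat \<Rightarrow> (nat \<Rightarrow> nat) \<Rightarrow> (nat \<Rightarrow> (nat \<Rightarrow> nat) \<Rightarrow> bool) \<Rightarrow> bool" where
  "computable_rule N k R \<longleftrightarrow> rec_fun 1 (\<lambda>xs. k (xs ! 0)) \<and>
     dec_pred 2 (\<lambda>xs. R (xs ! 0) (\<lambda>j. code_nth j (xs ! 1))) \<and>
     (\<forall>n c c'. (\<forall>j<N. c j = c' j) \<longrightarrow> R n c = R n c')"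

lemma oracle_halting_iff:
  "code_otm M \<in> oracle_halting Ora \<longleftrightarrow> accepts_empty Ora M"
  using inj_code_otm unfolding oracle_halting_def inj_def by auto

text \<open>Numbers that are no codes of machines get the rule that allows everything.\<close>

lemma tiling_reduction:
  fixes G :: "('a, 'm) monoid_scheme" (structure)
  assumes "group G" "infinite (carrier G)" "sym_gen_set G S" "inj_on \<nu> S"
    "special_symbol_property G S"
  defines "P \<equiv> G \<times>\<times> integer_group"
  obtains ps k R a0 where
    "set ps \<subseteq> carrier P" "computable_rule (length ps) k R" "\<And>n. a0 < k n"
    "\<And>n. n \<notin> oracle_halting (WP G S \<nu>) \<longleftrightarrow> (\<exists>x. x \<one>\<^bsub>P\<^esub> = a0 \<and>
       (\<forall>p\<in>carrier P. x p < k n \<and> R n (\<lambda>j. x (p \<otimes>\<^bsub>P\<^esub> ps ! j))))"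
proof -
  obtain gs V W \<xi> B0 where gs: "set gs \<subseteq> carrier G" "S \<subseteq> set gs" "gs \<noteq> []" "gs ! 0 = \<one>"
    and fin: "finite V" "finite W" and B0: "\<And>g. g \<in> carrier G \<Longrightarrow> \<xi> g \<le> (B0::nat)"
    and xi: "\<And>g. g \<in> carrier G \<Longrightarrow> window_code G gs \<xi> g \<in> V"
      "\<And>g. g \<in> carrier G \<Longrightarrow> window_code G gs \<xi> g \<in> W \<longleftrightarrow> g = \<one>"
    and unique: "\<And>\<zeta> g h. (\<And>g. g \<in> carrier G \<Longrightarrow> window_code G gs \<zeta> g \<in> V) \<Longrightarrow> g \<in> carrier G \<Longrightarrow>
      h \<in> carrier G \<Longrightarrow> window_code G gs \<zeta> g \<in> W \<Longrightarrow> window_code G gs \<zeta> h \<in> W \<Longrightarrow> g = h"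
    using special_symbol_windows[OF assms(1,3,5)] by blast
  interpret tiling G S \<nu> gs
    using assms(1,3,4) gs by (simp add: tiling_def tiling_axioms_def)
  let ?m = "length gs" and ?O = "WP G S \<nu>"
  obtain r :: "nat \<Rightarrow> 'a" where r: "r 0 = \<one>" "inj r" "range r \<subseteq> carrier G"
      "\<forall>i. \<exists>s\<in>S. r (Suc i) = r i \<otimes> s"
    using exists_injective_ray[OF assms(1,3,2)] by blast
  have "\<forall>i. \<exists>j. r (Suc i) = r i \<otimes> gs ! j \<and> j < ?m"
    using r(4) S_index by metis
  then obtain d where d: "\<And>i. r (Suc i) = r i \<otimes> gs ! d i" "\<And>i. d i < ?m" by metis
  have rc: "r i \<in> carrier G" for i using r(3) by auto
  define B where "B = max B0 (max 4 ?m)"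
  define a0 where "a0 = cell (\<xi> \<one>) 1 (Suc (d 0)) 0 1 1 0 (level 1 0 0 0 0 2 0)"
  define k where "k n = alphabet_size (n + B)" for n
  define R where "R n c \<longleftrightarrow> (is_otm_code n \<longrightarrow> tile_rule ?m V W letter_at n c)" for n c
  define ps where "ps = map (\<lambda>g. (g, 0::int)) gs @ map (\<lambda>g. (g, 1)) gs"
  have len: "length ps = 2 * ?m" by (simp add: ps_def)
  have P: "carrier P = carrier G \<times> UNIV" "\<one>\<^bsub>P\<^esub> = (\<one>, 0)"
    "\<And>g t h s. (g, t) \<otimes>\<^bsub>P\<^esub> (h, s) = (g \<otimes> h, t + s)"
    by (simp_all add: P_def)
  have R_cong: "R n c = R n c'" if "\<forall>j<length ps. c j = c' j" for n c c'
    using tile_rule_cong[of ?m c c'] that gs_0(2) len unfolding R_def by auto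
  have nbhd: "R n (\<lambda>j. x ((g, t) \<otimes>\<^bsub>P\<^esub> ps ! j)) = R n (neighbourhood (\<lambda>g t. x (g, t)) g t)"
    for n g t and x :: "'a \<times> int \<Rightarrow> nat"
  proof (rule R_cong, intro allI impI)
    fix j assume "j < length ps"
    then have "ps ! j = (if j < ?m then (gs ! j, 0) else (gs ! (j - ?m), 1))"
      by (auto simp: ps_def nth_append)
    then show "x ((g, t) \<otimes>\<^bsub>P\<^esub> ps ! j) = neighbourhood (\<lambda>g t. x (g, t)) g t j"
      by (auto simp: neighbourhood_def P)
  qed
  show thesis
  proof (rule that[of ps k R a0])
    show "set ps \<subseteq> carrier P" using gs(1) by (auto simp: ps_def P)
    show "computable_rule (length ps) k R"
      unfolding computable_rule_def
    proof (intro conjI allI impI)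
      show "rec_fun 1 (\<lambda>xs. k (xs ! 0))"
        unfolding k_def by (intro rec_fun_alphabet_size rec_intros) simp
      show "dec_pred 2 (\<lambda>xs. R (xs ! 0) (\<lambda>j. code_nth j (xs ! 1)))"
        unfolding R_def
        by (intro dec_pred_imp dec_pred_is_otm_code dec_pred_tile_rule fin rec_fun_code_nth
            rec_fun_const rec_fun_proj) simp_all
    qed (rule R_cong)
    show a0: "a0 < k n" for n
      unfolding a0_def k_def using B0[OF one_closed] d(2)[of 0]
      by (intro cell_mono level_mono) (auto simp: B_def)
    fix n
    show "n \<notin> oracle_halting ?O \<longleftrightarrow> (\<exists>x. x \<one>\<^bsub>P\<^esub> = a0 \<and>
       (\<forall>p\<in>carrier P. x p < k n \<and> R n (\<lambda>j. x (p \<otimes>\<^bsub>P\<^esub> ps ! j))))"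
    proof
      assume n: "n \<notin> oracle_halting ?O"
      show "\<exists>x. x \<one>\<^bsub>P\<^esub> = a0 \<and> (\<forall>p\<in>carrier P. x p < k n \<and> R n (\<lambda>j. x (p \<otimes>\<^bsub>P\<^esub> ps ! j)))"
      proof (cases "is_otm_code n")
        case False
        then show ?thesis using a0 by (intro exI[of _ "\<lambda>_. a0"]) (simp add: R_def)
      next
        case True
        then obtain M where M: "n = code_otm M" unfolding is_otm_code_iff by blast
        let ?X = "run_tiling M \<xi> r d"
        have "\<not> accepts_empty ?O M" using n M oracle_halting_iff by simp
        then have valid: "valid_tiling V W n ?X"
          unfolding M by (intro valid_run_tiling r rc d xi)
        have "?X \<one> 0 = a0"
        proof -
          have "inv_into UNIV r \<one> = 0" using r(1,2) by (metis inv_f_f)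
          moreover have "\<one> \<in> range r" using r(1) rangeI[of r 0] by simp
          ultimately show ?thesis
            unfolding run_tiling_def a0_def
            by (simp add: delayed_run_0 r(1) pointed_Nil level_at_def delayed_action_def)
        qed
        moreover have "?X g t < k n" if "g \<in> carrier G" for g t
          unfolding k_def M
          by (rule run_tiling_bound) (use B0[OF that] d(2) in \<open>auto simp: B_def\<close>)
        moreover have "R n (neighbourhood ?X g t)" if "g \<in> carrier G" for g t
          using valid that unfolding valid_tiling_def R_def by blast
        ultimately show ?thesis
          by (intro exI[of _ "\<lambda>(g, t). ?X g t"]) (auto simp: P(1,2) nbhd)
      qed
    next
      assume "\<exists>x. x \<one>\<^bsub>P\<^esub> = a0 \<and> (\<forall>p\<in>carrier P. x p < k n \<and> R n (\<lambda>j. x (p \<otimes>\<^bsub>P\<^esub> ps ! j)))"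
      then obtain x where x: "x (\<one>, 0) = a0"
        "\<And>p. p \<in> carrier P \<Longrightarrow> R n (\<lambda>j. x (p \<otimes>\<^bsub>P\<^esub> ps ! j))" by (auto simp: P(2))
      let ?X = "\<lambda>g t. x (g, t)"
      show "n \<notin> oracle_halting ?O"
      proof
        assume "n \<in> oracle_halting ?O"
        then obtain M where M: "n = code_otm M" "accepts_empty ?O M"
          unfolding oracle_halting_def by blast
        have "R n (neighbourhood ?X g t)" if "g \<in> carrier G" for g t
          using x(2)[of "(g, t)"] that by (simp add: nbhd P(1))
        then have valid: "valid_tiling V W (code_otm M) ?X"
          unfolding valid_tiling_def R_def M(1) using is_otm_code_iff by blast
        let ?\<zeta> = "\<lambda>t g. cover (?X g t)"
        have static: "window_code G gs (?\<zeta> t) g \<in> V"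
          "seed (?X g t) = (if window_code G gs (?\<zeta> t) g \<in> W then 1 else 0)"
          if g: "g \<in> carrier G" for g t
        proof -
          have "cover_window ?m (neighbourhood ?X g t) = window_code G gs (?\<zeta> t) g"
            unfolding list_encode_eq by (rule map_cong) simp_all
          then show "window_code G gs (?\<zeta> t) g \<in> V"
            "seed (?X g t) = (if window_code G gs (?\<zeta> t) g \<in> W then 1 else 0)"
            using valid_tilingD(1)[OF valid g, of t] g unfolding static_rule_def by simp_all
        qed
        have same: "window_code G gs (?\<zeta> t) g = window_code G gs (?\<zeta> 0) g" if "g \<in> carrier G" for g t
          unfolding list_encode_eq
          using static_rule_time(3)[OF valid, of _ t] that by (intro map_cong) simp_all
        have seed_one: "seed (?X \<one> 0) = 1" by (simp add: x(1) a0_def)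
        have one: "window_code G gs (?\<zeta> 0) \<one> \<in> W"
        proof (rule ccontr)
          assume "window_code G gs (?\<zeta> 0) \<one> \<notin> W"
          with static(2)[OF one_closed, of 0] have "seed (?X \<one> 0) = 0" by (simp only: if_False)
          then show False using seed_one by simp
        qed
        have "seed (?X g t) = of_bool (g = \<one>)" if g: "g \<in> carrier G" for g t
        proof -
          have "window_code G gs (?\<zeta> 0) g \<in> W \<longleftrightarrow> g = \<one>"
            using unique[of "?\<zeta> 0" g \<one>, OF static(1) g one_closed _ one] one by blast
          then show ?thesis using static(2)[OF g, of t] same[OF g, of t] by (simp only: of_bool_def)
        qed
        moreover have "phase (level_of (?X \<one> 0)) = 1" by (simp add: x(1) a0_def)
        ultimately show False
          using valid_tiling_imp_not_accepts[OF valid] M(2) by blast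
      qed
    qed
  qed
qed

section \<open>Hardness of the domino problems\<close>

text \<open>The languages of domino problems consist of the codes of presentations with empty subshift. A
  code determines its presentation, so it is in the language only for this presentation's sake.\<close>

lemma code_codings_inj:
  assumes \<tau>: "inj_on \<tau> T" and "valid_codings T k fs" "valid_codings T k' fs'"
    and eq: "code_codings \<tau> k fs = code_codings \<tau> k' fs'"
  shows "k = k' \<and> fs = fs'"
proof -
  let ?w = "\<lambda>(w, a). prod_encode (code_word \<tau> w, a)"
  have sub: "set c \<subseteq> lists T \<times> UNIV" if "c \<in> set fs \<union> set fs'" for c
    using assms(2,3) that unfolding valid_codings_def forbidden_set_def pattern_coding_def by auto
  have inj_w: "inj_on ?w (lists T \<times> UNIV)"
    unfolding inj_on_def code_word_def
    by (auto simp: list_encode_eq dest!: map_inj_on intro!: inj_on_subset[OF \<tau>])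
  have "map (\<lambda>c. list_encode (map ?w c)) fs = map (\<lambda>c. list_encode (map ?w c)) fs'"
    and k: "k = k'"
    using eq by (simp_all add: code_codings_def list_encode_eq)
  then have "fs = fs'"
  proof (rule_tac map_inj_on)
    show "inj_on (\<lambda>c. list_encode (map ?w c)) (set fs \<union> set fs')"
    proof (rule inj_onI)
      fix c c' assume c: "c \<in> set fs \<union> set fs'" "c' \<in> set fs \<union> set fs'"
        "list_encode (map ?w c) = list_encode (map ?w c')"
      then have "map ?w c = map ?w c'" by (simp add: list_encode_eq)
      then show "c = c'"
        by (rule map_inj_on) (rule inj_on_subset[OF inj_w], use sub c in blast)
    qed
  qed
  then show ?thesis using k by simp
qed

lemma words_for_places:
  assumes "group K" "sym_gen_set K T" "set ps \<subseteq> carrier K"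
  obtains ws where "set ws \<subseteq> lists T" "map (word_val K) ws = ps"
proof -
  have "\<exists>ws. set ws \<subseteq> lists T \<and> map (word_val K) ws = ps"
    using assms(3)
  proof (induction ps)
    case (Cons p ps)
    then obtain ws where "set ws \<subseteq> lists T" "map (word_val K) ws = ps" by auto
    moreover obtain w where "w \<in> lists T" "word_val K w = p"
      using sym_gen_set_word[OF assms(1,2), of p] Cons.prems by auto
    ultimately show ?case by (intro exI[of _ "w # ws"]) auto
  qed auto
  then show thesis using that by blast
qed

text \<open>Words for the places are fixed once and for all, so passing from rules to presentations is
  computable; nothing need be computed in the group.\<close>

lemma rule_shift_reduction:
  assumes K: "group K" "sym_gen_set K T" "inj_on \<tau> T"
    and R: "set ps \<subseteq> carrier K" "computable_rule (length ps) k R"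
  obtains f where "rec_fun 1 (\<lambda>xs. f (xs ! 0))"
    "\<And>n. f n \<in> DP K T \<tau> \<longleftrightarrow> rule_shift K (k n) ps (R n) = {}"
    "\<And>a n. a < k n \<Longrightarrow> prod_encode (a, f n) \<in> OCDP K T \<tau> \<longleftrightarrow>
       rule_shift K (k n) ps (R n) \<inter> cylinder K {..<k n} a \<one>\<^bsub>K\<^esub> = {}"
proof -
  obtain ws where ws: "set ws \<subseteq> lists T" "map (word_val K) ws = ps"
    using words_for_places[OF K(1,2) R(1)] by blast
  have len: "length ws = length ps" using ws(2) by auto
  have wsK: "set ws \<subseteq> lists (carrier K)"
    using ws(1) K(2) lists_mono[of T "carrier K"] by (auto simp: sym_gen_set_def)
  let ?fs = "\<lambda>n. rule_codings ws (k n) (R n)"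
  let ?f = "\<lambda>n. code_codings \<tau> (k n) (?fs n)"
  have valid: "valid_codings T (k n) (?fs n)" for n
    by (rule valid_rule_codings[OF ws(1)])
  have X: "X_forbid K {..<k n} (forbidden_set (?fs n)) = rule_shift K (k n) ps (R n)" for n
    using R(2) by (intro X_forbid_rule_codings[OF K(1) wsK ws(2)]) (simp add: computable_rule_def len)
  note inj = code_codings_inj[OF K(3) valid]
  show thesis
  proof (rule that[of ?f])
    show "rec_fun 1 (\<lambda>xs. ?f (xs ! 0))"
      using R(2) unfolding computable_rule_def by (intro rec_fun_code_rule_codings) auto
    show "?f n \<in> DP K T \<tau> \<longleftrightarrow> rule_shift K (k n) ps (R n) = {}" for n
    proof
      assume "?f n \<in> DP K T \<tau>"
      then obtain k' fs' where *: "?f n = code_codings \<tau> k' fs'" "valid_codings T k' fs'"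
          "X_forbid K {..<k'} (forbidden_set fs') = {}"
        unfolding DP_def by blast
      then show "rule_shift K (k n) ps (R n) = {}" using inj[OF *(2,1)] X[of n] by blast
    next
      assume "rule_shift K (k n) ps (R n) = {}"
      then have "X_forbid K {..<k n} (forbidden_set (?fs n)) = {}" by (simp only: X)
      then show "?f n \<in> DP K T \<tau>" unfolding DP_def using valid[of n] by blast
    qed
    show "prod_encode (a, ?f n) \<in> OCDP K T \<tau> \<longleftrightarrow>
       rule_shift K (k n) ps (R n) \<inter> cylinder K {..<k n} a \<one>\<^bsub>K\<^esub> = {}" if a: "a < k n" for a n
    proof
      assume "prod_encode (a, ?f n) \<in> OCDP K T \<tau>"
      then obtain a' k' fs' where "prod_encode (a, ?f n) = prod_encode (a', code_codings \<tau> k' fs')"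
          and *: "valid_codings T k' fs'"
          "X_forbid K {..<k'} (forbidden_set fs') \<inter> cylinder K {..<k'} a' \<one>\<^bsub>K\<^esub> = {}"
        unfolding OCDP_def by blast
      then have "a = a'" "?f n = code_codings \<tau> k' fs'" by simp_all
      then show "rule_shift K (k n) ps (R n) \<inter> cylinder K {..<k n} a \<one>\<^bsub>K\<^esub> = {}"
        using inj[OF *(1)] *(2) X[of n] by blast
    next
      assume "rule_shift K (k n) ps (R n) \<inter> cylinder K {..<k n} a \<one>\<^bsub>K\<^esub> = {}"
      then have "X_forbid K {..<k n} (forbidden_set (?fs n)) \<inter> cylinder K {..<k n} a \<one>\<^bsub>K\<^esub> = {}"
        by (simp only: X)
      then show "prod_encode (a, ?f n) \<in> OCDP K T \<tau>" unfolding OCDP_def using valid[of n] a by blast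
    qed
  qed
qed

lemma many_one_reducibleI:
  assumes "rec_fun 1 (\<lambda>xs. f (xs ! 0))" "\<And>n. n \<in> L \<longleftrightarrow> f n \<in> L'"
  shows "many_one_reducible L L'"
proof -
  obtain F where F: "recursive 1 F" "\<And>xs. length xs = 1 \<Longrightarrow> f (xs ! 0) = F xs"
    using assms(1) unfolding rec_fun_def by auto
  have "f x = F [x]" for x using F(2)[of "[x]"] by simp
  then show ?thesis
    unfolding many_one_reducible_def computable_def using F(1) assms(2) by blast
qed

lemma rule_shift_iff:
  assumes "group K" "set ps \<subseteq> carrier K"
    "\<And>c c'. (\<forall>j<length ps. c j = c' j) \<Longrightarrow> R c = R c'"
  shows "restrict x (carrier K) \<in> rule_shift K k ps R \<longleftrightarrow>
    (\<forall>g\<in>carrier K. x g < k \<and> R (\<lambda>j. x (g \<otimes>\<^bsub>K\<^esub> ps ! j)))"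
proof -
  interpret group K by fact
  have "R (\<lambda>j. restrict x (carrier K) (g \<otimes>\<^bsub>K\<^esub> ps ! j)) = R (\<lambda>j. x (g \<otimes>\<^bsub>K\<^esub> ps ! j))"
    if "g \<in> carrier K" for g
    using that assms(2) by (intro assms(3)) (auto simp: subset_iff)
  then show ?thesis unfolding rule_shift_def full_shift_def by auto
qed

theorem theorem3p7:
  fixes G :: "('a, 'm) monoid_scheme" and S :: "'a set" and \<nu> :: "'a \<Rightarrow> nat"
  assumes "group G" and "infinite (carrier G)"
    and "sym_gen_set G S" and "inj_on \<nu> S"
    and "special_symbol_property G S"
  shows "(\<forall>T \<tau>. sym_gen_set (G \<times>\<times> integer_group) T \<and> inj_on \<tau> T \<longrightarrow>
            jump_hard (WP G S \<nu>) (OCDP (G \<times>\<times> integer_group) T \<tau>))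
       \<and> (\<forall>H :: ('b, 'n) monoid_scheme.
            group H \<and> finite (carrier H) \<and> carrier H \<noteq> {\<one>\<^bsub>H\<^esub>} \<longrightarrow>
            (\<forall>T \<tau>. sym_gen_set (free_product (G \<times>\<times> integer_group) H) T \<and> inj_on \<tau> T \<longrightarrow>
               jump_hard (WP G S \<nu>) (DP (free_product (G \<times>\<times> integer_group) H) T \<tau>)))"
proof -
  let ?P = "G \<times>\<times> integer_group" and ?halt = "oracle_halting (WP G S \<nu>)"
  have P: "group ?P" using assms(1) by (simp add: DirProd_group)
  interpret P: group ?P by (rule P)
  obtain ps k R a0 where ps: "set ps \<subseteq> carrier ?P" and R: "computable_rule (length ps) k R"
    and a0: "\<And>n. a0 < k n"
    and red: "\<And>n. n \<notin> ?halt \<longleftrightarrow> (\<exists>x. x \<one>\<^bsub>?P\<^esub> = a0 \<and>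
       (\<forall>p\<in>carrier ?P. x p < k n \<and> R n (\<lambda>j. x (p \<otimes>\<^bsub>?P\<^esub> ps ! j))))"
    using tiling_reduction[OF assms] by blast
  have R_cong: "R n c = R n c'" if "\<forall>j<length ps. c j = c' j" for n c c'
    using R that unfolding computable_rule_def by blast
  show ?thesis
  proof (intro conjI allI impI)
    fix T and \<tau> :: "'a \<times> int \<Rightarrow> nat" assume T: "sym_gen_set ?P T \<and> inj_on \<tau> T"
    obtain f where f: "rec_fun 1 (\<lambda>xs. f (xs ! 0))"
      "\<And>a n. a < k n \<Longrightarrow> prod_encode (a, f n) \<in> OCDP ?P T \<tau> \<longleftrightarrow>
         rule_shift ?P (k n) ps (R n) \<inter> cylinder ?P {..<k n} a \<one>\<^bsub>?P\<^esub> = {}"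
      using rule_shift_reduction[OF P _ _ ps R] T by metis
    have "n \<in> ?halt \<longleftrightarrow> prod_encode (a0, f n) \<in> OCDP ?P T \<tau>" for n
    proof -
      have "n \<notin> ?halt \<longleftrightarrow> (\<exists>x. x \<one>\<^bsub>?P\<^esub> = a0 \<and> restrict x (carrier ?P) \<in> rule_shift ?P (k n) ps (R n))"
        unfolding red by (simp only: rule_shift_iff[OF P ps R_cong])
      also have "\<dots> \<longleftrightarrow> (\<exists>x\<in>rule_shift ?P (k n) ps (R n). x \<one>\<^bsub>?P\<^esub> = a0)"
      proof
        assume "\<exists>x. x \<one>\<^bsub>?P\<^esub> = a0 \<and> restrict x (carrier ?P) \<in> rule_shift ?P (k n) ps (R n)"
        then obtain x where "x \<one>\<^bsub>?P\<^esub> = a0" "restrict x (carrier ?P) \<in> rule_shift ?P (k n) ps (R n)"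
          by blast
        moreover have "restrict x (carrier ?P) \<one>\<^bsub>?P\<^esub> = x \<one>\<^bsub>?P\<^esub>" using P.one_closed by (rule restrict_apply')
        ultimately show "\<exists>x\<in>rule_shift ?P (k n) ps (R n). x \<one>\<^bsub>?P\<^esub> = a0" by metis
      next
        assume "\<exists>x\<in>rule_shift ?P (k n) ps (R n). x \<one>\<^bsub>?P\<^esub> = a0"
        then obtain x where x: "x \<in> rule_shift ?P (k n) ps (R n)" "x \<one>\<^bsub>?P\<^esub> = a0" by blast
        then have "restrict x (carrier ?P) = x"
          unfolding rule_shift_def full_shift_def by (intro PiE_restrict) blast
        then show "\<exists>x. x \<one>\<^bsub>?P\<^esub> = a0 \<and> restrict x (carrier ?P) \<in> rule_shift ?P (k n) ps (R n)"
          using x by metis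
      qed
      also have "\<dots> \<longleftrightarrow> rule_shift ?P (k n) ps (R n) \<inter> cylinder ?P {..<k n} a0 \<one>\<^bsub>?P\<^esub> \<noteq> {}"
        unfolding rule_shift_def cylinder_def by blast
      finally show ?thesis using f(2)[OF a0] by blast
    qed
    moreover have "rec_fun 1 (\<lambda>xs. prod_encode (a0, f (xs ! 0)))"
      by (intro rec_fun_prod_encode rec_fun_const f(1))
    ultimately show "jump_hard (WP G S \<nu>) (OCDP ?P T \<tau>)"
      unfolding jump_hard_def by (intro many_one_reducibleI[where f = "\<lambda>n. prod_encode (a0, f n)"])
  next
    fix H :: "('b, 'n) monoid_scheme" and T and \<tau> :: "(('a \<times> int) + 'b) list set \<Rightarrow> nat"
    assume H: "group H \<and> finite (carrier H) \<and> carrier H \<noteq> {\<one>\<^bsub>H\<^esub>}"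
      and T: "sym_gen_set (free_product ?P H) T \<and> inj_on \<tau> T"
    interpret two_groups ?P H using P H by (simp add: two_groups_def)
    let ?K = "free_product ?P H"
    have K: "group ?K" using group_free_product P H by blast
    interpret K: group ?K by (rule K)
    obtain hs where hs: "set hs = carrier H" using H finite_list by blast
    define qs where "qs = map of_P ps @ map of_H hs"
    \<comment> \<open>The additional condition requires the prescribed symbol somewhere on each coset of \<open>H\<close>.\<close>
    define R' where "R' n c \<longleftrightarrow> R n c \<and> (\<exists>j<length hs. c (length ps + j) = a0)" for n and c :: "nat \<Rightarrow> nat"
    have qs: "set qs \<subseteq> carrier ?K" "length qs = length ps + length hs"
      using ps hs of_P_closed of_H_closed by (auto simp: qs_def)
    have qs_nth: "j < length ps \<Longrightarrow> qs ! j = of_P (ps ! j)"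
      "j < length hs \<Longrightarrow> qs ! (length ps + j) = of_H (hs ! j)" for j
      by (auto simp: qs_def nth_append)
    have R'_cong: "R' n c = R' n c'" if "\<forall>j<length qs. c j = c' j" for n c c'
      using R_cong[of c c' n] that unfolding R'_def qs(2) by auto
    have "dec_pred 2 (\<lambda>xs. R' (xs ! 0) (\<lambda>j. code_nth j (xs ! 1)))"
      unfolding R'_def
      by (intro dec_pred_conj dec_pred_bounded_ex dec_pred_eq rec_fun_code_nth rec_fun_const rec_fun_proj)
        (use R in \<open>simp_all add: computable_rule_def\<close>)
    then have R': "computable_rule (length qs) k R'"
      using R R'_cong unfolding computable_rule_def by blast
    obtain f where f: "rec_fun 1 (\<lambda>xs. f (xs ! 0))"
      "\<And>n. f n \<in> DP ?K T \<tau> \<longleftrightarrow> rule_shift ?K (k n) qs (R' n) = {}"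
      using rule_shift_reduction[OF K _ _ qs(1) R'] T by metis
    have "n \<notin> ?halt \<longleftrightarrow> rule_shift ?K (k n) qs (R' n) \<noteq> {}" for n
    proof
      assume "n \<notin> ?halt"
      then obtain x where x: "x \<one>\<^bsub>?P\<^esub> = a0"
        "\<And>p. p \<in> carrier ?P \<Longrightarrow> x p < k n \<and> R n (\<lambda>j. x (p \<otimes>\<^bsub>?P\<^esub> ps ! j))"
        unfolding red by blast
      let ?y = "\<lambda>\<kappa>. x (P_part \<kappa>)"
      have "R' n (\<lambda>j. ?y (\<kappa> \<otimes>\<^bsub>?K\<^esub> qs ! j))" if \<kappa>: "\<kappa> \<in> carrier ?K" for \<kappa>
        unfolding R'_def
      proof
        have "?y (\<kappa> \<otimes>\<^bsub>?K\<^esub> qs ! j) = x (P_part \<kappa> \<otimes>\<^bsub>?P\<^esub> ps ! j)" if "j < length ps" for j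
          using P_part_closed_mult(2)[OF \<kappa> subsetD[OF ps nth_mem[OF that]]]
          by (simp only: qs_nth(1)[OF that])
        then have "R n (\<lambda>j. ?y (\<kappa> \<otimes>\<^bsub>?K\<^esub> qs ! j)) = R n (\<lambda>j. x (P_part \<kappa> \<otimes>\<^bsub>?P\<^esub> ps ! j))"
          by (intro R_cong) simp
        then show "R n (\<lambda>j. ?y (\<kappa> \<otimes>\<^bsub>?K\<^esub> qs ! j))"
          using x(2)[OF P_part_closed_mult(1)[OF \<kappa>]] by simp
        \<comment> \<open>If the last syllable is in \<open>P\<close>, then a non-trivial element of \<open>H\<close> takes its place.\<close>
        obtain h where h: "h \<in> carrier H" "P_part (\<kappa> \<otimes>\<^bsub>?K\<^esub> of_H h) = \<one>\<^bsub>?P\<^esub>"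
        proof (cases "P_part \<kappa> = \<one>\<^bsub>?P\<^esub>")
          case True
          then show thesis using that[of "\<one>\<^bsub>H\<^esub>"] \<kappa> by (simp add: of_H_one)
        next
          case False
          obtain h where "h \<in> carrier H" "h \<noteq> \<one>\<^bsub>H\<^esub>" using H H.one_closed by blast
          then show thesis using that P_part_closed_mult(3)[OF \<kappa> False] by blast
        qed
        then show "\<exists>j<length hs. ?y (\<kappa> \<otimes>\<^bsub>?K\<^esub> qs ! (length ps + j)) = a0"
          using hs x(1) qs_nth(2) by (metis in_set_conv_nth)
      qed
      then have "restrict ?y (carrier ?K) \<in> rule_shift ?K (k n) qs (R' n)"
        using x(2)[OF P_part_closed_mult(1)]
        by (intro rule_shift_iff[OF K qs(1) R'_cong, THEN iffD2] ballI conjI) simp_all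
      then show "rule_shift ?K (k n) qs (R' n) \<noteq> {}" by blast
    next
      assume "rule_shift ?K (k n) qs (R' n) \<noteq> {}"
      then obtain y where y: "y \<in> full_shift ?K {..<k n}"
        "\<And>\<kappa>. \<kappa> \<in> carrier ?K \<Longrightarrow> R' n (\<lambda>j. y (\<kappa> \<otimes>\<^bsub>?K\<^esub> qs ! j))"
        unfolding rule_shift_def by blast
      obtain j where j: "j < length hs" "y (\<one>\<^bsub>?K\<^esub> \<otimes>\<^bsub>?K\<^esub> qs ! (length ps + j)) = a0"
        using y(2)[OF K.one_closed] unfolding R'_def by blast
      let ?\<kappa> = "of_H (hs ! j)"
      have \<kappa>: "?\<kappa> \<in> carrier ?K" using j(1) hs of_H_closed nth_mem by blast
      let ?x = "\<lambda>p. y (?\<kappa> \<otimes>\<^bsub>?K\<^esub> of_P p)"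
      have "?x \<one>\<^bsub>?P\<^esub> = a0" using j \<kappa> qs_nth(2) of_P_one by simp
      moreover have "?x p < k n \<and> R n (\<lambda>j. ?x (p \<otimes>\<^bsub>?P\<^esub> ps ! j))" if p: "p \<in> carrier ?P" for p
      proof
        have \<kappa>p: "?\<kappa> \<otimes>\<^bsub>?K\<^esub> of_P p \<in> carrier ?K" using \<kappa> of_P_closed[OF p] by blast
        then show "?x p < k n" using y(1) by (auto simp: full_shift_def)
        have "?x (p \<otimes>\<^bsub>?P\<^esub> ps ! j) = y ((?\<kappa> \<otimes>\<^bsub>?K\<^esub> of_P p) \<otimes>\<^bsub>?K\<^esub> qs ! j)" if "j < length ps" for j
        proof -
          have pj: "ps ! j \<in> carrier ?P" using ps nth_mem[OF that] by blast
          show ?thesis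
            using \<kappa> of_P_closed[OF p] of_P_closed[OF pj]
            by (simp only: qs_nth(1)[OF that] of_P_mult[OF p pj] K.m_assoc)
        qed
        then have "R n (\<lambda>j. ?x (p \<otimes>\<^bsub>?P\<^esub> ps ! j)) = R n (\<lambda>j. y ((?\<kappa> \<otimes>\<^bsub>?K\<^esub> of_P p) \<otimes>\<^bsub>?K\<^esub> qs ! j))"
          by (intro R_cong) simp
        then show "R n (\<lambda>j. ?x (p \<otimes>\<^bsub>?P\<^esub> ps ! j))"
          using y(2)[OF \<kappa>p] unfolding R'_def by simp
      qed
      ultimately show "n \<notin> ?halt" unfolding red by (intro exI[of _ ?x]) blast
    qed
    then have "n \<in> ?halt \<longleftrightarrow> f n \<in> DP ?K T \<tau>" for n using f(2) by blast
    then show "jump_hard (WP G S \<nu>) (DP ?K T \<tau>)"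
      unfolding jump_hard_def using f(1) many_one_reducibleI by blast
  qed
qed

end
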